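(* For every positive integer $n$, \[ W_{13}(n)=\frac{1}{408}\sigma_3(n)+\frac{169}{408}\sigma_3\left(\frac{n}{13}\right)-\frac{1}{52}n\sigma_1(n)-\frac{1}{4}n\sigma_1\left(\frac{n}{13}\right)+\frac{1}{24}\sigma_1(n)+\frac{1}{24}\sigma_1\left(\frac{n}{13}\right)+\frac{u-6}{442}\tau_{4,13,2}(n)-\frac{u+5}{442}\tau_{4,13,3}(n). \]
   Context: For positive integers $j,n$ let $\sigma_j(n)=\sum_{d\mid n}d^j$; set $\sigma_j(x)=0$ for $x\notin\mathbb{N}^*$. For $N\in\mathbb{N}^*$ let $W_N(n)=\sum_{m}\sigma_1(m)\sigma_1(n-Nm)$, summed over positive integers $m<n/N$. Write $q=e^{2\pi iz}$. The set of primitive forms (normalized newforms, Hecke eigenforms with first coefficient $1$) of weight $4$ on $\Gamma_0(13)$ has three elements: one with rational coefficients, and two with coefficients in $\mathbb{Q}(u)$, where $u$ is a fixed root of $X^2-X-4$. Let $\Delta_{4,13,2}=q+(1-u)q^2+O(q^3)$ and $\Delta_{4,13,3}=q+uq^2+O(q^3)$ be the latter two, and write $\Delta_{4,13,i}=\sum_{n\ge1}\tau_{4,13,i}(n)q^n$. *)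

theory Defs
  imports "HOL-Complex_Analysis.Complex_Analysis"
begin

definition divisor_sigma :: "nat \<Rightarrow> real \<Rightarrow> nat" where
  "divisor_sigma j x = (if x \<in> \<nat> \<and> x > 0 then (\<Sum>d | d dvd nat \<lfloor>x\<rfloor>. d ^ j) else 0)"

definition conv_sum :: "nat \<Rightarrow> nat \<Rightarrow> nat" where
  "conv_sum N n = (\<Sum>m | 0 < m \<and> real m < real n / real N.
     divisor_sigma 1 (real m) * divisor_sigma 1 (real n - real N * real m))"

definition upper_half_plane :: "complex set" where
  "upper_half_plane = {z. Im z > 0}"

definition SL2Z :: "(int ^ 2 ^ 2) set" where
  "SL2Z = {A. det A = 1}"

definition Gamma0 :: "nat \<Rightarrow> (int ^ 2 ^ 2) set" where
  "Gamma0 N = {A \<in> SL2Z. int N dvd A $ 2 $ 1}"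

definition automorphy :: "int ^ 2 ^ 2 \<Rightarrow> complex \<Rightarrow> complex" where
  "automorphy A z = of_int (A $ 2 $ 1) * z + of_int (A $ 2 $ 2)"

definition moebius :: "int ^ 2 ^ 2 \<Rightarrow> complex \<Rightarrow> complex" where
  "moebius A z = (of_int (A $ 1 $ 1) * z + of_int (A $ 1 $ 2)) / automorphy A z"

definition slash :: "nat \<Rightarrow> (complex \<Rightarrow> complex) \<Rightarrow> int ^ 2 ^ 2 \<Rightarrow> complex \<Rightarrow> complex" where
  "slash k f A z = f (moebius A z) / automorphy A z ^ k"

text \<open>
  Functions on the upper half plane are represented by total functions whose values elsewhere
  are irrelevant. Vanishing at the cusps: since \<open>SL2Z\<close> permutes the cusps transitively, it is
  required that every \<open>slash k f A\<close> tends to \<open>0\<close> as the imaginary part tends to infinity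
  (uniformly in the real part), that is, has an expansion in fractional powers of
  \<open>exp (2 \<pi> i z)\<close> with only positive exponents.
\<close>

definition cusp_forms :: "nat \<Rightarrow> nat \<Rightarrow> (complex \<Rightarrow> complex) set" where
  "cusp_forms k N = {f. f holomorphic_on upper_half_plane \<and>
     (\<forall>A\<in>Gamma0 N. \<forall>z\<in>upper_half_plane. slash k f A z = f z) \<and>
     (\<forall>A\<in>SL2Z. (slash k f A \<longlongrightarrow> 0) (filtercomap Im at_top))}"

definition has_q_expansion :: "(complex \<Rightarrow> complex) \<Rightarrow> (nat \<Rightarrow> complex) \<Rightarrow> bool" where
  "has_q_expansion f a \<longleftrightarrow>
     (\<forall>z\<in>upper_half_plane. (\<lambda>n. a n * exp (2 * of_real pi * \<i> * z) ^ n) sums f z)"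

text \<open>
  The Hecke operator \<open>T\<^sub>n\<close> of level \<open>N\<close> and trivial character. The condition \<open>coprime a N\<close>
  makes it the operator \<open>U\<^sub>p\<close> when \<open>n = p\<close> is a prime dividing \<open>N\<close>.
\<close>

definition hecke_op ::
    "nat \<Rightarrow> nat \<Rightarrow> nat \<Rightarrow> (complex \<Rightarrow> complex) \<Rightarrow> complex \<Rightarrow> complex" where
  "hecke_op k N n f z =
     (\<Sum>a | a dvd n \<and> coprime a N. of_nat a ^ k *
        (\<Sum>b<n div a. f ((of_nat a * z + of_nat b) / of_nat (n div a)))) / of_nat n"

definition hecke_eigenform :: "nat \<Rightarrow> nat \<Rightarrow> (complex \<Rightarrow> complex) \<Rightarrow> bool" where
  "hecke_eigenform k N f \<longleftrightarrow>
     (\<exists>z\<in>upper_half_plane. f z \<noteq> 0) \<and>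
     (\<forall>n>0. \<exists>c. \<forall>z\<in>upper_half_plane. hecke_op k N n f z = c * f z)"

definition modular_fundamental_domain :: "complex set" where
  "modular_fundamental_domain = {z \<in> upper_half_plane. \<bar>Re z\<bar> \<le> 1 / 2 \<and> cmod z \<ge> 1}"

definition Gamma0_cosets :: "nat \<Rightarrow> (int ^ 2 ^ 2) set set" where
  "Gamma0_cosets N = (\<lambda>A. (\<lambda>B. B ** A) ` Gamma0 N) ` SL2Z"

text \<open>
  The translates of the fundamental domain of \<open>SL2Z\<close> by representatives of the right cosets of
  \<open>Gamma0 N\<close> form a fundamental domain of \<open>Gamma0 N\<close>. The integrand is \<open>Gamma0 N\<close>-invariant, so
  the choice of representatives does not matter, and the invariant measure is
  \<open>dx dy / y\<^sup>2\<close>. The product is not divided by the volume, which is immaterial for orthogonality.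
\<close>

definition petersson ::
    "nat \<Rightarrow> nat \<Rightarrow> (complex \<Rightarrow> complex) \<Rightarrow> (complex \<Rightarrow> complex) \<Rightarrow> complex" where
  "petersson k N f g =
     (\<Sum>C\<in>Gamma0_cosets N. LINT z : modular_fundamental_domain | lborel.
        (let w = moebius (SOME A. A \<in> C) z
         in f w * cnj (g w) * of_real (Im w ^ k)) / of_real (Im z ^ 2))"

definition old_generators :: "nat \<Rightarrow> nat \<Rightarrow> (complex \<Rightarrow> complex) set" where
  "old_generators k N =
     {(\<lambda>z. f (of_nat d * z)) | f d M. M < N \<and> M * d dvd N \<and> f \<in> cusp_forms k M}"

definition old_subspace :: "nat \<Rightarrow> nat \<Rightarrow> (complex \<Rightarrow> complex) set" where
  "old_subspace k N =
     {(\<lambda>z. \<Sum>g\<in>G. c g * g z) | c G. finite G \<and> G \<subseteq> old_generators k N}"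

definition new_subspace :: "nat \<Rightarrow> nat \<Rightarrow> (complex \<Rightarrow> complex) set" where
  "new_subspace k N = {f \<in> cusp_forms k N. \<forall>g\<in>old_subspace k N. petersson k N f g = 0}"

definition primitive_form :: "nat \<Rightarrow> nat \<Rightarrow> (complex \<Rightarrow> complex) \<Rightarrow> bool" where
  "primitive_form k N f \<longleftrightarrow> f \<in> new_subspace k N \<and> hecke_eigenform k N f \<and>
     (\<exists>a. has_q_expansion f a \<and> a 1 = 1)"

end

(*
  With P = E_2, the form E(z) = (13 P(13z) - P(z)) / 12 is modular of weight 2 for Gamma_0(13), and
  Ramanujan's identity P^2 = E_4 + 12 q dP/dq turns the generating function of W_13, which is
  (1 - P(z)) (1 - P(13z)) / 576, into Eisenstein series, derivatives of P and E^2. Up to E_4(z) and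
  E_4(13z), E^2 is a cusp form G invariant under the Fricke involution z -> -1/(13z).
  A Fricke-symmetric form vanishing to high order at infinity is 0: the product of its 14 conjugates
  is a form of level 1, and a suitable power of that divided by a power of the discriminant has a
  maximum modulus on the upper half plane.
  An eigenform of U_13 is a Fricke eigenform because its trace to level 1 vanishes. Comparing the
  square of such an eigenform with squares of combinations of G and T_2 G shows that it is itself
  such a combination, determined by its second coefficient; so G is a combination of the two given
  newforms.
*)
theory Submission
  imports Defs
begin

section \<open>Lattice sums and the Eisenstein series of weight 2 and 4\<close>

text \<open>The vanishing criterion reads the expansion at infinity only, while
  \<open>Gamma0 13\<close> has two cusps; Fricke symmetry carries the order of vanishing from one to
  the other. In weight 4 it asks for agreement through q^2, so a newform and a combination of
  \<open>G13\<close> and \<open>T2 G13\<close> with the same first two coefficients would coincide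
  at once if both had Fricke eigenvalue 1. The sign for the newform is not known beforehand.
  Squaring removes it, at a price: weight 8 asks for agreement through q^4. The Hecke relation at 2
  and the equation X^2 - X - 4 = 0 settle the coefficient of q^4; the unknown one of q^3 is
  eliminated with a multiple of a known square. The product P(z) P(13z) is reached by polarisation,
  from 26 P(z) P(13z) = P(z)^2 + 169 P(13z)^2 - (13 P(13z) - P(z))^2. The form of weight 2 is
  modular as the logarithmic derivative of Delta(13z) / Delta(z), and Delta is built as an
  exponential, so that it has no zeros and can serve as a denominator.\<close>

lemma open_upper_half_plane: "open upper_half_plane"
  unfolding upper_half_plane_def by (rule open_halfspace_Im_gt)

lemma connected_upper_half_plane: "connected upper_half_plane"
  unfolding upper_half_plane_def by (intro convex_connected convex_halfspace_Im_gt)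

lemma upper_half_plane_iff [simp]: "z \<in> upper_half_plane \<longleftrightarrow> Im z > 0"
  by (simp add: upper_half_plane_def)

lemma eventually_nhds_Im_pos: "Im z > 0 \<Longrightarrow> eventually (\<lambda>w. Im w > 0) (nhds z)"
  using open_upper_half_plane by (auto simp: eventually_nhds upper_half_plane_def)

lemma not_Ints_of_Im_pos: "Im z > 0 \<Longrightarrow> z \<notin> \<int>"
  by (auto elim!: Ints_cases)

lemma Im_inverse_neg: "Im z > 0 \<Longrightarrow> Im (inverse z) < 0"
  by (simp add: divide_neg_pos sum_power2_gt_zero_iff)

lemma Im_uminus_inverse_pos: "Im z > 0 \<Longrightarrow> Im (-1 / z) > 0"
  using Im_inverse_neg[of z] by (simp add: divide_inverse del: inverse_complex.sel)

definition nome :: "complex \<Rightarrow> complex" where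
  "nome z = exp (2 * of_real pi * \<i> * z)"

lemma norm_nome: "norm (nome z) = exp (- 2 * pi * Im z)"
  by (simp add: nome_def)

lemma norm_nome_less_1: "Im z > 0 \<Longrightarrow> norm (nome z) < 1"
  by (simp add: norm_nome)

lemma nome_nz [simp]: "nome z \<noteq> 0"
  by (simp add: nome_def)

lemma nome_add: "nome (z + w) = nome z * nome w"
  by (simp add: nome_def ring_distribs exp_add)

lemma nome_of_nat_mult: "nome (of_nat m * z) = nome z ^ m"
  by (simp add: nome_def exp_of_nat_mult [symmetric] mult_ac)

lemma nome_1 [simp]: "nome 1 = 1"
  by (simp add: nome_def exp_two_pi_i mult_ac)

lemma nome_plus1 [simp]: "nome (z + 1) = nome z"
  by (simp add: nome_add)

lemma has_field_derivative_nome [derivative_intros]: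
  "(nome has_field_derivative 2 * of_real pi * \<i> * nome z) (at z within A)"
  unfolding nome_def by (auto intro!: derivative_eq_intros)

section \<open>Cotangent and polygamma functions as power series in the nome\<close>

lemma Digamma_reflection:
  fixes z :: complex
  assumes "z \<notin> \<int>"
  shows "Digamma z - Digamma (1 - z) = - of_real pi * cot (of_real pi * z)"
proof -
  have nz: "sin (of_real pi * z) \<noteq> 0"
  proof
    assume "sin (of_real pi * z) = 0"
    then obtain n :: int where "of_real pi * z = of_real (of_int n * pi)"
      by (auto simp: sin_eq_0)
    hence "of_real pi * z = of_real pi * of_int n" by simp
    hence "z = of_int n" by (subst (asm) mult_cancel_left) auto
    with assms show False by simp
  qed
  have z: "z \<notin> \<int>\<^sub>\<le>\<^sub>0" "1 - z \<notin> \<int>\<^sub>\<le>\<^sub>0"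
    using assms nonpos_Ints_Int[of z] nonpos_Ints_Int[of "1 - z"] by (auto dest: Ints_diff[OF Ints_1])
  have "((\<lambda>w. Gamma w * Gamma (1 - w)) has_field_derivative
      Gamma z * Gamma (1 - z) * (Digamma z - Digamma (1 - z))) (at z)"
    using z by (auto intro!: derivative_eq_intros simp: algebra_simps)
  moreover have "((\<lambda>w. of_real pi / sin (of_real pi * w)) has_field_derivative
      (- (of_real pi ^ 2) * cos (of_real pi * z) / sin (of_real pi * z) ^ 2)) (at z)"
    using nz by (auto intro!: derivative_eq_intros simp: power2_eq_square field_simps)
  ultimately have eq: "of_real pi / sin (of_real pi * z) * (Digamma z - Digamma (1 - z)) =
      - (of_real pi ^ 2) * cos (of_real pi * z) / sin (of_real pi * z) ^ 2"
    unfolding Gamma_reflection_complex by (rule DERIV_unique)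
  have aux: "d = - p * (c / s)" if "p / s * d = - (p ^ 2) * c / s ^ 2" "s \<noteq> 0" "p \<noteq> 0" for p s c d :: complex
  proof -
    have "p * (d * s) = p * (- (p * c))"
      using that by (simp add: divide_simps power2_eq_square mult_ac)
    hence "d * s = - (p * c)"
      using that by (subst (asm) mult_cancel_left) auto
    thus ?thesis using that by (simp add: divide_simps)
  qed
  show ?thesis
    unfolding cot_def by (rule aux[OF eq nz]) simp
qed

lemma cot_nome:
  assumes "Im z > 0"
  shows "cot (of_real pi * z) = - \<i> * (1 + nome z) / (1 - nome z)"
proof -
  define e where "e = exp (\<i> * (of_real pi * z))"
  have e: "nome z = e * e" "e \<noteq> 0"
    by (simp_all add: nome_def e_def exp_add [symmetric] mult_ac)
  have q1: "nome z \<noteq> 1"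
    using norm_nome_less_1[OF assms] by auto
  have "exp (- (\<i> * (of_real pi * z))) = 1 / e"
    by (simp add: e_def exp_minus field_simps)
  hence "cot (of_real pi * z) = ((e + 1 / e) / 2) / ((e - 1 / e) / (2 * \<i>))"
    unfolding cot_def sin_exp_eq cos_exp_eq e_def [symmetric] by simp
  also have "\<dots> = \<i> * ((e + 1 / e) / (e - 1 / e))"
  proof -
    have "a / 2 / (b / (2 * \<i>)) = \<i> * (a / b)" for a b
      by (cases "b = 0") (simp_all add: field_simps)
    thus ?thesis .
  qed
  also have "(e + 1 / e) / (e - 1 / e) = (nome z + 1) / (nome z - 1)"
  proof -
    have "e - 1 / e = (nome z - 1) / e" "e + 1 / e = (nome z + 1) / e"
      using e by (simp_all add: divide_simps)
    thus ?thesis using e by simp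
  qed
  also have "\<i> * ((nome z + 1) / (nome z - 1)) = - \<i> * (1 + nome z) / (1 - nome z)"
    using q1 by (simp add: divide_simps) (simp add: algebra_simps)
  finally show ?thesis .
qed

text \<open>The constant term of \<open>pow_fps 0\<close> is \<open>0 ^ 0 = 1\<close>, which makes
  it the full geometric series; for \<open>j > 0\<close> it is 0.\<close>

definition pow_fps :: "nat \<Rightarrow> complex fps" where
  "pow_fps j = Abs_fps (\<lambda>k. of_nat k ^ j)"

lemma pow_fps_Suc: "pow_fps (Suc j) = fps_X * fps_deriv (pow_fps j)"
  by (rule fps_ext) (auto simp: pow_fps_def gr0_conv_Suc)

lemma conv_radius_pow_fps: "fps_conv_radius (pow_fps j) \<ge> 1"
proof (induction j)
  case 0
  have "summable (\<lambda>k. x ^ k)" if "norm x < 1" for x :: complex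
    using that by (rule summable_geometric)
  show ?case
    unfolding fps_conv_radius_def pow_fps_def
  proof (rule conv_radius_geI_ex)
    fix r :: real assume r: "0 < r" "ereal r < 1"
    thus "\<exists>z :: complex. norm z = r \<and> summable (\<lambda>n. fps_nth (Abs_fps (\<lambda>k. of_nat k ^ 0)) n * z ^ n)"
      by (intro exI[of _ "of_real r"]) (auto simp: summable_geometric one_ereal_def)
  qed
next
  case (Suc j)
  have "1 \<le> fps_conv_radius (fps_deriv (pow_fps j))"
    using Suc fps_conv_radius_deriv order_trans by blast
  thus ?case
    unfolding pow_fps_Suc using fps_conv_radius_mult[of fps_X "fps_deriv (pow_fps j)"]
    by (auto simp: min_def split: if_splits)
qed

lemma eval_fps_nome_deriv:
  assumes F: "fps_conv_radius F \<ge> 1" and z: "Im z > 0"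
  shows "((\<lambda>w. eval_fps F (nome w)) has_field_derivative
           2 * of_real pi * \<i> * eval_fps (fps_X * fps_deriv F) (nome z)) (at z)"
proof -
  have n: "ereal (norm (nome z)) < 1"
    using norm_nome_less_1[OF z] by simp
  have r: "ereal (norm (nome z)) < fps_conv_radius F"
          "ereal (norm (nome z)) < fps_conv_radius (fps_deriv F)"
    using less_le_trans[OF n F] less_le_trans[OF n order_trans[OF F fps_conv_radius_deriv]] by auto
  have "((\<lambda>w. eval_fps F (nome w)) has_field_derivative
           eval_fps (fps_deriv F) (nome z) * (2 * of_real pi * \<i> * nome z)) (at z)"
    using r by (intro DERIV_chain2[where f = "eval_fps F"] has_field_derivative_eval_fps
                      has_field_derivative_nome)
  also have "eval_fps (fps_deriv F) (nome z) * (2 * of_real pi * \<i> * nome z) =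
             2 * of_real pi * \<i> * eval_fps (fps_X * fps_deriv F) (nome z)"
    using r by (simp add: eval_fps_mult mult_ac)
  finally show ?thesis .
qed

lemma eval_pow_fps_0: "norm x < 1 \<Longrightarrow> eval_fps (pow_fps 0) x = 1 / (1 - x)"
  unfolding eval_fps_def pow_fps_def by (simp add: suminf_geometric)

text \<open>This is Lipschitz's formula in closed form. Each derivative of the reflection formula
  for \<open>Digamma\<close> turns k^n into k^(n + 1) on the nome side; the constant of the
  cotangent disappears with the first derivative.\<close>

lemma Polygamma_reflection_nome:
  assumes "Im z > 0"
  shows "Polygamma n z + (-1) ^ Suc n * Polygamma n (1 - z) =
           (2 * of_real pi * \<i>) ^ Suc n * eval_fps (pow_fps n) (nome z) -
           (if n = 0 then of_real pi * \<i> else 0)"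
  using assms
proof (induction n arbitrary: z)
  case 0
  have "nome z \<noteq> 1" using norm_nome_less_1[OF 0] by auto
  moreover have "- p * (- \<i> * (1 + x) / (1 - x)) = 2 * p * \<i> * (1 / (1 - x)) - p * \<i>"
    if "x \<noteq> 1" for p x :: complex
    using that by (simp add: divide_simps) (simp add: algebra_simps)
  ultimately show ?case
    using Digamma_reflection[OF not_Ints_of_Im_pos[OF 0]]
    unfolding eval_pow_fps_0[OF norm_nome_less_1[OF 0]] cot_nome[OF 0]
    by simp
next
  case (Suc n)
  note z = \<open>Im z > 0\<close>
  have z': "z \<notin> \<int>\<^sub>\<le>\<^sub>0" "1 - z \<notin> \<int>\<^sub>\<le>\<^sub>0"
    using not_Ints_of_Im_pos[OF z] nonpos_Ints_Int[of z] nonpos_Ints_Int[of "1 - z"]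
    by (auto dest: Ints_diff[OF Ints_1])
  define c :: complex where "c = (if n = 0 then of_real pi * \<i> else 0)"
  have "((\<lambda>z. Polygamma n z + (-1) ^ Suc n * Polygamma n (1 - z)) has_field_derivative
          Polygamma (Suc n) z + (-1) ^ Suc (Suc n) * Polygamma (Suc n) (1 - z)) (at z)"
    using z' by (auto intro!: derivative_eq_intros)
  moreover have "((\<lambda>z. (2 * of_real pi * \<i>) ^ Suc n * eval_fps (pow_fps n) (nome z) - c)
          has_field_derivative (2 * of_real pi * \<i>) ^ Suc n * (2 * of_real pi * \<i> * 
             eval_fps (fps_X * fps_deriv (pow_fps n)) (nome z)) - 0) (at z)"
    by (intro DERIV_diff DERIV_cmult eval_fps_nome_deriv conv_radius_pow_fps z DERIV_const)
  moreover have "\<forall>\<^sub>F w in nhds z. Polygamma n w + (-1) ^ Suc n * Polygamma n (1 - w) =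
      (2 * of_real pi * \<i>) ^ Suc n * eval_fps (pow_fps n) (nome w) - c"
    using eventually_nhds_Im_pos[OF z]
    unfolding c_def by (rule eventually_mono) (rule Suc.IH)
  note DERIV_cong_ev[OF refl this refl]
  ultimately have "Polygamma (Suc n) z + (-1) ^ Suc (Suc n) * Polygamma (Suc n) (1 - z) =
     (2 * of_real pi * \<i>) ^ Suc n * (2 * of_real pi * \<i> * 
             eval_fps (fps_X * fps_deriv (pow_fps n)) (nome z)) - 0"
    using DERIV_unique by blast
  thus ?case by (simp add: pow_fps_Suc mult_ac)
qed

section \<open>Sums over the integers and absolute convergence of lattice sums\<close>

lemma has_sum_int:
  fixes f :: "int \<Rightarrow> complex"
  assumes "f summable_on UNIV"
    and a: "(\<lambda>k. f (int k)) sums a" and b: "(\<lambda>k. f (- 1 - int k)) sums b"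
  shows "(f has_sum (a + b)) UNIV"
proof -
  have sub: "f summable_on A" for A
    using assms(1) by (rule summable_on_subset_banach) auto
  have inj: "inj int" "inj (\<lambda>k. - 1 - int k)"
    by (auto intro!: injI)
  have 1: "(f has_sum a) (range int)"
  proof -
    obtain a' where a': "(f has_sum a') (range int)"
      using sub unfolding summable_on_def by blast
    hence "((\<lambda>k. f (int k)) has_sum a') UNIV"
      using has_sum_reindex[OF inj(1), of f a'] by (simp add: o_def)
    with a have "a' = a"
      using has_sum_imp_sums sums_unique2 by blast
    with a' show ?thesis by simp
  qed
  have 2: "(f has_sum b) (range (\<lambda>k. - 1 - int k))"
  proof -
    obtain a' where a': "(f has_sum a') (range (\<lambda>k. - 1 - int k))"
      using sub unfolding summable_on_def by blast
    hence "((\<lambda>k. f (- 1 - int k)) has_sum a') UNIV"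
      using has_sum_reindex[OF inj(2), of f a'] by (simp add: o_def)
    with b have "a' = b"
      using has_sum_imp_sums sums_unique2 by blast
    with a' show ?thesis by simp
  qed
  have "x \<in> range int \<union> range (\<lambda>k. - 1 - int k)" for x
  proof (cases "x \<ge> 0")
    case True thus ?thesis by (auto intro: image_eqI[of _ _ "nat x"])
  next
    case False thus ?thesis by (auto intro!: image_eqI[of _ _ "nat (- 1 - x)"])
  qed
  hence "range int \<union> range (\<lambda>k. - 1 - int k) = UNIV" by blast
  moreover have "range int \<inter> range (\<lambda>k. - 1 - int k) = {}" by auto
  ultimately show ?thesis
    using has_sum_Un_disjoint[OF 1 2] by simp
qed

lemma summable_inverse_square_int: "(\<lambda>n::int. 1 / (1 + real_of_int n ^ 2)) summable_on UNIV"
proof -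
  have "summable (\<lambda>k. 4 * (1 / (real k + 1) ^ 2))"
    using inverse_squares_sums by (intro summable_mult) (simp add: sums_iff add.commute)
  moreover have "norm (1 / (1 + real k ^ 2)) \<le> 4 * (1 / (real k + 1) ^ 2)" for k
  proof -
    have "(real k + 1) ^ 2 \<le> 4 * (1 + real k ^ 2)"
      using zero_le_power2[of "real k - 1"] by (simp add: power2_eq_square algebra_simps)
    moreover have "0 < (real k + 1) ^ 2" "0 < 1 + real k ^ 2"
      by (auto intro: add_pos_nonneg)
    ultimately show ?thesis by (simp add: divide_simps)
  qed
  ultimately have s: "summable (\<lambda>k. 1 / (1 + real k ^ 2))"
    by (intro summable_comparison_test[of "\<lambda>k. 1 / (1 + real k ^ 2)"]) auto
  have A: "(\<lambda>n::int. 1 / (1 + real_of_int n ^ 2)) summable_on range int"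
    using s by (subst summable_on_reindex) (auto simp: o_def intro!: norm_summable_imp_summable_on)
  have B: "(\<lambda>n::int. 1 / (1 + real_of_int n ^ 2)) summable_on range (\<lambda>k. - int k)"
    using s by (subst summable_on_reindex) (auto simp: o_def inj_on_def intro!: norm_summable_imp_summable_on)
  have "x \<in> range int \<union> range (\<lambda>k. - int k)" for x
  proof (cases "x \<ge> 0")
    case True thus ?thesis by (auto intro: image_eqI[of _ _ "nat x"])
  next
    case False thus ?thesis by (auto intro!: image_eqI[of _ _ "nat (- x)"])
  qed
  hence "range int \<union> range (\<lambda>k. - int k) = UNIV" by blast
  with summable_on_union[OF A B] show ?thesis by simp
qed

text \<open>|x z + y|^2 is a positive definite quadratic form in (x, y). The constant comes from y^2
  <= 2 (x Re z + y)^2 + 2 (x Re z)^2 and from absorbing multiples of x^2 into (x Im z)^2.\<close>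

lemma lattice_norm_bound:
  assumes "Im z > 0"
  obtains M where "M > 0" "\<And>x y. x ^ 2 + y ^ 2 \<le> M * norm (of_real x * z + of_real y) ^ 2"
proof -
  define s t where "s = Re z" and "t = Im z"
  define M where "M = 2 + (2 * s ^ 2 + 1) / t ^ 2"
  have t: "t > 0" using assms by (simp add: t_def)
  have M: "M \<ge> 2" by (simp add: M_def)
  have "x ^ 2 + y ^ 2 \<le> M * norm (of_real x * z + of_real y) ^ 2" for x y
  proof -
    have eq: "norm (of_real x * z + of_real y) ^ 2 = (x * s + y) ^ 2 + (x * t) ^ 2"
      by (simp add: cmod_power2 s_def t_def)
    have "y ^ 2 \<le> 2 * (x * s + y) ^ 2 + 2 * (x * s) ^ 2"
      using zero_le_power2[of "2 * x * s + y"] by (simp add: power2_eq_square algebra_simps)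
    moreover have "2 * (x * s) ^ 2 + x ^ 2 = (2 * s ^ 2 + 1) / t ^ 2 * (x * t) ^ 2"
      using t by (simp add: field_simps)
    moreover have "M * ((x * s + y) ^ 2 + (x * t) ^ 2) = 2 * (x * s + y) ^ 2 + 2 * (x * t)^2
         + (2 * s ^ 2 + 1) / t ^ 2 * (x * s + y) ^ 2 + (2 * s ^ 2 + 1) / t ^ 2 * (x * t) ^ 2"
      unfolding M_def ring_distribs by simp
    moreover have "(2 * s ^ 2 + 1) / t ^ 2 * (x * s + y) ^ 2 \<ge> 0" "(x * t)^2 \<ge> 0" by simp_all
    ultimately show ?thesis unfolding eq by linarith
  qed
  with M show ?thesis by (intro that[of M]) auto
qed

lemma summable_on_int_bound:
  fixes f :: "int \<Rightarrow> complex"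
  assumes "\<And>n. norm (f n) \<le> C / (1 + of_int n ^ 2)"
  shows "f summable_on UNIV"
proof (rule abs_summable_summable, rule summable_on_comparison_test)
  show "(\<lambda>n::int. C * (1 / (1 + real_of_int n ^ 2))) summable_on UNIV"
    by (intro summable_on_cmult_right summable_inverse_square_int)
qed (use assms in auto)

text \<open>A product majorant reduces double series to one-dimensional ones, so that lattice points
  need not be counted by size.\<close>

lemma summable_on_int_prod_bound:
  fixes f :: "int \<Rightarrow> int \<Rightarrow> complex"
  assumes "\<And>m n. norm (f m n) \<le> C / ((1 + of_int m ^ 2) * (1 + of_int n ^ 2))"
  shows "(\<lambda>(m, n). f m n) summable_on UNIV \<times> UNIV"
proof (rule abs_summable_summable, rule summable_on_comparison_test)
  let ?w = "\<lambda>n::int. 1 / (1 + real_of_int n ^ 2)"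
  have "(\<lambda>(m, n). ?w m * ?w n) summable_on Sigma UNIV (\<lambda>_. UNIV)"
  proof (rule summable_on_SigmaI)
    show "((\<lambda>n. (\<lambda>(m, n). ?w m * ?w n) (m, n)) has_sum ?w m * infsum ?w UNIV) UNIV" for m
      using has_sum_cmult_right[OF has_sum_infsum[OF summable_inverse_square_int], of "?w m"] by simp
    show "(\<lambda>m. ?w m * infsum ?w UNIV) summable_on UNIV"
      by (intro summable_on_cmult_left summable_inverse_square_int)
  qed auto
  thus "(\<lambda>p. C * (\<lambda>(m, n). ?w m * ?w n) p) summable_on UNIV \<times> UNIV"
    by (intro summable_on_cmult_right) auto
qed (use assms in \<open>auto simp: field_simps\<close>)

lemma square_sum_ge_1:
  fixes m n :: int
  assumes "(m, n) \<noteq> (0, 0)"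
  shows "real_of_int m ^ 2 + real_of_int n ^ 2 \<ge> 1"
proof -
  have "m ^ 2 + n ^ 2 > 0"
    using assms by (simp add: sum_power2_gt_zero_iff)
  hence "real_of_int (m ^ 2 + n ^ 2) \<ge> 1"
    by (subst of_int_1 [symmetric], subst of_int_le_iff) auto
  thus ?thesis by simp
qed

lemma odd_square_bound:
  fixes n :: int
  assumes "e = 1 \<or> e = -1"
  shows "(2 * real_of_int n + of_int e) ^ 2 \<ge> (1 + real_of_int n ^ 2) / 2"
proof -
  have "\<bar>n\<bar> \<le> \<bar>2 * n + e\<bar>" "\<bar>1\<bar> \<le> \<bar>2 * n + e\<bar>"
    using assms by arith+
  hence "n ^ 2 \<le> (2 * n + e) ^ 2" "1 ^ 2 \<le> (2 * n + e) ^ 2"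
    unfolding abs_le_square_iff by auto
  hence "1 + n ^ 2 \<le> 2 * (2 * n + e) ^ 2" by simp
  hence "real_of_int (1 + n ^ 2) \<le> real_of_int (2 * (2 * n + e) ^ 2)"
    by (simp only: of_int_le_iff)
  thus ?thesis by simp
qed

text \<open>(m z + n)^2 - 1/4 is the product of m z + n + 1/2 and m z + n - 1/2. Twice either factor
  is a lattice point with odd second coordinate, hence not 0, so the bound includes m = n =
  0.\<close>

lemma lattice_quarter_bound:
  assumes "Im z > 0"
  obtains C where "C > 0"
    "\<And>m n :: int. 1 + of_int m ^ 2 + of_int n ^ 2 \<le>
       C * norm ((of_int m * z + of_int n) ^ 2 - 1 / 4)"
proof -
  obtain M where M: "M > 0" "\<And>x y. x ^ 2 + y ^ 2 \<le> M * norm (of_real x * z + of_real y) ^ 2"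
    using lattice_norm_bound[OF assms] by blast
  have *: "1 + of_int m ^ 2 + of_int n ^ 2 \<le>
      8 * M * norm (of_int m * z + of_int n + of_int e / 2) ^ 2" if e: "e = 1 \<or> e = -1" for m n e :: int
  proof -
    define X where "X = of_int m * z + of_int n + of_int e / (2 :: complex)"
    have "of_real (2 * of_int m) * z + of_real (2 * real_of_int n + of_int e) = 2 * X"
      by (simp add: X_def algebra_simps)
    hence "(2 * of_int m) ^ 2 + (2 * real_of_int n + of_int e) ^ 2 \<le> M * norm (2 * X) ^ 2"
      using M(2)[of "2 * of_int m" "2 * real_of_int n + of_int e"] by simp
    hence "4 * of_int m ^ 2 + (2 * real_of_int n + of_int e) ^ 2 \<le> 4 * M * norm X ^ 2"
      by (simp add: power_mult_distrib norm_mult)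
    moreover define y where "y = M * norm X ^ 2"
    moreover define a b c where "a = real_of_int m ^ 2" and "b = (2 * real_of_int n + of_int e) ^ 2"
      and "c = real_of_int n ^ 2"
    moreover have "a \<ge> 0" by (simp add: a_def)
    moreover have "(1 + c) / 2 \<le> b"
      using odd_square_bound[OF e, of n] by (simp add: b_def c_def)
    ultimately have "4 * a + b \<le> 4 * y" "(1 + c) / 2 \<le> b" "0 \<le> a" by simp_all
    hence "1 + a + c \<le> 8 * y" by argo
    thus ?thesis by (simp add: a_def c_def y_def X_def)
  qed
  have "1 + of_int m ^ 2 + of_int n ^ 2 \<le> 8 * M * norm ((of_int m * z + of_int n) ^ 2 - 1 / 4)" for m n :: int
  proof (rule power2_le_imp_le)
    define s where "s = 1 + real_of_int m ^ 2 + real_of_int n ^ 2"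
    have "s \<ge> 0" by (simp add: s_def)
    hence "s * s \<le> (8 * M * norm (of_int m * z + of_int n + 1 / 2) ^ 2) *
        (8 * M * norm (of_int m * z + of_int n - 1 / 2) ^ 2)"
      using *[of 1 m n] *[of "-1" m n] M(1) unfolding s_def by (intro mult_mono) auto
    also have "\<dots> = (8 * M * norm ((of_int m * z + of_int n + 1 / 2) * (of_int m * z + of_int n - 1 / 2))) ^ 2"
      by (simp add: power2_eq_square norm_mult)
    also have "(of_int m * z + of_int n + 1 / 2) * (of_int m * z + of_int n - 1 / 2) =
        (of_int m * z + of_int n) ^ 2 - 1 / 4"
      by (simp add: power2_eq_square algebra_simps)
    finally show "s ^ 2 \<le> (8 * M * norm ((of_int m * z + of_int n) ^ 2 - 1 / 4)) ^ 2"
      by (simp add: power2_eq_square)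
  qed (use M(1) in auto)
  thus ?thesis using M(1) by (intro that[of "8 * M"]) auto
qed

text \<open>Converts decay like |m z + n|^(-4) into the product majorant.\<close>

lemma prod_square_bound:
  fixes m n :: int
  defines "s \<equiv> 1 + real_of_int m ^ 2 + real_of_int n ^ 2"
  assumes "C \<ge> 0"
  shows "C / (s * s) \<le> C / ((1 + of_int m ^ 2) * (1 + of_int n ^ 2))"
proof -
  have "(1 + real_of_int m ^ 2) * (1 + of_int n ^ 2) \<le> s * s"
    unfolding s_def by (intro mult_mono) auto
  thus ?thesis
    using assms(2) by (intro divide_left_mono mult_pos_pos) (auto simp: s_def add_pos_nonneg)
qed

lemma summable_lattice_4:
  assumes "Im z > 0"
  shows "(\<lambda>(m::int, n::int). 1 / (of_int m * z + of_int n) ^ 4) summable_on UNIV \<times> UNIV"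
proof -
  obtain M where M: "M > 0" "\<And>x y. x ^ 2 + y ^ 2 \<le> M * norm (of_real x * z + of_real y) ^ 2"
    using lattice_norm_bound[OF assms] by blast
  show ?thesis
  proof (rule summable_on_int_prod_bound[where C = "4 * M ^ 2"])
    fix m n :: int
    define s where "s = 1 + real_of_int m ^ 2 + real_of_int n ^ 2"
    define X where "X = of_int m * z + of_int n"
    show "norm (1 / X ^ 4) \<le> 4 * M ^ 2 / ((1 + of_int m ^ 2) * (1 + of_int n ^ 2))"
    proof (cases "(m, n) = (0, 0)")
      \<comment> \<open>At the origin \<open>1 / 0 = 0\<close>: the excluded term of the classical
        sum is present but contributes nothing.\<close>
      case True
      thus ?thesis by (simp add: X_def)
    next
      case False
      have s: "s > 0" by (simp add: s_def add_pos_nonneg)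
      have "s \<le> 2 * M * norm X ^ 2"
        using square_sum_ge_1[OF False] M(2)[of "of_int m" "of_int n"] by (simp add: s_def X_def)
      hence "s * s \<le> (2 * M * norm X ^ 2) * (2 * M * norm X ^ 2)"
        using s by (intro mult_mono) auto
      hence *: "s * s \<le> 4 * M ^ 2 * norm X ^ 4"
        by (simp add: power2_eq_square eval_nat_numeral mult_ac)
      moreover have "0 < s * s" using s by simp
      ultimately have "norm X ^ 4 \<noteq> 0" by auto
      hence "norm X ^ 4 > 0" by auto
      hence "norm (1 / X ^ 4) \<le> 4 * M ^ 2 / (s * s)"
        using * s by (simp add: norm_divide norm_power divide_simps)
      also have "\<dots> \<le> 4 * M ^ 2 / ((1 + of_int m ^ 2) * (1 + of_int n ^ 2))"
        unfolding s_def by (rule prod_square_bound) simp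
      finally show ?thesis .
    qed
  qed
qed

text \<open>With X = m z + n, 1/X^2 - 1/(X^2 - 1/4) = -(1/4) / (X^2 (X^2 - 1/4)) decays like a
  fourth power, which the weight 2 terms alone do not.\<close>

lemma summable_lattice_2:
  assumes "Im z > 0"
  defines "d \<equiv> \<lambda>m n::int. 1 / ((of_int m * z + of_int n) ^ 2 - 1 / 4)"
  shows "(\<lambda>(m::int, n::int). 1 / (of_int m * z + of_int n) ^ 2 - d m n) summable_on UNIV \<times> UNIV" (is ?th1)
    and "d m summable_on UNIV" (is ?th2)
    and "(\<lambda>m. d m n) summable_on UNIV" (is ?th3)
proof -
  obtain M where M: "M > 0" "\<And>x y. x ^ 2 + y ^ 2 \<le> M * norm (of_real x * z + of_real y) ^ 2"
    using lattice_norm_bound[OF assms(1)] by blast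
  obtain C where C: "C > 0" "\<And>m n :: int. 1 + of_int m ^ 2 + of_int n ^ 2 \<le>
       C * norm ((of_int m * z + of_int n) ^ 2 - 1 / 4)"
    using lattice_quarter_bound[OF assms(1)] by blast
  have d: "norm (d m n) \<le> C / (1 + real_of_int m ^ 2 + real_of_int n ^ 2)" for m n
  proof -
    define Y where "Y = norm ((of_int m * z + of_int n) ^ 2 - 1 / 4)"
    have *: "0 < 1 + real_of_int m ^ 2 + real_of_int n ^ 2" by (simp add: add_pos_nonneg)
    hence "0 < C * Y" using C(2)[of m n] unfolding Y_def by linarith
    hence "Y > 0" using C(1) by (simp add: zero_less_mult_iff)
    thus ?thesis
      using C(2)[of m n] * unfolding d_def norm_divide Y_def [symmetric] by (simp add: divide_simps)
  qed
  show ?th2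
  proof (rule summable_on_int_bound[where C = C])
    fix n :: int
    have "C / (1 + real_of_int m ^ 2 + real_of_int n ^ 2) \<le> C / (1 + of_int n ^ 2)"
      using C(1) by (intro divide_left_mono mult_pos_pos) (auto simp: add_pos_nonneg)
    with d[of m n] show "norm (d m n) \<le> C / (1 + of_int n ^ 2)" by linarith
  qed
  show ?th3
  proof (rule summable_on_int_bound[where C = C])
    fix m :: int
    have "C / (1 + real_of_int m ^ 2 + real_of_int n ^ 2) \<le> C / (1 + of_int m ^ 2)"
      using C(1) by (intro divide_left_mono mult_pos_pos) (auto simp: add_pos_nonneg)
    with d[of m n] show "norm (d m n) \<le> C / (1 + of_int m ^ 2)" by linarith
  qed
  show ?th1
  proof (rule summable_on_int_prod_bound[where C = "2 * M * C + 4"])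
    fix m n :: int
    define s where "s = 1 + real_of_int m ^ 2 + real_of_int n ^ 2"
    define X where "X = of_int m * z + of_int n"
    show "norm (1 / X ^ 2 - d m n) \<le> (2 * M * C + 4) / ((1 + of_int m ^ 2) * (1 + of_int n ^ 2))"
    proof (cases "(m, n) = (0, 0)")
      \<comment> \<open>Here \<open>1 / 0 = 0\<close> and \<open>d 0 0 = -4\<close>, which explains
        the summand 4 in the constant.\<close>
      case True
      thus ?thesis using M C by (simp add: X_def d_def)
    next
      case False
      have s: "s > 0" by (simp add: s_def add_pos_nonneg)
      have *: "s \<le> 2 * M * norm X ^ 2"
        using square_sum_ge_1[OF False] M(2)[of "of_int m" "of_int n"] by (simp add: s_def X_def)
      hence "norm X ^ 2 > 0" using s M(1) by (auto simp: zero_less_mult_iff)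
      hence X: "X \<noteq> 0" by auto
      have Y: "X ^ 2 - 1 / 4 \<noteq> 0"
      proof
        assume "X ^ 2 - 1 / 4 = 0"
        moreover have "s \<le> C * norm (X ^ 2 - 1 / 4)"
          using C(2)[of m n] by (simp only: X_def s_def)
        ultimately have "s \<le> C * norm (0 :: complex)" by metis
        with s show False by simp
      qed
      have "1 / a - 1 / (a - 1 / 4) = - (1 / 4) * (1 / a) * (1 / (a - 1 / 4))"
        if "a \<noteq> 0" "a - 1 / 4 \<noteq> 0" for a :: complex
        using that by (simp add: field_simps)
      hence "1 / X ^ 2 - d m n = - (1 / 4) * (1 / X ^ 2) * d m n"
        unfolding d_def X_def [symmetric] using X Y by simp
      hence "norm (1 / X ^ 2 - d m n) = 1 / 4 * norm (1 / X ^ 2) * norm (d m n)"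
        by (simp add: norm_mult norm_divide)
      also have "\<dots> \<le> 1 / 4 * (2 * M / s) * (C / s)"
      proof (intro mult_mono)
        show "norm (1 / X\<^sup>2) \<le> 2 * M / s"
          using * s X M(1) by (simp add: norm_divide norm_power divide_simps)
        show "norm (d m n) \<le> C / s"
          using d[of m n] by (simp add: s_def)
      qed (use M(1) s in auto)
      also have "\<dots> = (M * C / 2) / (s * s)" by simp
      also have "\<dots> \<le> (M * C / 2) / ((1 + of_int m ^ 2) * (1 + of_int n ^ 2))"
        unfolding s_def using M(1) C(1) by (intro prod_square_bound) auto
      also have "\<dots> \<le> (2 * M * C + 4) / ((1 + of_int m ^ 2) * (1 + of_int n ^ 2))"
        using M(1) C(1) by (intro divide_right_mono) (auto simp: field_simps intro!: mult_nonneg_nonneg)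
      finally show ?thesis .
    qed
  qed
qed

section \<open>Rows of the lattice sums and their Lambert series\<close>

lemma has_sum_row:
  assumes z: "Im z > 0" and k: "even k" "k \<ge> 2"
    and sm: "(\<lambda>n::int. 1 / (z + of_int n) ^ k) summable_on UNIV"
  shows "((\<lambda>n::int. 1 / (z + of_int n) ^ k) has_sum
           (2 * of_real pi * \<i>) ^ k / fact (k - 1) * eval_fps (pow_fps (k - 1)) (nome z)) UNIV"
proof -
  have P: "(\<lambda>j. 1 / (w + of_nat j) ^ k) sums (Polygamma (k - 1) w / fact (k - 1))"
    if "w \<noteq> 0" for w :: complex
  proof -
    have "summable (\<lambda>j. inverse ((w + of_nat j) ^ k))"
      using that k by (intro Polygamma_converges') auto
    hence "(\<lambda>j. inverse ((w + of_nat j) ^ k)) sums (\<Sum>j. inverse ((w + of_nat j) ^ k))"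
      by (rule summable_sums)
    also have "(\<Sum>j. inverse ((w + of_nat j) ^ k)) = Polygamma (k - 1) w / fact (k - 1)"
      using k by (simp add: Polygamma_def)
    finally show ?thesis by (simp add: inverse_eq_divide)
  qed
  have nz: "z \<noteq> 0" "1 - z \<noteq> 0" using z by (auto simp: complex_eq_iff)
  have "((\<lambda>n::int. 1 / (z + of_int n) ^ k) has_sum
          (Polygamma (k - 1) z / fact (k - 1) + Polygamma (k - 1) (1 - z) / fact (k - 1))) UNIV"
  proof (rule has_sum_int)
    \<comment> \<open>The negative half of the row is the \<open>Polygamma\<close> series at 1 - z;
      the sign drops out because \<open>k\<close> is even.\<close>
    have "(z + of_int (- 1 - int j)) ^ k = (1 - z + of_nat j) ^ k" for j
    proof -
      have "(z + of_int (- 1 - int j)) = - (1 - z + of_nat j)" by simp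
      thus ?thesis using k(1) by (metis power_minus_even)
    qed
    thus "(\<lambda>j. 1 / (z + of_int (- 1 - int j)) ^ k) sums (Polygamma (k - 1) (1 - z) / fact (k - 1))"
      using P[OF nz(2)] by simp
  qed (use sm P[OF nz(1)] in auto)
  also have "Polygamma (k - 1) z / fact (k - 1) + Polygamma (k - 1) (1 - z) / fact (k - 1) =
      (Polygamma (k - 1) z + (-1) ^ Suc (k - 1) * Polygamma (k - 1) (1 - z)) / fact (k - 1)"
    using k by (simp add: add_divide_distrib)
  also have "Polygamma (k - 1) z + (-1) ^ Suc (k - 1) * Polygamma (k - 1) (1 - z) =
      (2 * of_real pi * \<i>) ^ k * eval_fps (pow_fps (k - 1)) (nome z)"
    using Polygamma_reflection_nome[OF z, of "k - 1"] k by simp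
  finally show ?thesis by simp
qed

text \<open>The partial fractions of the cotangent in an absolutely convergent form: on subtracting
  two of them the harmonic terms in the series for \<open>Digamma\<close> cancel.\<close>

lemma has_sum_cot_diff:
  fixes a b :: complex
  assumes ab: "a \<notin> \<int>" "b \<notin> \<int>"
    and sm: "(\<lambda>m::int. 1 / (a + of_int m) - 1 / (b + of_int m)) summable_on UNIV"
  shows "((\<lambda>m::int. 1 / (a + of_int m) - 1 / (b + of_int m)) has_sum
           of_real pi * (cot (of_real pi * a) - cot (of_real pi * b))) UNIV"
proof -
  have D: "(\<lambda>k. 1 / (x + of_nat k) - 1 / (y + of_nat k)) sums (Digamma y - Digamma x)"
    if "x \<noteq> 0" "y \<noteq> 0" for x y :: complex
  proof -
    have "(\<lambda>k. (inverse (of_nat (Suc k)) - inverse (y + of_nat k)) -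
               (inverse (of_nat (Suc k)) - inverse (x + of_nat k))) sums
          ((\<Sum>k. inverse (of_nat (Suc k)) - inverse (y + of_nat k)) -
           (\<Sum>k. inverse (of_nat (Suc k)) - inverse (x + of_nat k)))"
      using that by (intro sums_diff summable_sums summable_Digamma)
    thus ?thesis by (simp add: Digamma_def inverse_eq_divide)
  qed
  have nz: "a \<noteq> 0" "b \<noteq> 0" "1 - a \<noteq> 0" "1 - b \<noteq> 0"
    using ab by auto
  have "((\<lambda>m::int. 1 / (a + of_int m) - 1 / (b + of_int m)) has_sum
          ((Digamma b - Digamma a) + (Digamma (1 - a) - Digamma (1 - b)))) UNIV"
  proof (rule has_sum_int)
    have "1 / (a + of_int (- 1 - int k)) - 1 / (b + of_int (- 1 - int k)) =
          1 / (1 - b + of_nat k) - 1 / (1 - a + of_nat k)" for k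
    proof -
      have "a + of_int (- 1 - int k) = - (1 - a + of_nat k)"
           "b + of_int (- 1 - int k) = - (1 - b + of_nat k)" by simp_all
      thus ?thesis by (simp only: divide_minus_right) simp
    qed
    thus "(\<lambda>k. 1 / (a + of_int (- 1 - int k)) - 1 / (b + of_int (- 1 - int k))) sums
        (Digamma (1 - a) - Digamma (1 - b))"
      using D[OF nz(4,3)] by simp
  qed (use sm D[OF nz(1,2)] in auto)
  also have "(Digamma b - Digamma a) + (Digamma (1 - a) - Digamma (1 - b)) =
      (Digamma b - Digamma (1 - b)) - (Digamma a - Digamma (1 - a))" by (simp add: algebra_simps)
  also have "\<dots> = of_real pi * (cot (of_real pi * a) - cot (of_real pi * b))"
    unfolding Digamma_reflection[OF ab(1)] Digamma_reflection[OF ab(2)] by (simp add: algebra_simps)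
  finally show ?thesis .
qed

text \<open>At \<open>n = 0\<close> the set of divisors is infinite, so the constant term is 0 by
  the convention for sums over infinite sets.\<close>

definition sigma_fps :: "nat \<Rightarrow> complex fps" where
  "sigma_fps j = Abs_fps (\<lambda>n. of_nat (\<Sum>d | d dvd n. d ^ j))"

lemma sigma_fps_nth_0 [simp]: "fps_nth (sigma_fps j) 0 = 0"
  by (simp add: sigma_fps_def)

lemma divisor_power_sum_le:
  fixes n :: nat
  assumes "n > 0"
  shows "(\<Sum>d | d dvd n. d ^ j) \<le> n ^ Suc j"
proof -
  have sub: "{d. d dvd n} \<subseteq> {1..n}"
    using assms dvd_imp_le[of _ n] dvd_pos_nat[of n] by (fastforce simp: Suc_le_eq)
  have "(\<Sum>d | d dvd n. d ^ j) \<le> (\<Sum>d\<in>{1..n}. n ^ j)"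
    using sub by (intro order_trans[OF sum_mono2[OF _ sub] sum_mono] power_mono) auto
  thus ?thesis by simp
qed

lemma summable_pow: "norm (x :: complex) < 1 \<Longrightarrow> summable (\<lambda>n. real n ^ j * norm x ^ n)"
proof -
  assume x: "norm x < 1"
  have "ereal (norm x) < fps_conv_radius (pow_fps j)"
    using x by (intro less_le_trans[OF _ conv_radius_pow_fps]) auto
  hence "summable (\<lambda>n. norm (fps_nth (pow_fps j) n * x ^ n))"
    unfolding fps_conv_radius_def by (rule abs_summable_in_conv_radius)
  thus ?thesis by (simp add: pow_fps_def norm_mult norm_power)
qed

lemma norm_sigma_fps_le: "norm (fps_nth (sigma_fps j) n) \<le> real n ^ Suc j"
proof (cases "n = 0")
  case False
  hence "real (\<Sum>d | d dvd n. d ^ j) \<le> real (n ^ Suc j)"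
    using divisor_power_sum_le[of n j] by (subst of_nat_le_iff) auto
  thus ?thesis by (simp only: sigma_fps_def fps_nth_Abs_fps norm_of_nat of_nat_power)
qed auto

lemma conv_radius_sigma_fps: "fps_conv_radius (sigma_fps j) \<ge> 1"
  unfolding fps_conv_radius_def
proof (rule conv_radius_geI_ex)
  fix r :: real assume r: "0 < r" "ereal r < 1"
  have "summable (\<lambda>n. fps_nth (sigma_fps j) n * of_real r ^ n)"
  proof (rule summable_comparison_test[OF _ summable_pow[of "of_real r" "Suc j"]])
    show "\<exists>N. \<forall>n\<ge>N. norm (fps_nth (sigma_fps j) n * complex_of_real r ^ n) \<le>
         real n ^ Suc j * norm (complex_of_real r) ^ n"
      using norm_sigma_fps_le[of j] r by (auto simp: norm_mult norm_power intro!: mult_right_mono simp del: power_Suc)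
  qed (use r in \<open>simp add: one_ereal_def\<close>)
  thus "\<exists>z :: complex. norm z = r \<and> summable (\<lambda>n. fps_nth (sigma_fps j) n * z ^ n)"
    using r by (intro exI[of _ "of_real r"]) auto
qed

lemma has_sum_eval_fps:
  assumes "norm x < 1" "fps_conv_radius F \<ge> 1" "fps_nth F 0 = 0"
  shows "((\<lambda>n. fps_nth F n * x ^ n) has_sum eval_fps F x) {1..}"
proof -
  have r: "ereal (norm x) < fps_conv_radius F"
    using assms by (intro less_le_trans[OF _ assms(2)]) auto
  have "((\<lambda>n. fps_nth F n * x ^ n) has_sum eval_fps F x) UNIV"
    using r by (intro norm_summable_imp_has_sum sums_eval_fps)
       (auto simp: fps_conv_radius_def intro: abs_summable_in_conv_radius)
  thus ?thesis
    by (subst has_sum_cong_neutral[where T = UNIV]) (use assms in \<open>auto simp: not_less_eq_eq\<close>)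
qed

text \<open>Both sides sum k^j x^n over the pairs (n, k) with k dividing n, grouped by n on one side
  and by the cofactor n / k = m + 1 on the other.\<close>

lemma lambert_sums:
  assumes x: "norm x < 1" and j: "j > 0"
  shows "(\<lambda>m. eval_fps (pow_fps j) (x ^ Suc m)) sums eval_fps (sigma_fps j) x"
proof -
  let ?D = "Sigma {1..} (\<lambda>n::nat. {k. k dvd n})"
  define f where "f = (\<lambda>(n::nat, k). of_nat k ^ j * x ^ n)"
  have "f summable_on ?D"
  proof (rule abs_summable_summable)
    show "(\<lambda>p. norm (f p)) summable_on ?D"
    proof (rule summable_on_SigmaI)
      show "((\<lambda>k. norm (f (n, k))) has_sum (\<Sum>k | k dvd n. real k ^ j) * norm x ^ n) {k. k dvd n}"
        if "n \<in> {1..}" for n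
        using that by (intro has_sum_finiteI) (auto simp: f_def norm_mult norm_power sum_distrib_right)
      have "(\<lambda>n. real n ^ Suc j * norm x ^ n) summable_on {1..}"
        by (rule summable_on_subset_banach[of _ UNIV])
           (use summable_pow[OF x, of "Suc j"] in \<open>auto intro!: norm_summable_imp_summable_on\<close>)
      thus "(\<lambda>n. (\<Sum>k | k dvd n. real k ^ j) * norm x ^ n) summable_on {1..}"
      proof (rule summable_on_comparison_test)
        fix n :: nat assume "n \<in> {1..}"
        hence "real (\<Sum>k | k dvd n. k ^ j) \<le> real (n ^ Suc j)"
          using divisor_power_sum_le[of n j] by (subst of_nat_le_iff) auto
        thus "(\<Sum>k | k dvd n. real k ^ j) * norm x ^ n \<le> real n ^ Suc j * norm x ^ n"
          by (intro mult_right_mono) auto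
      qed (auto intro!: mult_nonneg_nonneg sum_nonneg)
    qed auto
  qed
  then obtain S where S: "(f has_sum S) ?D"
    by (auto simp: summable_on_def)
  have "((\<lambda>n. of_nat (\<Sum>k | k dvd n. k ^ j) * x ^ n) has_sum S) {1..}"
  proof (rule has_sum_SigmaD[OF S])
    show "((\<lambda>k. f (n, k)) has_sum of_nat (\<Sum>k | k dvd n. k ^ j) * x ^ n) {k. k dvd n}"
      if "n \<in> {1..}" for n
      using that by (intro has_sum_finiteI) (auto simp: f_def sum_distrib_right)
  qed
  hence "S = eval_fps (sigma_fps j) x"
    using has_sum_eval_fps[OF x conv_radius_sigma_fps sigma_fps_nth_0, of j]
    by (auto simp: sigma_fps_def dest: has_sum_unique)
  moreover have "((\<lambda>(m, k). of_nat k ^ j * (x ^ Suc m) ^ k) has_sum S) (Sigma UNIV (\<lambda>_. {1..}))"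
    using S
    by (subst has_sum_reindex_bij_witness[where i = "\<lambda>(n, k). (n div k - 1, k)" and
          j = "\<lambda>(m, k). (Suc m * k, k)" and T = ?D and h = f and s' = S])
       (auto simp: f_def power_mult [symmetric] simp del: power_Suc mult_Suc elim!: dvdE)
  hence "((\<lambda>m. eval_fps (pow_fps j) (x ^ Suc m)) has_sum S) UNIV"
  proof (rule has_sum_SigmaD)
    fix m :: nat
    have "norm (x ^ Suc m) < 1"
      using x by (simp add: norm_power power_less_one_iff del: power_Suc)
    from has_sum_eval_fps[OF this conv_radius_pow_fps, of j]
    show "((\<lambda>k. (\<lambda>(m, k). of_nat k ^ j * (x ^ Suc m) ^ k) (m, k)) has_sum
            eval_fps (pow_fps j) (x ^ Suc m)) {1..}"
      using j by (simp add: pow_fps_def)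
  qed
  ultimately show ?thesis
    by (auto dest: has_sum_imp_sums)
qed

text \<open>Row 0 gives the first term, its singular summand being \<open>1 / 0 = 0\<close>; the
  rows m and -m agree for even k, whence the factor 2.\<close>

lemma infsum_rows:
  assumes z: "Im z > 0" and k: "even k" "k \<ge> 2"
    and sm: "\<And>m. (\<lambda>n::int. 1 / (of_int m * z + of_int n) ^ k) summable_on UNIV"
    and sr: "(\<lambda>m::int. \<Sum>\<^sub>\<infinity>n::int. 1 / (of_int m * z + of_int n) ^ k) summable_on UNIV"
  shows "(\<Sum>\<^sub>\<infinity>m::int. \<Sum>\<^sub>\<infinity>n::int. 1 / (of_int m * z + of_int n) ^ k) =
           (\<Sum>\<^sub>\<infinity>n::int. 1 / of_int n ^ k) +
           2 * (2 * of_real pi * \<i>) ^ k / fact (k - 1) * eval_fps (sigma_fps (k - 1)) (nome z)"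
proof -
  define R where "R = (\<lambda>m::int. \<Sum>\<^sub>\<infinity>n::int. 1 / (of_int m * z + of_int n) ^ k)"
  define c where "c = (2 * of_real pi * \<i>) ^ k / fact (k - 1)"
  have R_pos: "R (int (Suc m)) = c * eval_fps (pow_fps (k - 1)) (nome z ^ Suc m)" for m
  proof -
    have "Im (of_nat (Suc m) * z) > 0"
      using z by simp
    from has_sum_row[OF this k] sm[of "int (Suc m)"]
    have "R (int (Suc m)) = c * eval_fps (pow_fps (k - 1)) (nome (of_nat (Suc m) * z))"
      unfolding R_def c_def by (intro infsumI) simp
    thus ?thesis by (simp only: nome_of_nat_mult)
  qed
  have R_neg: "R (- m) = R m" for m
  proof -
    have "1 / (of_int (- m) * z + of_int (- n)) ^ k = 1 / (of_int m * z + of_int n) ^ k" for n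
    proof -
      have "of_int (- m) * z + of_int (- n) = - (of_int m * z + of_int n)" by simp
      thus ?thesis using k(1) by (metis power_minus_even)
    qed
    moreover have "bij (uminus :: int \<Rightarrow> int)"
      by (rule bij_uminus)
    from infsum_reindex_bij_betw[OF this, of "\<lambda>n. 1 / (of_int (- m) * z + of_int n) ^ k"]
    have "R (- m) = (\<Sum>\<^sub>\<infinity>n::int. 1 / (of_int (- m) * z + of_int (- n)) ^ k)"
      by (simp add: R_def)
    ultimately show ?thesis by (simp add: R_def)
  qed
  have L: "(\<lambda>m. c * eval_fps (pow_fps (k - 1)) (nome z ^ Suc m)) sums
          (c * eval_fps (sigma_fps (k - 1)) (nome z))"
    using k by (intro sums_mult lambert_sums norm_nome_less_1 z) auto
  have pos: "(\<lambda>m. R (int m)) sums (R 0 + c * eval_fps (sigma_fps (k - 1)) (nome z))"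
    using L unfolding R_pos [symmetric] by (subst (asm) sums_Suc_iff) (simp add: add.commute)
  have neg: "(\<lambda>m. R (- 1 - int m)) sums (c * eval_fps (sigma_fps (k - 1)) (nome z))"
  proof -
    have "R (- 1 - int m) = R (int (Suc m))" for m
      using R_neg[of "int (Suc m)"] by (simp add: algebra_simps)
    thus ?thesis using L by (simp only: R_pos)
  qed
  have "infsum R UNIV = R 0 + c * eval_fps (sigma_fps (k - 1)) (nome z) + c * eval_fps (sigma_fps (k - 1)) (nome z)"
    using has_sum_int[OF _ pos neg] sr by (intro infsumI) (simp add: R_def)
  thus ?thesis by (simp add: R_def c_def)
qed

section \<open>Eisenstein series of weight 2 and 4 as lattice sums, under z -> -1/z\<close>

definition E2_fps :: "complex fps" where
  "E2_fps = 1 - fps_const 24 * sigma_fps 1"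

definition Eis2 :: "complex \<Rightarrow> complex" where
  "Eis2 z = eval_fps E2_fps (nome z)"

lemma conv_radius_cmult: "fps_conv_radius F \<ge> 1 \<Longrightarrow> fps_conv_radius (fps_const (c :: complex) * F) \<ge> 1"
  by (rule order_trans[OF _ fps_conv_radius_mult]) simp

lemma conv_radius_E2_fps: "fps_conv_radius E2_fps \<ge> 1"
  unfolding E2_fps_def
  by (rule order_trans[OF _ fps_conv_radius_diff]) (auto intro: conv_radius_cmult conv_radius_sigma_fps)

lemma Eis2_eq: "Im z > 0 \<Longrightarrow> Eis2 z = 1 - 24 * eval_fps (sigma_fps 1) (nome z)"
proof -
  assume z: "Im z > 0"
  have r: "ereal (norm (nome z)) < fps_conv_radius (sigma_fps 1)"
          "ereal (norm (nome z)) < fps_conv_radius (fps_const 24 * sigma_fps 1)"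
    using norm_nome_less_1[OF z] less_le_trans[OF _ conv_radius_sigma_fps]
      less_le_trans[OF _ conv_radius_cmult[OF conv_radius_sigma_fps]] by auto
  show ?thesis
    unfolding Eis2_def E2_fps_def using r by (simp add: eval_fps_diff eval_fps_mult)
qed

lemma infsum_inverse_square_int: "(\<Sum>\<^sub>\<infinity>n::int. 1 / of_int n ^ 2) = (of_real (pi ^ 2 / 3) :: complex)"
proof -
  have s: "(\<lambda>k. 1 / of_int (1 + int k) ^ 2) sums (of_real (pi ^ 2 / 6) :: complex)"
    using sums_of_real[OF inverse_squares_sums, where 'a = complex] by (simp add: add.commute)
  have "((\<lambda>n::int. 1 / of_int n ^ 2 :: complex) has_sum
          (of_real (pi ^ 2 / 6) + of_real (pi ^ 2 / 6))) UNIV"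
  proof (rule has_sum_int)
    show "(\<lambda>n::int. 1 / of_int n ^ 2 :: complex) summable_on UNIV"
    proof (rule summable_on_int_bound[where C = 2])
      fix n :: int
      show "norm (1 / of_int n ^ 2 :: complex) \<le> 2 / (1 + real_of_int n ^ 2)"
      proof (cases "n = 0")
        case False
        hence "real_of_int n ^ 2 \<ge> 1"
          using square_sum_ge_1[of n 0] by simp
        thus ?thesis by (simp add: norm_divide norm_power divide_simps)
      qed auto
    qed
    show "(\<lambda>k. 1 / of_int (int k) ^ 2) sums (of_real (pi ^ 2 / 6) :: complex)"
      using s sums_Suc_iff[of "\<lambda>k. 1 / of_int (int k) ^ 2 :: complex"] by simp
    have "of_int (- 1 - int k) ^ 2 = (of_int (1 + int k) ^ 2 :: complex)" for k
      by (simp add: power2_eq_square algebra_simps)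
    thus "(\<lambda>k. 1 / of_int (- 1 - int k) ^ 2) sums (of_real (pi ^ 2 / 6) :: complex)"
      using s by simp
  qed
  thus ?thesis by (simp add: infsumI)
qed

lemma infsum_diff_complex:
  fixes f g :: "'a \<Rightarrow> complex"
  assumes "f summable_on A" "g summable_on A"
  shows "infsum (\<lambda>x. f x - g x) A = infsum f A - infsum g A"
  using infsum_add[OF assms(1) summable_on_cmult_right[OF assms(2), of "-1"]]
  by (simp add: infsum_uminus)

lemma summable_on_diff_complex:
  fixes f g :: "'a \<Rightarrow> complex"
  assumes "f summable_on A" "g summable_on A"
  shows "(\<lambda>x. f x - g x) summable_on A"
  using summable_on_add[OF assms(1) summable_on_cmult_right[OF assms(2), of "-1"]] by simp

lemma summable_on_swap:
  assumes "(\<lambda>(m, n). f m n) summable_on A \<times> B"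
  shows "(\<lambda>(n, m). f m n) summable_on B \<times> A"
  using assms by (subst summable_on_reindex_bij_witness[where i = prod.swap and j = prod.swap and
    h = "\<lambda>(m, n). f m n" and T = "A \<times> B"]) auto

text \<open>- m z + n = - z (n (-1/z) + m), so a column of the lattice of z is a row of the lattice
  of -1/z, up to a power of z.\<close>

lemma infsum_columns:
  assumes z: "Im z > 0" and k: "even k"
  shows "(\<Sum>\<^sub>\<infinity>m::int. 1 / (of_int m * z + of_int n) ^ k) =
           (\<Sum>\<^sub>\<infinity>m::int. 1 / (of_int n * (-1 / z) + of_int m) ^ k) / z ^ k"
proof -
  have nz: "z \<noteq> 0" using z by auto
  have bij: "bij (uminus :: int \<Rightarrow> int)" by (rule bij_uminus)
  have "1 / (of_int (- m) * z + of_int n) ^ k = 1 / (of_int n * (-1 / z) + of_int m) ^ k * (1 / z ^ k)" for m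
  proof -
    have "of_int (- m) * z + of_int n = - ((of_int n * (-1 / z) + of_int m) * z)"
      using nz by (simp add: field_simps)
    hence "(of_int (- m) * z + of_int n) ^ k = (of_int n * (-1 / z) + of_int m) ^ k * z ^ k"
      using k by (metis power_minus_even power_mult_distrib)
    thus ?thesis by simp
  qed
  hence "(\<Sum>\<^sub>\<infinity>m::int. 1 / (of_int (- m) * z + of_int n) ^ k) =
        (\<Sum>\<^sub>\<infinity>m::int. 1 / (of_int n * (-1 / z) + of_int m) ^ k) * (1 / z ^ k)"
    by (simp only: infsum_cmult_left')
  thus ?thesis
    using infsum_reindex_bij_betw[OF bij, of "\<lambda>m. 1 / (of_int m * z + of_int n) ^ k"] by simp
qed

lemma summable_columns:
  assumes z: "Im z > 0" and k: "even k"
    and "(\<lambda>n::int. \<Sum>\<^sub>\<infinity>m::int. 1 / (of_int n * (-1 / z) + of_int m) ^ k) summable_on UNIV"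
  shows "(\<lambda>n::int. \<Sum>\<^sub>\<infinity>m::int. 1 / (of_int m * z + of_int n) ^ k) summable_on UNIV"
  unfolding infsum_columns[OF z k] using summable_on_cmult_left[OF assms(3), of "1 / z ^ k"] by simp

text \<open>This is 2 zeta(4). Its value is never computed: the ratio to the next coefficient falls
  out of \<open>E4_fps_eq\<close>.\<close>

definition Eis4_const :: complex where
  "Eis4_const = (\<Sum>\<^sub>\<infinity>n::int. 1 / of_int n ^ 4)"

text \<open>16 pi^4 / 3 = 2 (2 pi \<i>)^4 / 3! is the factor from Lipschitz's formula in weight
  4.\<close>

definition lattice_Eis4 :: "complex \<Rightarrow> complex" where
  "lattice_Eis4 z = Eis4_const + of_real (16 * pi ^ 4 / 3) * eval_fps (sigma_fps 3) (nome z)"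

lemma lattice_Eis4_rows:
  assumes z: "Im z > 0"
  shows "lattice_Eis4 z = (\<Sum>\<^sub>\<infinity>m::int. \<Sum>\<^sub>\<infinity>n::int. 1 / (of_int m * z + of_int n) ^ 4)"
proof -
  have "(\<lambda>(m::int, n::int). 1 / (of_int m * z + of_int n) ^ 4) summable_on Sigma UNIV (\<lambda>_. UNIV)"
    using summable_lattice_4[OF z] by simp
  hence "(\<lambda>n::int. 1 / (of_int m * z + of_int n) ^ 4) summable_on UNIV"
    and "(\<lambda>m::int. \<Sum>\<^sub>\<infinity>n::int. 1 / (of_int m * z + of_int n) ^ 4) summable_on UNIV" for m :: int
    using summable_on_SigmaD1[of "\<lambda>m n. 1 / (of_int m * z + of_int n) ^ 4" UNIV "\<lambda>_. UNIV" m]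
      summable_on_Sigma_banach[of "\<lambda>m n. 1 / (of_int m * z + of_int n) ^ 4" UNIV "\<lambda>_. UNIV"] by auto
  note rows = infsum_rows[OF z _ _ this]
  have coeff: "2 * (2 * of_real pi * \<i>) ^ 4 / fact (4 - 1) = (of_real (16 * pi ^ 4 / 3) :: complex)"
    by (simp add: eval_nat_numeral)
  show ?thesis
    using rows unfolding coeff by (simp add: lattice_Eis4_def Eis4_const_def)
qed

text \<open>Absolute convergence allows rows and columns to be exchanged, and this exchange is the
  substitution z -> -1/z.\<close>

lemma lattice_Eis4_S:
  assumes z: "Im z > 0"
  shows "lattice_Eis4 (-1 / z) = z ^ 4 * lattice_Eis4 z"
proof -
  have nz: "z \<noteq> 0" using z by auto
  have "lattice_Eis4 z = (\<Sum>\<^sub>\<infinity>m::int. \<Sum>\<^sub>\<infinity>n::int. 1 / (of_int m * z + of_int n) ^ 4)"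
    by (rule lattice_Eis4_rows[OF z])
  also have "\<dots> = (\<Sum>\<^sub>\<infinity>n::int. \<Sum>\<^sub>\<infinity>m::int. 1 / (of_int m * z + of_int n) ^ 4)"
    by (rule infsum_swap_banach[OF summable_lattice_4[OF z]])
  also have "\<dots> = (\<Sum>\<^sub>\<infinity>n::int. (\<Sum>\<^sub>\<infinity>m::int. 1 / (of_int n * (-1 / z) + of_int m) ^ 4) * (1 / z ^ 4))"
    by (subst infsum_columns[OF z]) auto
  also have "\<dots> = lattice_Eis4 (-1 / z) * (1 / z ^ 4)"
    unfolding infsum_cmult_left' lattice_Eis4_rows[OF Im_uminus_inverse_pos[OF z]] ..
  finally show ?thesis using nz by simp
qed

lemma has_sum_telescope_int:
  fixes t :: "int \<Rightarrow> complex"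
  assumes "(\<lambda>n. t n - t (n + 1)) summable_on UNIV"
    and a: "(\<lambda>k. t (- int k)) \<longlonglongrightarrow> a" and b: "(\<lambda>k. t (int k)) \<longlonglongrightarrow> b"
  shows "((\<lambda>n. t n - t (n + 1)) has_sum (a - b)) UNIV"
proof -
  have "((\<lambda>n. t n - t (n + 1)) has_sum ((t 0 - b) + (a - t 0))) UNIV"
  proof (rule has_sum_int)
    show "(\<lambda>k. t (int k) - t (int k + 1)) sums (t 0 - b)"
      using telescope_sums'[OF b] by (simp add: add.commute)
    have "(\<lambda>k. t (- int (Suc k)) - t (- int k)) sums (a - t 0)"
      using telescope_sums[OF a] by simp
    thus "(\<lambda>k. t (- 1 - int k) - t (- 1 - int k + 1)) sums (a - t 0)"
      by (simp add: algebra_simps)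
  qed fact
  thus ?thesis by simp
qed

lemma tendsto_cot_arith:
  assumes w: "Im w > 0"
  shows "(\<lambda>k. cot (of_real pi * (of_nat k * w + c))) \<longlonglongrightarrow> - \<i>"
proof -
  have "(\<lambda>k. nome w ^ k * nome c) \<longlonglongrightarrow> 0 * nome c"
    using norm_nome_less_1[OF w] by (intro tendsto_mult LIMSEQ_power_zero tendsto_const)
  hence 0: "(\<lambda>k. nome (of_nat k * w + c)) \<longlonglongrightarrow> 0"
    by (simp add: nome_add nome_of_nat_mult)
  have "(\<lambda>k. - \<i> * (1 + nome (of_nat k * w + c)) / (1 - nome (of_nat k * w + c))) \<longlonglongrightarrow> - \<i> * (1 + 0) / (1 - 0)"
    by (intro tendsto_intros 0) auto
  moreover have "eventually (\<lambda>k. real k > - Im c / Im w) sequentially"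
    using filterlim_real_sequentially by (simp add: filterlim_at_top_dense)
  hence "eventually (\<lambda>k. Im (of_nat k * w + c) > 0) sequentially"
    by eventually_elim (use w in \<open>simp add: field_simps\<close>)
  hence "eventually (\<lambda>k. - \<i> * (1 + nome (of_nat k * w + c)) / (1 - nome (of_nat k * w + c)) =
      cot (of_real pi * (of_nat k * w + c))) sequentially"
    by eventually_elim (simp add: cot_nome)
  ultimately show ?thesis
    by (simp add: Lim_transform_eventually)
qed

text \<open>
  Subtracting \<open>1 / ((m z + n)\<^sup>2 - 1/4)\<close> makes the double series for \<open>Eis2\<close> absolutely convergent. The
  correction telescopes in \<open>n\<close>: each row contributes \<open>0\<close>, while the columns leave a difference of
  limits of cotangents, which is the anomaly of \<open>Eis2\<close>.
\<close>

theorem Eis2_S: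
  assumes z: "Im z > 0"
  shows "Eis2 (-1 / z) = z ^ 2 * Eis2 z - 6 * \<i> * z / of_real pi"
proof -
  have nz: "z \<noteq> 0" using z by auto
  have z': "Im (-1 / z) > 0" by (rule Im_uminus_inverse_pos[OF z])
  define d where "d = (\<lambda>w (m::int) (n::int). 1 / ((of_int m * w + of_int n) ^ 2 - 1 / 4 :: complex))"
  define f where "f = (\<lambda>w (m::int) (n::int). 1 / (of_int m * w + of_int n :: complex) ^ 2)"
  have smb: "(\<lambda>(m, n). f w m n - d w m n) summable_on UNIV \<times> UNIV" if "Im w > 0" for w
    using summable_lattice_2(1)[OF that] unfolding d_def f_def .
  have smd: "d w m summable_on UNIV" "(\<lambda>m. d w m n) summable_on UNIV" if "Im w > 0" for w m n
    using summable_lattice_2(2,3)[OF that] unfolding d_def by auto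
  have half_nz: "of_int m * w + of_int n - 1 / 2 \<noteq> 0" "of_int m * w + of_int n + 1 / 2 \<noteq> 0"
    if w: "Im w > 0" for m n :: int and w
  proof -
    have "of_int m * w + of_int n + of_int e / 2 \<noteq> 0" if e: "e = 1 \<or> e = -1" for e :: int
    proof
      assume *: "of_int m * w + of_int n + of_int e / 2 = 0"
      hence "Im (of_int m * w + of_int n + of_int e / 2) = 0" by simp
      hence "m = 0" using w by simp
      with * have "(of_int (2 * n + e) :: complex) = 0" by (simp add: field_simps)
      hence "2 * n + e = 0" by (simp only: of_int_eq_0_iff)
      thus False using e by presburger
    qed
    from this[of 1] this[of "-1"] show "of_int m * w + of_int n - 1 / 2 \<noteq> 0" "of_int m * w + of_int n + 1 / 2 \<noteq> 0"
      by simp_all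
  qed
  have d_eq: "d w m n = 1 / (of_int m * w + of_int n - 1 / 2) - 1 / (of_int m * w + of_int n + 1 / 2)"
    if w: "Im w > 0" for w m n
  proof -
    have "1 / (a ^ 2 - 1 / 4) = 1 / (a - 1 / 2) - 1 / (a + 1 / 2)" 
      if "a - 1 / 2 \<noteq> 0" "a + 1 / 2 \<noteq> 0" for a :: complex
    proof -
      have "a ^ 2 - 1 / 4 = (a - 1 / 2) * (a + 1 / 2)"
        by (simp add: power2_eq_square algebra_simps)
      moreover have "1 / (a - 1 / 2) - 1 / (a + 1 / 2) = 1 / ((a - 1 / 2) * (a + 1 / 2))"
        using that by (subst diff_frac_eq) auto
      ultimately show ?thesis by simp
    qed
    thus ?thesis unfolding d_def using half_nz[OF w] by blast
  qed
  have rows_d: "infsum (d w m) UNIV = 0" if w: "Im w > 0" for w m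
  proof -
    \<comment> \<open>Along a row the second fraction of \<open>d\<close> at n is the first one at n
      + 1, and both ends tend to 0.\<close>
    define t where "t = (\<lambda>n::int. 1 / (of_int m * w + of_int n - 1 / 2))"
    have dt: "d w m n = t n - t (n + 1)" for n
      unfolding d_eq[OF w] t_def by (simp add: algebra_simps)
    have lim: "(\<lambda>k. 1 / (of_int m * w + of_int (e * int k) - 1 / 2)) \<longlonglongrightarrow> 0"
      if e: "e = 1 \<or> e = -1" for e :: int
    proof -
      have "filterlim (\<lambda>k. (of_int m * w - 1 / 2) + of_int (e * int k)) at_infinity sequentially"
      proof (rule tendsto_add_filterlim_at_infinity[OF tendsto_const])
        show "filterlim (\<lambda>k. of_int (e * int k) :: complex) at_infinity sequentially"
          using tendsto_mult_filterlim_at_infinity[OF tendsto_const _ tendsto_of_nat, of "of_int e"] e by auto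
      qed
      from tendsto_divide_0[OF tendsto_const this, of 1] show ?thesis
        by (simp add: algebra_simps)
    qed
    have "(\<lambda>n. t n - t (n + 1)) summable_on UNIV"
      using smd(1)[OF w, of m] by (simp add: dt [symmetric])
    hence "((\<lambda>n. t n - t (n + 1)) has_sum (0 - 0)) UNIV"
      using lim[of 1] lim[of "-1"]
      by (intro has_sum_telescope_int) (auto simp: t_def)
    thus ?thesis by (simp add: dt [symmetric] infsumI)
  qed
  have smf: "f w m summable_on UNIV" if w: "Im w > 0" for w m
  proof -
    have "(\<lambda>n. f w m n - d w m n) summable_on UNIV"
      using summable_on_SigmaD1[of "\<lambda>m n. f w m n - d w m n" UNIV "\<lambda>_. UNIV" m] smb[OF w] by simp
    from summable_on_add[OF this smd(1)[OF w, of m]] show ?thesis by simp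
  qed
  have row_bf: "infsum (\<lambda>n. f w m n - d w m n) UNIV = infsum (f w m) UNIV" if w: "Im w > 0" for w m
    using infsum_diff_complex[OF smf[OF w] smd(1)[OF w], of m m] rows_d[OF w] by simp
  have sm_rows: "(\<lambda>m. infsum (f w m) UNIV) summable_on UNIV" if w: "Im w > 0" for w
    using summable_on_Sigma_banach[OF smb[OF w]] by (simp add: row_bf[OF w])
  have G: "infsum (\<lambda>m. infsum (f w m) UNIV) UNIV = of_real (pi ^ 2 / 3) * Eis2 w" if w: "Im w > 0" for w
  proof -
    have "infsum (\<lambda>m. infsum (f w m) UNIV) UNIV = of_real (pi ^ 2 / 3) +
        2 * (2 * of_real pi * \<i>) ^ 2 / fact 1 * eval_fps (sigma_fps 1) (nome w)"
      using infsum_rows[OF w, of 2] smf[OF w] sm_rows[OF w] 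
      unfolding f_def infsum_inverse_square_int by simp
    thus ?thesis by (simp add: Eis2_eq[OF w] power_mult_distrib algebra_simps)
  qed
  \<comment> \<open>Column sums: \<open>C\<close> of the conditionally convergent series,
    \<open>D\<close> of the correction.\<close>
  define C where "C = (\<lambda>n. infsum (\<lambda>m. f z m n) UNIV)"
  define D where "D = (\<lambda>n. infsum (\<lambda>m. d z m n) UNIV)"
  have C_eq: "C n = infsum (f (-1 / z) n) UNIV / z ^ 2" for n
    unfolding C_def f_def by (rule infsum_columns[OF z]) simp
  have smC: "C summable_on UNIV"
    unfolding C_def f_def using sm_rows[OF z'] by (intro summable_columns[OF z]) (auto simp: f_def)
  have smfc: "(\<lambda>m. f z m n) summable_on UNIV" and smbc: "(\<lambda>m. f z m n - d z m n) summable_on UNIV" for n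
  proof -
    have "(\<lambda>(n, m). f z m n - d z m n) summable_on UNIV \<times> UNIV"
      using summable_on_swap[OF smb[OF z]] .
    thus sm: "(\<lambda>m. f z m n - d z m n) summable_on UNIV"
      using summable_on_SigmaD1[of "\<lambda>n m. f z m n - d z m n" UNIV "\<lambda>_. UNIV" n] by simp
    from summable_on_add[OF this smd(2)[OF z, of n]] show "(\<lambda>m. f z m n) summable_on UNIV" by simp
  qed
  have col_b: "infsum (\<lambda>m. f z m n - d z m n) UNIV = C n - D n" for n
    unfolding C_def D_def by (rule infsum_diff_complex[OF smfc smd(2)[OF z]])
  have sw: "infsum (\<lambda>m. infsum (\<lambda>n. f z m n - d z m n) UNIV) UNIV =
        infsum (\<lambda>n. infsum (\<lambda>m. f z m n - d z m n) UNIV) UNIV"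
    by (rule infsum_swap_banach[OF smb[OF z]])
  have smCD: "(\<lambda>n. C n - D n) summable_on UNIV"
  proof -
    have "(\<lambda>(n, m). f z m n - d z m n) summable_on UNIV \<times> UNIV"
      using summable_on_swap[OF smb[OF z]] .
    thus ?thesis
      using summable_on_Sigma_banach[of "\<lambda>n m. f z m n - d z m n" UNIV "\<lambda>_. UNIV"] by (simp add: col_b)
  qed
  have smD: "D summable_on UNIV"
    using summable_on_diff_complex[OF smC smCD] by simp
  \<comment> \<open>The column sum of the correction is a difference of cotangents at (n - 1/2)/z
    and (n + 1/2)/z. These telescope in n as well, but the cotangent tends to -\<i> high in the
    upper and to \<i> deep in the lower half plane.\<close>
  define t where "t = (\<lambda>n::int. of_real pi / z * cot (of_real pi * ((of_int n - 1 / 2) / z)))"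
  have Dt: "D n = t n - t (n + 1)" for n
  proof -
    define a b where "a = (of_int n - 1 / 2) / z" and "b = (of_int n + 1 / 2) / z"
    have notint: "(of_int n + of_int e / 2) / z \<notin> \<int>" if e: "e = 1 \<or> e = -1" for e :: int
    proof
      assume "(of_int n + of_int e / 2) / z \<in> \<int>"
      then obtain j where "(of_int n + of_int e / 2) / z = of_int j" by (auto elim!: Ints_cases)
      hence "of_int (- j) * z + of_int n + of_int e / 2 = 0" using nz by (simp add: field_simps)
      thus False using half_nz[OF z, of "- j" n] e by auto
    qed
    have ab: "a \<notin> \<int>" "b \<notin> \<int>"
      using notint[of "-1"] notint[of 1] by (simp_all add: a_def b_def)
    have deq: "d z m n = 1 / z * (1 / (a + of_int m) - 1 / (b + of_int m))" for m
    proof -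
      have "of_int m * z + of_int n - 1 / 2 = z * (a + of_int m)"
           "of_int m * z + of_int n + 1 / 2 = z * (b + of_int m)"
        using nz by (simp_all add: a_def b_def field_simps)
      thus ?thesis unfolding d_eq[OF z] by (simp add: right_diff_distrib)
    qed
    have "(\<lambda>m. z * d z m n) summable_on UNIV"
      using smd(2)[OF z] by (rule summable_on_cmult_right)
    hence "(\<lambda>m::int. 1 / (a + of_int m) - 1 / (b + of_int m)) summable_on UNIV"
      using nz by (simp add: deq)
    from has_sum_cmult_right[OF has_sum_cot_diff[OF ab this], of "1 / z"]
    have "D n = 1 / z * (of_real pi * (cot (of_real pi * a) - cot (of_real pi * b)))"
      unfolding D_def deq by (intro infsumI)
    moreover have "b = (of_int (n + 1) - 1 / 2) / z" by (simp add: b_def)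
    hence "t (n + 1) = of_real pi / z * cot (of_real pi * b)" by (simp only: t_def)
    moreover have "t n = of_real pi / z * cot (of_real pi * a)" by (simp only: t_def a_def)
    ultimately show ?thesis by (simp add: right_diff_distrib)
  qed
  have neg: "(\<lambda>k. t (- int k)) \<longlonglongrightarrow> of_real pi / z * (- \<i>)"
  proof -
    have "(of_int (- int k) - 1 / 2) / z = of_nat k * (-1 / z) + (- 1 / 2) / z" for k
      using nz by (simp add: field_simps)
    thus ?thesis unfolding t_def
      by (simp only:) (intro tendsto_mult tendsto_const tendsto_cot_arith z')
  qed
  have pos: "(\<lambda>k. t (int k)) \<longlonglongrightarrow> of_real pi / z * \<i>"
  proof -
    have "of_real pi * ((of_int (int k) - 1 / 2) / z) = - (of_real pi * (of_nat k * (-1 / z) + (1 / 2) / z))" for k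
      using nz by (simp add: field_simps)
    hence "t (int k) = of_real pi / z * - cot (of_real pi * (of_nat k * (-1 / z) + (1 / 2) / z))" for k
      unfolding t_def by (simp only: cot_minus)
    moreover have "(\<lambda>k. of_real pi / z * - cot (of_real pi * (of_nat k * (-1 / z) + (1 / 2) / z)))
        \<longlonglongrightarrow> of_real pi / z * - (- \<i>)"
      by (intro tendsto_mult tendsto_const tendsto_minus tendsto_cot_arith z')
    ultimately show ?thesis by simp
  qed
  have "(D has_sum (of_real pi / z * (- \<i>) - of_real pi / z * \<i>)) UNIV"
  proof -
    have D_fun: "D = (\<lambda>n. t n - t (n + 1))" by (intro ext Dt)
    show ?thesis
      using has_sum_telescope_int[OF smD[unfolded D_fun] neg pos] unfolding D_fun .
  qed
  hence D_sum: "infsum D UNIV = - 2 * of_real pi * \<i> / z"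
    by (simp add: infsumI field_simps)
  \<comment> \<open>Rows first yields \<open>Eis2\<close> at z; columns first yields
    \<open>Eis2\<close> at -1/z together with the sum of \<open>D\<close>. Only the corrected series
    permits the exchange.\<close>
  have "of_real (pi ^ 2 / 3) * Eis2 z = infsum (\<lambda>n. C n - D n) UNIV"
    using sw by (simp add: row_bf[OF z] G[OF z] col_b)
  also have "\<dots> = infsum C UNIV - infsum D UNIV"
    by (rule infsum_diff_complex[OF smC smD])
  also have "infsum C UNIV = (\<Sum>\<^sub>\<infinity>n. infsum (f (-1 / z) n) UNIV * (1 / z ^ 2))"
    by (intro infsum_cong) (simp add: C_eq)
  also have "\<dots> = of_real (pi ^ 2 / 3) * Eis2 (-1 / z) / z ^ 2"
    unfolding infsum_cmult_left' G[OF z'] by simp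
  finally have eq: "of_real (pi ^ 2 / 3) * Eis2 z = of_real (pi ^ 2 / 3) * Eis2 (-1 / z) / z ^ 2 + 2 * of_real pi * \<i> / z"
    by (simp add: D_sum)
  have "Y = z ^ 2 * X - 6 * \<i> * z / p"
    if "p ^ 2 / 3 * X = p ^ 2 / 3 * Y / z ^ 2 + 2 * p * \<i> / z" "p \<noteq> 0" for X Y p :: complex
  proof -
    have "3 * (p * (p * Y)) = 3 * (p * (p * (z ^ 2 * X) - 6 * \<i> * z))"
      using that nz by (simp add: field_simps power2_eq_square)
    hence "p * Y = p * (z ^ 2 * X) - 6 * \<i> * z"
      using that(2) by simp
    thus ?thesis using that(2) by (simp add: field_simps)
  qed
  from this[of "of_real pi" "Eis2 z" "Eis2 (-1 / z)"] eq show ?thesis by simp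
qed

section \<open>Forms of level 1\<close>

text \<open>The logarithm of the product of all 1 - q^n is minus this series.\<close>

definition Delta_log_fps :: "complex fps" where
  "Delta_log_fps = Abs_fps (\<lambda>n. fps_nth (sigma_fps 1) n / of_nat n)"

definition Delta_log :: "complex \<Rightarrow> complex" where
  "Delta_log z = 2 * of_real pi * \<i> * z - 24 * eval_fps Delta_log_fps (nome z)"

text \<open>This is q times the product of all (1 - q^n)^24. Written as an exponential it is free of
  zeros by construction, and its logarithmic derivative is 2 pi \<i> \<open>Eis2\<close>.\<close>

definition Delta :: "complex \<Rightarrow> complex" where
  "Delta z = exp (Delta_log z)"

lemma Delta_nz [simp]: "Delta z \<noteq> 0"
  by (simp add: Delta_def)

lemma fps_conv_radius_ge_1I:
  fixes F :: "complex fps"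
  assumes "\<And>x. norm x < 1 \<Longrightarrow> x \<noteq> 0 \<Longrightarrow> summable (\<lambda>n. fps_nth F n * x ^ n)"
  shows "fps_conv_radius F \<ge> 1"
  unfolding fps_conv_radius_def
proof (rule conv_radius_geI_ex)
  fix r :: real assume "0 < r" "ereal r < 1"
  thus "\<exists>z :: complex. norm z = r \<and> summable (\<lambda>n. fps_nth F n * z ^ n)"
    using assms[of "of_real r"] by (intro exI[of _ "of_real r"]) (auto simp: one_ereal_def)
qed

lemma conv_radius_Delta_log_fps: "fps_conv_radius Delta_log_fps \<ge> 1"
proof (rule fps_conv_radius_ge_1I)
  fix x :: complex assume x: "norm x < 1"
  have "ereal (norm x) < fps_conv_radius (sigma_fps 1)"
    using x by (intro less_le_trans[OF _ conv_radius_sigma_fps]) auto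
  hence "summable (\<lambda>n. norm (fps_nth (sigma_fps 1) n * x ^ n))"
    unfolding fps_conv_radius_def by (rule abs_summable_in_conv_radius)
  moreover have "norm (fps_nth Delta_log_fps n) \<le> norm (fps_nth (sigma_fps 1) n)" for n
    using mult_left_mono[of 1 "real n" "norm (fps_nth (sigma_fps 1) n)"]
    by (cases "n = 0") (auto simp: Delta_log_fps_def norm_divide divide_simps)
  hence "norm (fps_nth Delta_log_fps n * x ^ n) \<le> norm (fps_nth (sigma_fps 1) n * x ^ n)" for n
    by (auto simp: norm_mult intro: mult_right_mono)
  ultimately show "summable (\<lambda>n. fps_nth Delta_log_fps n * x ^ n)"
    by (intro summable_comparison_test[of "\<lambda>n. fps_nth Delta_log_fps n * x ^ n"]) auto
qed

lemma has_field_derivative_Delta_log: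
  assumes z: "Im z > 0"
  shows "(Delta_log has_field_derivative 2 * of_real pi * \<i> * Eis2 z) (at z)"
proof -
  have X: "fps_X * fps_deriv Delta_log_fps = sigma_fps 1"
    by (rule fps_ext) (auto simp: Delta_log_fps_def gr0_conv_Suc simp flip: of_nat_Suc)
  have "((\<lambda>z. 2 * of_real pi * \<i> * z - 24 * eval_fps Delta_log_fps (nome z)) has_field_derivative
        2 * of_real pi * \<i> * 1 - 24 * (2 * of_real pi * \<i> * eval_fps (fps_X * fps_deriv Delta_log_fps) (nome z))) (at z)"
    by (intro DERIV_diff DERIV_cmult DERIV_ident eval_fps_nome_deriv conv_radius_Delta_log_fps z)
  thus ?thesis
    unfolding X Delta_log_def [abs_def] Eis2_eq[OF z] by (simp add: algebra_simps)
qed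

lemma has_field_derivative_Delta:
  assumes z: "Im z > 0"
  shows "(Delta has_field_derivative 2 * of_real pi * \<i> * Eis2 z * Delta z) (at z)"
  unfolding Delta_def [abs_def]
  by (rule derivative_eq_intros has_field_derivative_Delta_log[OF z] refl)+ simp

lemma holomorphic_Delta: "Delta holomorphic_on upper_half_plane"
  unfolding holomorphic_on_open[OF open_upper_half_plane]
  by (intro ballI exI, rule has_field_derivative_Delta) simp

lemma Delta_T: "Delta (z + 1) = Delta z"
  by (simp add: Delta_def Delta_log_def ring_distribs exp_add exp_diff exp_two_pi_i')

text \<open>The anomaly of \<open>Eis2\<close> is exactly the logarithmic derivative 12 / z of z^12,
  so the quotient of the two sides is constant; at the fixed point \<i> it is 1 because \<i>^12 =
  1.\<close>

lemma Delta_S: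
  assumes z: "Im z > 0"
  shows "Delta (-1 / z) = z ^ 12 * Delta z"
proof -
  define h where "h = (\<lambda>z. Delta (-1 / z) / (z ^ 12 * Delta z))"
  have "(h has_field_derivative 0) (at w)" if w: "w \<in> upper_half_plane" for w
  proof -
    have nz: "w \<noteq> 0" using w by auto
    have w': "Im (-1 / w) > 0" using w by (intro Im_uminus_inverse_pos) auto
    have d1: "((\<lambda>w. -1 / w) has_field_derivative 1 / w ^ 2) (at w)"
      using nz by (auto intro!: derivative_eq_intros simp: power2_eq_square)
    have "((\<lambda>w. Delta (-1 / w)) has_field_derivative
        2 * of_real pi * \<i> * Eis2 (-1 / w) * Delta (-1 / w) * (1 / w ^ 2)) (at w)"
      by (rule DERIV_chain2[OF has_field_derivative_Delta[OF w'] d1])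
    moreover have "((\<lambda>w. w ^ 12 * Delta w) has_field_derivative
        12 * w ^ 11 * Delta w + w ^ 12 * (2 * of_real pi * \<i> * Eis2 w * Delta w)) (at w)"
      using w by (auto intro!: derivative_eq_intros has_field_derivative_Delta)
    ultimately have "(h has_field_derivative
        (2 * of_real pi * \<i> * Eis2 (-1 / w) * Delta (-1 / w) * (1 / w ^ 2) * (w ^ 12 * Delta w) -
         Delta (-1 / w) * (12 * w ^ 11 * Delta w + w ^ 12 * (2 * of_real pi * \<i> * Eis2 w * Delta w))) /
        (w ^ 12 * Delta w * (w ^ 12 * Delta w))) (at w)"
      unfolding h_def using nz by (intro DERIV_divide) auto
    also have "2 * of_real pi * \<i> * Eis2 (-1 / w) * Delta (-1 / w) * (1 / w ^ 2) * (w ^ 12 * Delta w) =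
       Delta (-1 / w) * (12 * w ^ 11 * Delta w + w ^ 12 * (2 * of_real pi * \<i> * Eis2 w * Delta w))"
    proof -
      have E: "Eis2 (-1 / w) = w ^ 2 * Eis2 w - 6 * \<i> * w / of_real pi"
        using w by (intro Eis2_S) auto
      have "2 * of_real pi * \<i> * Eis2 (-1 / w) = w * (w * (2 * of_real pi * \<i> * Eis2 w) + 12)"
        unfolding E by (simp add: field_simps power2_eq_square)
      moreover have "w ^ 12 = w ^ 2 * w ^ 10" "w ^ 11 = w * w ^ 10" by (simp_all flip: power_add power_Suc)
      ultimately show ?thesis
        using nz by (simp add: field_simps power2_eq_square)
    qed
    finally show ?thesis by simp
  qed
  hence "\<exists>c. \<forall>w\<in>upper_half_plane. h w = c"
    using has_field_derivative_zero_constant[of upper_half_plane h] convex_halfspace_Im_gt[of 0]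
    by (metis (no_types, lifting) has_field_derivative_at_within upper_half_plane_def)
  then obtain c where c: "\<And>w. Im w > 0 \<Longrightarrow> h w = c" by auto
  have "-1 / \<i> = \<i>" by (simp add: complex_eq_iff)
  hence "h \<i> = 1"
    by (simp add: h_def power_mult[of \<i> 2 6, simplified])
  hence "h z = 1" using c[of \<i>] c[OF z] by simp
  moreover have "z \<noteq> 0" using z by auto
  ultimately show ?thesis by (simp add: h_def)
qed

section \<open>The action of SL2(Z), reduction theory and the vanishing criterion\<close>

lemma moebius_denom_nz:
  fixes a b c d :: int
  assumes "Im z > 0" "a * d - b * c = 1"
  shows "of_int c * z + of_int d \<noteq> 0"
proof
  assume *: "of_int c * z + of_int d = 0"
  hence "Im (of_int c * z + of_int d) = 0" by simp
  hence "c = 0" using assms(1) by simp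
  with * have "d = 0" by simp
  with \<open>c = 0\<close> assms(2) show False by simp
qed

lemma Im_moebius:
  fixes a b c d :: int
  assumes "Im z > 0" "a * d - b * c = 1"
  shows "Im ((of_int a * z + of_int b) / (of_int c * z + of_int d)) > 0"
proof -
  have nz: "of_int c * z + of_int d \<noteq> 0" by (rule moebius_denom_nz[OF assms])
  have "real_of_int a * of_int d - of_int b * of_int c = of_int (a * d - b * c)" by simp
  hence det: "real_of_int a * of_int d - of_int b * of_int c = 1" using assms(2) by simp
  have "Im ((of_int a * z + of_int b) / (of_int c * z + of_int d)) =
      (real_of_int a * of_int d - of_int b * of_int c) * Im z / norm (of_int c * z + of_int d) ^ 2"
    by (simp add: Im_divide cmod_power2) (simp add: algebra_simps)
  thus ?thesis using nz assms(1) unfolding det by simp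
qed

lemma periodic_of_int:
  assumes "\<And>z. Im z > 0 \<Longrightarrow> f (z + 1) = (f z :: 'a)" "Im z > 0"
  shows "f (z + of_int n) = f z"
proof -
  have nat: "f (w + of_nat k) = f w" if "Im w > 0" for w k
    using that
  proof (induction k)
    case (Suc k)
    have "f (w + of_nat (Suc k)) = f ((w + of_nat k) + 1)" by (simp add: algebra_simps)
    also have "\<dots> = f (w + of_nat k)" using Suc by (intro assms(1)) auto
    finally show ?case using Suc by simp
  qed auto
  show ?thesis
  proof (cases "n \<ge> 0")
    case True
    thus ?thesis using nat[OF assms(2), of "nat n"] by simp
  next
    case False
    thus ?thesis using nat[of "z + of_int n" "nat (- n)"] assms(2) by simp
  qed
qed

text \<open>Euclid's algorithm on the lower row. With d = c q + r the matrix is, up to sign, the one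
  with rows (b', -a) and (r, -c) times S T^q, and |r| < |c|. Even weight makes the sign
  harmless.\<close>

lemma modular_SL2:
  fixes f :: "complex \<Rightarrow> complex" and a b c d :: int
  assumes T: "\<And>z. Im z > 0 \<Longrightarrow> f (z + 1) = f z"
    and S: "\<And>z. Im z > 0 \<Longrightarrow> f (-1 / z) = z ^ k * f z"
    and k: "even k" and det: "a * d - b * c = 1" and z: "Im z > 0"
  shows "f ((of_int a * z + of_int b) / (of_int c * z + of_int d)) =
           (of_int c * z + of_int d) ^ k * f z"
  using det z
proof (induction "nat \<bar>c\<bar>" arbitrary: a b c d z rule: less_induct)
  case less
  note z = \<open>Im z > 0\<close> and det = \<open>a * d - b * c = 1\<close>
  show ?case
  proof (cases "c = 0")
    case True
    hence "a * d = 1" using det by simp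
    hence ad: "a = d" "d = 1 \<or> d = -1" by (auto simp: zmult_eq_1_iff)
    hence "(of_int a * z + of_int b) / (of_int c * z + of_int d) = z + of_int (b * d)"
      using True by auto
    moreover have "(of_int d :: complex) ^ k = 1"
      using ad k by auto
    ultimately show ?thesis
      using True periodic_of_int[of f, OF T z, of "b * d"] by simp
  next
    case False
    define q r b' where "q = d div c" and "r = d mod c" and "b' = b - a * q"
    have d: "d = c * q + r" by (simp add: q_def r_def)
    have b: "b = b' + a * q" by (simp add: b'_def)
    have det': "b' * (- c) - (- a) * r = 1"
      using det by (simp add: d b algebra_simps)
    have less': "nat \<bar>r\<bar> < nat \<bar>c\<bar>"
      using False abs_mod_less[of c d] by (simp add: r_def)
    define w where "w = z + of_int q"
    have w: "Im w > 0" using z by (simp add: w_def)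
    define v where "v = -1 / w"
    have v: "Im v > 0" unfolding v_def by (rule Im_uminus_inverse_pos[OF w])
    have wnz: "w \<noteq> 0" using w by auto
    have nz: "of_int c * z + of_int d \<noteq> 0" by (rule moebius_denom_nz[OF z det])
    have e1: "(of_int r * v + of_int (- c)) * w = - (of_int c * z + of_int d)"
      using wnz by (simp add: v_def w_def d field_simps)
    have e2: "(of_int b' * v + of_int (- a)) * w = - (of_int a * z + of_int b)"
      using wnz by (simp add: v_def w_def b field_simps)
    have "of_int r * v + of_int (- c) \<noteq> 0"
      by (rule moebius_denom_nz[OF v det'])
    have "(of_int a * z + of_int b) / (of_int c * z + of_int d) =
        ((of_int b' * v + of_int (- a)) * w) / ((of_int r * v + of_int (- c)) * w)"
      unfolding e1 e2 by (rule minus_divide_divide [symmetric])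
    also have "\<dots> = (of_int b' * v + of_int (- a)) / (of_int r * v + of_int (- c))"
      using wnz by simp
    finally have "f ((of_int a * z + of_int b) / (of_int c * z + of_int d)) =
        (of_int r * v + of_int (- c)) ^ k * f v"
      using less.hyps[OF less' det' v] by simp
    also have "f w = f z"
      unfolding w_def by (rule periodic_of_int[of f, OF T z])
    hence "f v = w ^ k * f z"
      unfolding v_def using S[OF w] by simp
    also have "(of_int r * v + of_int (- c)) ^ k * (w ^ k * f z) =
        ((of_int r * v + of_int (- c)) * w) ^ k * f z"
      by (simp add: power_mult_distrib mult_ac)
    finally show ?thesis unfolding e1 power_minus_even[OF k] .
  qed
qed

text \<open>After translation to |Re w| <= 1/2, a point with Im w < 1/2 has |w|^2 <= 1/2, so
  inversion at least doubles the imaginary part. The resulting strip exceeds the fundamental domain,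
  but its truncations are compact, and that is what matters.\<close>

lemma fundamental_reduction:
  fixes \<phi> :: "complex \<Rightarrow> real"
  assumes T: "\<And>z. Im z > 0 \<Longrightarrow> \<phi> (z + 1) = \<phi> z"
    and S: "\<And>z. Im z > 0 \<Longrightarrow> \<phi> (-1 / z) = \<phi> z" and z: "Im z > 0"
  obtains w where "Im w \<ge> 1 / 2" "\<bar>Re w\<bar> \<le> 1 / 2" "\<phi> w = \<phi> z"
proof -
  have "\<exists>w. Im w \<ge> 1 / 2 \<and> \<bar>Re w\<bar> \<le> 1 / 2 \<and> \<phi> w = \<phi> z"
    if "Im z > 0" "2 ^ k * Im z \<ge> 1 / 2" for k z
    using that
  proof (induction k arbitrary: z)
    case 0
    define w where "w = z + of_int (- round (Re z))"
    have "\<bar>Re w\<bar> \<le> 1 / 2" using of_int_round_abs_le[of "Re z"] by (simp add: w_def abs_minus_commute)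
    moreover have "\<phi> w = \<phi> z" unfolding w_def by (rule periodic_of_int[of \<phi>, OF T 0(1)])
    ultimately show ?case using 0 by (intro exI[of _ w]) (auto simp: w_def)
  next
    case (Suc k)
    define w where "w = z + of_int (- round (Re z))"
    have Re: "\<bar>Re w\<bar> \<le> 1 / 2" using of_int_round_abs_le[of "Re z"] by (simp add: w_def abs_minus_commute)
    have eq: "\<phi> w = \<phi> z" unfolding w_def by (rule periodic_of_int[of \<phi>, OF T Suc.prems(1)])
    have Im: "Im w = Im z" by (simp add: w_def)
    show ?case
    proof (cases "Im z \<ge> 1 / 2")
      case True
      thus ?thesis using Re eq Im by (intro exI[of _ w]) simp
    next
      case False
      have Im_pos: "Im w > 0" using Suc.prems Im by simp
      have "\<bar>Re w\<bar> ^ 2 \<le> (1 / 2) ^ 2" "\<bar>Im w\<bar> ^ 2 \<le> (1 / 2) ^ 2"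
        using Re False Im Im_pos by (intro power_mono; simp)+
      hence "norm w ^ 2 \<le> 1 / 2" unfolding cmod_power2 by (simp add: power2_eq_square)
      moreover have "norm w ^ 2 > 0" using Im_pos by auto
      moreover have "Im (-1 / w) = Im w / norm w ^ 2"
        by (simp add: Im_divide cmod_power2)
      ultimately have "Im (-1 / w) \<ge> 2 * Im w"
        using Im_pos divide_left_mono[of "norm w ^ 2" "1 / 2" "Im w"] by simp
      hence "2 ^ k * Im (-1 / w) \<ge> 2 ^ k * (2 * Im w)" by (intro mult_left_mono) auto
      hence "2 ^ k * Im (-1 / w) \<ge> 1 / 2" using Suc.prems(2) Im by (simp add: mult_ac)
      from Suc.IH[OF Im_uminus_inverse_pos[OF Im_pos] this] S[OF Im_pos] eq show ?thesis by auto
    qed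
  qed
  moreover obtain k where "1 / 2 / Im z < 2 ^ k"
    using real_arch_pow[of 2 "1 / 2 / Im z"] by auto
  hence "2 ^ k * Im z \<ge> 1 / 2" using z by (simp add: field_simps)
  ultimately show ?thesis using z that by blast
qed

lemma Delta_lower_bound:
  obtains c :: real where "c > 0" "\<And>z. Im z \<ge> 1 \<Longrightarrow> norm (Delta z) \<ge> c * exp (- 2 * pi * Im z)"
proof -
  let ?r = "exp (- 2 * pi)"
  have r: "ereal (norm x) < fps_conv_radius Delta_log_fps" if "norm x \<le> ?r" for x :: complex
  proof -
    have "norm x < 1" using that pi_gt_zero by (simp add: order.strict_trans1)
    thus ?thesis
      by (intro less_le_trans[OF _ conv_radius_Delta_log_fps]) auto
  qed
  hence sub: "(cball 0 ?r :: complex set) \<subseteq> eball 0 (fps_conv_radius Delta_log_fps)"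
    by (auto simp: eball_def)
  have "compact (eval_fps Delta_log_fps ` cball 0 ?r)"
    by (intro compact_continuous_image continuous_on_subset[OF continuous_on_eval_fps sub]) auto
  then obtain B where B: "\<And>x. x \<in> cball 0 ?r \<Longrightarrow> norm (eval_fps Delta_log_fps x) \<le> B"
    by (metis bounded_iff compact_imp_bounded imageI)
  have "norm (Delta z) \<ge> exp (- 24 * B) * exp (- 2 * pi * Im z)" if "Im z \<ge> 1" for z :: complex
  proof -
    have "nome z \<in> cball 0 ?r" using that by (simp add: norm_nome)
    hence "norm (24 * eval_fps Delta_log_fps (nome z)) \<le> 24 * B"
      using B by (simp add: norm_mult)
    hence "Re (24 * eval_fps Delta_log_fps (nome z)) \<le> 24 * B"
      using complex_Re_le_cmod order_trans by blast
    hence "- 24 * B + - 2 * pi * Im z \<le> Re (Delta_log z)"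
      by (simp add: Delta_log_def)
    thus ?thesis by (simp add: Delta_def flip: exp_add)
  qed
  thus ?thesis by (intro that[of "exp (- 24 * B)"]) simp_all
qed

text \<open>h^12 / Delta^k has weight 0, is holomorphic since Delta has no zeros, and decays like
  |q|^(12 N - k). Its modulus therefore attains a maximum inside a truncated strip, so the quotient
  is constant, and decay forces 0. Prescribing moduli only leaves room for multipliers of modulus
  1.\<close>

theorem level_one_vanishing:
  assumes hol: "h holomorphic_on upper_half_plane"
    and T: "\<And>z. Im z > 0 \<Longrightarrow> norm (h (z + 1)) = norm (h z)"
    and S: "\<And>z. Im z > 0 \<Longrightarrow> norm (h (-1 / z)) = norm z ^ k * norm (h z)"
    and bd: "\<And>z. Im z \<ge> Y \<Longrightarrow> norm (h z) \<le> C * exp (- 2 * pi * of_nat N * Im z)"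
    and N: "k < 12 * N" and z: "Im z > 0"
  shows "h z = 0"
proof (rule ccontr)
  assume hz: "h z \<noteq> 0"
  define \<phi> where "\<phi> = (\<lambda>z. h z ^ 12 / Delta z ^ k)"
  have hol': "\<phi> holomorphic_on upper_half_plane"
    unfolding \<phi>_def by (intro holomorphic_intros hol holomorphic_Delta) auto
  have T': "norm (\<phi> (w + 1)) = norm (\<phi> w)" if "Im w > 0" for w
    using T[OF that] by (simp add: \<phi>_def Delta_T norm_divide norm_power)
  have S': "norm (\<phi> (-1 / w)) = norm (\<phi> w)" if "Im w > 0" for w
  proof -
    have nz: "w \<noteq> 0" using that by auto
    have "norm (\<phi> (-1 / w)) = (norm w ^ k * norm (h w)) ^ 12 / (norm w ^ 12 * norm (Delta w)) ^ k"
      unfolding \<phi>_def norm_divide norm_power S[OF that] Delta_S[OF that] norm_mult ..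
    also have "\<dots> = norm (h w) ^ 12 / norm (Delta w) ^ k"
      using nz by (simp add: power_mult_distrib mult.commute flip: power_mult)
    finally show ?thesis by (simp add: \<phi>_def norm_divide norm_power)
  qed
  define M where "M = norm (\<phi> z)"
  have M: "M > 0" using hz by (simp add: M_def \<phi>_def)
  obtain c where c: "c > 0" "\<And>z. Im z \<ge> 1 \<Longrightarrow> norm (Delta z) \<ge> c * exp (- 2 * pi * Im z)"
    using Delta_lower_bound by blast
  have \<phi>_bd: "norm (\<phi> w) \<le> C ^ 12 / c ^ k * exp (- 2 * pi * Im w)"
    if w: "Im w \<ge> 1" "Im w \<ge> Y" for w
  proof -
    have "norm (\<phi> w) = norm (h w) ^ 12 / norm (Delta w) ^ k"
      by (simp add: \<phi>_def norm_divide norm_power)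
    also have "\<dots> \<le> (C * exp (- 2 * pi * of_nat N * Im w)) ^ 12 / (c * exp (- 2 * pi * Im w)) ^ k"
      using c w bd[of w] by (intro frac_le power_mono) auto
    also have "\<dots> = C ^ 12 / c ^ k * (exp (12 * (- 2 * pi * of_nat N * Im w)) / exp (of_nat k * (- 2 * pi * Im w)))"
      by (simp add: power_mult_distrib flip: exp_of_nat_mult)
    also have "exp (12 * (- 2 * pi * of_nat N * Im w)) / exp (of_nat k * (- 2 * pi * Im w)) =
        exp (- 2 * pi * Im w * (12 * of_nat N - of_nat k))"
      by (simp add: algebra_simps flip: exp_diff)
    also have "C ^ 12 / c ^ k * \<dots> \<le> C ^ 12 / c ^ k * exp (- 2 * pi * Im w)"
    proof (intro mult_left_mono)
      \<comment> \<open>The exponent is a positive integer, so one full power of |q|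
        survives.\<close>
      have "1 \<le> 12 * real N - real k" using N by linarith
      hence "2 * pi * Im w * 1 \<le> 2 * pi * Im w * (12 * real N - real k)"
        using w by (intro mult_left_mono) auto
      thus "exp (- 2 * pi * Im w * (12 * real N - real k)) \<le> exp (- 2 * pi * Im w)" by simp
    qed (use c in \<open>auto intro!: divide_nonneg_nonneg\<close>)
    finally show ?thesis .
  qed
  have "((\<lambda>y. C ^ 12 / c ^ k * exp (- 2 * pi * y)) \<longlongrightarrow> C ^ 12 / c ^ k * 0) at_top"
    by (intro tendsto_mult tendsto_const filterlim_compose[OF exp_at_bot]
          filterlim_tendsto_neg_mult_at_bot[OF tendsto_const] filterlim_ident) auto
  hence "eventually (\<lambda>y. C ^ 12 / c ^ k * exp (- 2 * pi * y) < M) at_top"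
    using M by (intro order_tendstoD(2)) auto
  then obtain Y0 where Y0: "\<And>y. y \<ge> Y0 \<Longrightarrow> C ^ 12 / c ^ k * exp (- 2 * pi * y) < M"
    by (auto simp: eventually_at_top_linorder)
  define Y1 where "Y1 = max 1 (max Y Y0)"
  have small: "norm (\<phi> w) < M" if "Im w \<ge> Y1" for w
    using \<phi>_bd[of w] Y0[of "Im w"] that by (auto simp: Y1_def)
  define B where "B = cbox (Complex (-1/2) (1/2)) (Complex (1/2) Y1)"
  have B: "w \<in> B \<longleftrightarrow> \<bar>Re w\<bar> \<le> 1 / 2 \<and> 1 / 2 \<le> Im w \<and> Im w \<le> Y1" for w
    by (auto simp: B_def in_cbox_complex_iff abs_le_iff)
  have Bsub: "B \<subseteq> upper_half_plane" by (auto simp: B)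
  obtain w0 where w0: "Im w0 \<ge> 1 / 2" "\<bar>Re w0\<bar> \<le> 1 / 2" "norm (\<phi> w0) = norm (\<phi> z)"
    using fundamental_reduction[of "\<lambda>z. norm (\<phi> z)", OF T' S' z] by blast
  have w0B: "w0 \<in> B"
    using w0 small[of w0] by (force simp: B M_def)
  have "compact B" by (simp add: B_def)
  moreover have "continuous_on B (\<lambda>w. norm (\<phi> w))"
    using holomorphic_on_imp_continuous_on[OF hol'] Bsub continuous_on_subset
    by (intro continuous_on_norm) blast
  ultimately obtain \<xi> where \<xi>: "\<xi> \<in> B" "\<And>w. w \<in> B \<Longrightarrow> norm (\<phi> w) \<le> norm (\<phi> \<xi>)"
    using continuous_attains_sup[of B "\<lambda>w. norm (\<phi> w)"] w0B by blast
  have "M \<le> norm (\<phi> \<xi>)" using \<xi>(2)[OF w0B] w0(3) by (simp add: M_def)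
  have max: "norm (\<phi> w) \<le> norm (\<phi> \<xi>)" if w: "w \<in> upper_half_plane" for w
  proof -
    obtain v where v: "Im v \<ge> 1 / 2" "\<bar>Re v\<bar> \<le> 1 / 2" "norm (\<phi> v) = norm (\<phi> w)"
      using fundamental_reduction[of "\<lambda>z. norm (\<phi> z)", OF T' S', of w] w by auto
    show ?thesis
    proof (cases "v \<in> B")
      case True thus ?thesis using \<xi>(2)[of v] v by simp
    next
      case False
      hence "Im v \<ge> Y1" using v by (auto simp: B)
      from small[OF this] show ?thesis using v \<open>M \<le> norm (\<phi> \<xi>)\<close> by simp
    qed
  qed
  have "\<phi> constant_on upper_half_plane"
    using maximum_modulus_principle[OF hol' open_upper_half_plane connected_upper_half_plane
        open_upper_half_plane order_refl, of \<xi>] max \<xi>(1) Bsub by blast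
  then obtain a where "\<And>w. Im w > 0 \<Longrightarrow> \<phi> w = a" by (auto simp: constant_on_def)
  hence "\<phi> (Complex 0 Y1) = \<phi> z" using z by (simp add: Y1_def)
  with small[of "Complex 0 Y1"] show False by (simp add: M_def)
qed

section \<open>Expansions in the nome\<close>

text \<open>Values off the upper half plane stay free; the radius condition makes
  \<open>eval_fps\<close> meaningful at every nome.\<close>

definition qexp :: "(complex \<Rightarrow> complex) \<Rightarrow> complex fps \<Rightarrow> bool" where
  "qexp f F \<longleftrightarrow> fps_conv_radius F \<ge> 1 \<and> (\<forall>z. Im z > 0 \<longrightarrow> f z = eval_fps F (nome z))"

lemma qexpD: "qexp f F \<Longrightarrow> fps_conv_radius F \<ge> 1" "qexp f F \<Longrightarrow> Im z > 0 \<Longrightarrow> f z = eval_fps F (nome z)"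
  by (auto simp: qexp_def)

lemma nome_in_conv_radius: "fps_conv_radius F \<ge> 1 \<Longrightarrow> Im z > 0 \<Longrightarrow> ereal (norm (nome z)) < fps_conv_radius F"
  by (rule less_le_trans[of _ 1]) (auto intro: norm_nome_less_1)

lemma nome_surj:
  assumes "norm q < 1" "q \<noteq> 0"
  obtains z where "Im z > 0" "nome z = q"
proof -
  define z where "z = Ln q / (2 * of_real pi * \<i>)"
  have "nome z = exp (Ln q)" by (simp add: nome_def z_def)
  hence q: "nome z = q" using assms by simp
  have "exp (- 2 * pi * Im z) < exp 0"
    using assms(1) norm_nome[of z] by (simp add: q)
  hence "Im z > 0" by (simp add: zero_less_mult_iff)
  with q show ?thesis by (intro that)
qed

text \<open>The nome maps the upper half plane onto the punctured unit disc, so convergence at every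
  z already gives radius at least 1.\<close>

lemma has_q_expansion_iff: "has_q_expansion f a \<longleftrightarrow> qexp f (Abs_fps a)"
proof
  assume L: "has_q_expansion f a"
  have s: "(\<lambda>n. a n * nome z ^ n) sums f z" if "Im z > 0" for z
    using L that unfolding has_q_expansion_def nome_def by auto
  have "fps_conv_radius (Abs_fps a) \<ge> 1"
  proof (rule fps_conv_radius_ge_1I)
    fix x :: complex assume "norm x < 1" "x \<noteq> 0"
    then obtain z where "Im z > 0" "nome z = x" by (rule nome_surj)
    with s[of z] show "summable (\<lambda>n. fps_nth (Abs_fps a) n * x ^ n)"
      by (auto simp: sums_iff)
  qed
  thus "qexp f (Abs_fps a)"
    using s by (auto simp: qexp_def eval_fps_def sums_iff)
next
  assume R: "qexp f (Abs_fps a)"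
  show "has_q_expansion f a"
    unfolding has_q_expansion_def nome_def [symmetric]
  proof
    fix z assume "z \<in> upper_half_plane"
    hence z: "Im z > 0" by simp
    show "(\<lambda>n. a n * nome z ^ n) sums f z"
      using sums_eval_fps[OF nome_in_conv_radius[OF qexpD(1)[OF R] z]] qexpD(2)[OF R z] by simp
  qed
qed

lemma qexp_const: "qexp (\<lambda>_. c) (fps_const c)"
  by (auto simp: qexp_def)

lemma qexp_add: "qexp f F \<Longrightarrow> qexp g G \<Longrightarrow> qexp (\<lambda>z. f z + g z) (F + G)"
  unfolding qexp_def
  by (auto simp: eval_fps_add nome_in_conv_radius intro: order_trans[OF _ fps_conv_radius_add])

lemma qexp_diff: "qexp f F \<Longrightarrow> qexp g G \<Longrightarrow> qexp (\<lambda>z. f z - g z) (F - G)"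
  unfolding qexp_def
  by (auto simp: eval_fps_diff nome_in_conv_radius intro: order_trans[OF _ fps_conv_radius_diff])

lemma qexp_mult: "qexp f F \<Longrightarrow> qexp g G \<Longrightarrow> qexp (\<lambda>z. f z * g z) (F * G)"
  unfolding qexp_def
  by (auto simp: eval_fps_mult nome_in_conv_radius intro: order_trans[OF _ fps_conv_radius_mult])

lemma qexp_cmult: "qexp f F \<Longrightarrow> qexp (\<lambda>z. c * f z) (fps_const c * F)"
  by (intro qexp_mult qexp_const)

lemma qexp_power: "qexp f F \<Longrightarrow> qexp (\<lambda>z. f z ^ n) (F ^ n)"
  unfolding qexp_def
  by (auto simp: eval_fps_power nome_in_conv_radius intro: order_trans[OF _ fps_conv_radius_power])

lemma qexp_deriv:
  assumes "qexp f F" "Im z > 0"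
  shows "(f has_field_derivative 2 * of_real pi * \<i> * eval_fps (fps_X * fps_deriv F) (nome z)) (at z)"
proof -
  have "\<forall>\<^sub>F w in nhds z. f w = eval_fps F (nome w)"
    using eventually_nhds_Im_pos[OF assms(2)] by eventually_elim (rule qexpD(2)[OF assms(1)])
  from DERIV_cong_ev[OF refl this refl] show ?thesis
    using eval_fps_nome_deriv[OF qexpD(1)[OF assms(1)] assms(2)] by blast
qed

lemma conv_radius_theta: "fps_conv_radius F \<ge> 1 \<Longrightarrow> fps_conv_radius (fps_X * fps_deriv F :: complex fps) \<ge> 1"
  using order_trans[OF _ fps_conv_radius_deriv[of F]] by (intro order_trans[OF _ fps_conv_radius_mult]) auto

lemma qexp_holomorphic: "qexp f F \<Longrightarrow> f holomorphic_on upper_half_plane"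
  unfolding holomorphic_on_open[OF open_upper_half_plane]
  by (intro ballI exI, rule qexp_deriv) simp_all

lemma qexp_T: "qexp f F \<Longrightarrow> Im z > 0 \<Longrightarrow> f (z + 1) = f z"
  by (simp add: qexp_def)

lemma nome_tendsto_0: "((\<lambda>y. nome (Complex 0 y)) \<longlongrightarrow> 0) at_top"
proof (rule tendsto_norm_zero_cancel)
  show "((\<lambda>y. norm (nome (Complex 0 y))) \<longlongrightarrow> 0) at_top"
    unfolding norm_nome complex.sel
    by (intro filterlim_compose[OF exp_at_bot] filterlim_tendsto_neg_mult_at_bot[OF tendsto_const] filterlim_ident) auto
qed

text \<open>With the lowest power of the nome divided out, Im z -> infinity isolates the leading
  coefficient.\<close>

lemma fps_eq_0_if_eval_0:
  assumes F: "fps_conv_radius F \<ge> 1" and 0: "\<And>z. Im z > 0 \<Longrightarrow> eval_fps F (nome z) = 0"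
  shows "F = 0"
proof (rule ccontr)
  assume nz: "F \<noteq> 0"
  define G where "G = fps_shift (subdegree F) F"
  have G: "fps_conv_radius G \<ge> 1" using F by (simp add: G_def)
  have "F = fps_X ^ subdegree F * G"
    by (simp add: G_def subdegree_decompose mult.commute)
  have "eval_fps G (nome z) = 0" if z: "Im z > 0" for z
  proof -
    have "eval_fps F (nome z) = nome z ^ subdegree F * eval_fps G (nome z)"
      by (subst \<open>F = fps_X ^ subdegree F * G\<close>) (simp add: eval_fps_mult nome_in_conv_radius[OF G z])
    thus ?thesis using 0[OF z] by simp
  qed
  hence "eventually (\<lambda>y. eval_fps G (nome (Complex 0 y)) = 0) at_top"
    by (intro eventually_mono[OF eventually_gt_at_top[of 0]]) auto
  hence "((\<lambda>y. eval_fps G (nome (Complex 0 y))) \<longlongrightarrow> 0) at_top"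
    by (rule tendsto_eventually)
  moreover have "isCont (eval_fps G) 0"
    using G by (intro continuous_eval_fps) (auto intro: less_le_trans[of _ 1])
  from isCont_tendsto_compose[OF this nome_tendsto_0]
  have "((\<lambda>y. eval_fps G (nome (Complex 0 y))) \<longlongrightarrow> fps_nth G 0) at_top"
    by (simp add: eval_fps_at_0)
  ultimately have "fps_nth G 0 = 0"
    by (rule tendsto_unique [OF trivial_limit_at_top_linorder, THEN sym])
  with nz show False by (simp add: G_def)
qed

lemma qexp_unique:
  assumes "qexp f F" "qexp g G" "\<And>z. Im z > 0 \<Longrightarrow> f z = g z"
  shows "F = G"
proof -
  have "F - G = 0"
  proof (rule fps_eq_0_if_eval_0)
    show "fps_conv_radius (F - G) \<ge> 1"
      using qexp_diff[OF assms(1,2)] by (rule qexpD)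
    show "eval_fps (F - G) (nome z) = 0" if "Im z > 0" for z
      using qexpD(2)[OF qexp_diff[OF assms(1,2)] that] assms(3)[OF that] by simp
  qed
  thus ?thesis by simp
qed

lemma qexp_bound:
  assumes "qexp f F" "\<And>i. i < N \<Longrightarrow> fps_nth F i = 0"
  obtains C where "C > 0" "\<And>z. Im z \<ge> 1 \<Longrightarrow> norm (f z) \<le> C * exp (- 2 * pi * of_nat N * Im z)"
proof -
  let ?r = "exp (- 2 * pi)"
  define G where "G = fps_shift N F"
  have G: "fps_conv_radius G \<ge> 1" using assms by (simp add: G_def qexpD)
  have F: "F = fps_X ^ N * G"
    using assms(2) by (intro fps_ext) (auto simp: G_def fps_X_power_mult_nth)
  have r: "ereal (norm x) < fps_conv_radius G" if "norm x \<le> ?r" for x :: complex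
  proof -
    have "norm x < 1" using that pi_gt_zero by (simp add: order.strict_trans1)
    thus ?thesis by (intro less_le_trans[OF _ G]) auto
  qed
  hence sub: "(cball 0 ?r :: complex set) \<subseteq> eball 0 (fps_conv_radius G)"
    by (auto simp: eball_def)
  have "compact (eval_fps G ` cball 0 ?r)"
    by (intro compact_continuous_image continuous_on_subset[OF continuous_on_eval_fps sub]) auto
  then obtain B where B: "\<And>x. x \<in> cball 0 ?r \<Longrightarrow> norm (eval_fps G x) \<le> B"
    by (metis bounded_iff compact_imp_bounded imageI)
  have "norm (f z) \<le> (\<bar>B\<bar> + 1) * exp (- 2 * pi * of_nat N * Im z)" if z: "Im z \<ge> 1" for z
  proof -
    have "nome z \<in> cball 0 ?r" using z by (simp add: norm_nome)
    hence "norm (eval_fps G (nome z)) \<le> \<bar>B\<bar> + 1" using B by fastforce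
    moreover have "f z = nome z ^ N * eval_fps G (nome z)"
      using z by (simp add: qexpD(2)[OF assms(1)] F eval_fps_mult nome_in_conv_radius[OF G])
    moreover have "norm (nome z) ^ N = exp (- 2 * pi * of_nat N * Im z)"
      by (simp add: norm_nome flip: exp_of_nat_mult)
    ultimately show ?thesis
      by (simp add: norm_mult norm_power mult.commute mult_right_mono)
  qed
  thus ?thesis by (intro that[of "\<bar>B\<bar> + 1"]) auto
qed

definition dilate_fps :: "nat \<Rightarrow> complex fps \<Rightarrow> complex fps" where
  "dilate_fps m F = Abs_fps (\<lambda>n. if m dvd n then fps_nth F (n div m) else 0)"

lemma qexp_dilate:
  assumes f: "qexp f F" and m: "m > 0"
  shows "qexp (\<lambda>z. f (of_nat m * z)) (dilate_fps m F)"
proof -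
  have s: "(\<lambda>n. fps_nth (dilate_fps m F) n * x ^ n) sums eval_fps F (x ^ m)" if x: "norm x < 1" for x
  proof -
    have "ereal (norm (x ^ m)) < fps_conv_radius F"
      using x m by (intro less_le_trans[OF _ qexpD(1)[OF f]]) (auto simp: norm_power power_less_one_iff)
    hence "(\<lambda>n. fps_nth F n * (x ^ m) ^ n) sums eval_fps F (x ^ m)"
      by (rule sums_eval_fps)
    hence "(\<lambda>n. fps_nth (dilate_fps m F) (m * n) * x ^ (m * n)) sums eval_fps F (x ^ m)"
      using m by (simp add: dilate_fps_def power_mult)
    thus ?thesis
      using m
      by (subst (asm) sums_mono_reindex) (auto simp: dilate_fps_def strict_mono_def elim!: dvdE)
  qed
  show ?thesis
    unfolding qexp_def
  proof (intro conjI allI impI)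
    show "fps_conv_radius (dilate_fps m F) \<ge> 1"
      using s by (intro fps_conv_radius_ge_1I) (auto simp: sums_iff)
    fix z assume z: "Im z > 0"
    have "Im (of_nat m * z) > 0" using z m by simp
    from qexpD(2)[OF f this] show "f (of_nat m * z) = eval_fps (dilate_fps m F) (nome z)"
      using s[OF norm_nome_less_1[OF z]] by (simp add: nome_of_nat_mult eval_fps_def sums_iff)
  qed
qed

section \<open>Ramanujan's identity and the Eisenstein series of weight 4\<close>

lemma qexp_Eis2: "qexp Eis2 E2_fps"
  by (simp add: qexp_def Eis2_def conv_radius_E2_fps)

text \<open>Ramanujan's identity is made the definition; \<open>E4_fps_eq\<close> then recovers the
  divisor sums.\<close>

definition E4_fps :: "complex fps" where
  "E4_fps = E2_fps ^ 2 - fps_const 12 * (fps_X * fps_deriv E2_fps)"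

definition Eis4 :: "complex \<Rightarrow> complex" where
  "Eis4 z = eval_fps E4_fps (nome z)"

definition theta_Eis2 :: "complex \<Rightarrow> complex" where
  "theta_Eis2 z = eval_fps (fps_X * fps_deriv E2_fps) (nome z)"

lemma qexp_theta_Eis2: "qexp theta_Eis2 (fps_X * fps_deriv E2_fps)"
  by (simp add: qexp_def theta_Eis2_def conv_radius_theta conv_radius_E2_fps)

lemma qexp_Eis4': "qexp (\<lambda>z. Eis2 z ^ 2 - 12 * theta_Eis2 z) E4_fps"
  unfolding E4_fps_def by (intro qexp_diff qexp_power qexp_cmult qexp_Eis2 qexp_theta_Eis2)

lemma qexp_Eis4: "qexp Eis4 E4_fps"
  using qexp_Eis4' by (simp add: qexp_def Eis4_def)

lemma Eis4_eq: "Im z > 0 \<Longrightarrow> Eis4 z = Eis2 z ^ 2 - 12 * theta_Eis2 z"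
  using qexpD(2)[OF qexp_Eis4'] by (simp add: Eis4_def)

lemma theta_Eis2_S:
  assumes z: "Im z > 0"
  shows "theta_Eis2 (-1 / z) = z ^ 4 * theta_Eis2 z - \<i> * z ^ 3 * Eis2 z / of_real pi - 3 * z ^ 2 / of_real pi ^ 2"
proof -
  have nz: "z \<noteq> 0" using z by auto
  have z': "Im (-1 / z) > 0" by (rule Im_uminus_inverse_pos[OF z])
  have d1: "((\<lambda>w. -1 / w) has_field_derivative 1 / z ^ 2) (at z)"
    using nz by (auto intro!: derivative_eq_intros simp: power2_eq_square)
  have "((\<lambda>w. Eis2 (-1 / w)) has_field_derivative 2 * of_real pi * \<i> * theta_Eis2 (-1 / z) * (1 / z ^ 2)) (at z)"
    unfolding theta_Eis2_def by (rule DERIV_chain2[OF qexp_deriv[OF qexp_Eis2 z'] d1])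
  moreover have "((\<lambda>w. w ^ 2 * Eis2 w - 6 * \<i> * w / of_real pi) has_field_derivative
      2 * z * Eis2 z + z ^ 2 * (2 * of_real pi * \<i> * theta_Eis2 z) - 6 * \<i> / of_real pi) (at z)"
    unfolding theta_Eis2_def by (auto intro!: derivative_eq_intros qexp_deriv[OF qexp_Eis2 z])
  moreover have "\<forall>\<^sub>F w in nhds z. Eis2 (-1 / w) = w ^ 2 * Eis2 w - 6 * \<i> * w / of_real pi"
    using eventually_nhds_Im_pos[OF z] by eventually_elim (rule Eis2_S)
  note DERIV_cong_ev[OF refl this refl]
  ultimately have eq: "2 * of_real pi * \<i> * theta_Eis2 (-1 / z) * (1 / z ^ 2) =
      2 * z * Eis2 z + z ^ 2 * (2 * of_real pi * \<i> * theta_Eis2 z) - 6 * \<i> / of_real pi"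
    using DERIV_unique by blast
  have "Y = z ^ 4 * D - \<i> * z ^ 3 * X / p - 3 * z ^ 2 / p ^ 2"
    if "2 * p * \<i> * Y * (1 / z ^ 2) = 2 * z * X + z ^ 2 * (2 * p * \<i> * D) - 6 * \<i> / p" "p \<noteq> 0" for p X Y D :: complex
  proof -
    have "Y = (2 * p * \<i> * Y * (1 / z ^ 2)) * (z ^ 2 / (2 * p * \<i>))"
      using that nz by (simp add: field_simps)
    also have "\<dots> = z ^ 4 * D - \<i> * z ^ 3 * X / p - 3 * z ^ 2 / p ^ 2"
      unfolding that(1) using that(2) by (simp add: field_simps eval_nat_numeral)
    finally show ?thesis .
  qed
  from this[OF eq] show ?thesis by simp
qed

text \<open>The anomalies of \<open>Eis2\<close> squared and of 12 \<open>theta_Eis2\<close> are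
  equal, so they cancel.\<close>

lemma Eis4_S:
  assumes z: "Im z > 0"
  shows "Eis4 (-1 / z) = z ^ 4 * Eis4 z"
  unfolding Eis4_eq[OF z] Eis4_eq[OF Im_uminus_inverse_pos[OF z]] theta_Eis2_S[OF z] Eis2_S[OF z]
  by (simp add: field_simps eval_nat_numeral)

lemma Eis4_T: "Im z > 0 \<Longrightarrow> Eis4 (z + 1) = Eis4 z"
  by (rule qexp_T[OF qexp_Eis4])

lemma sigma_fps_1 [simp]: "fps_nth (sigma_fps j) (Suc 0) = 1"
  by (simp add: sigma_fps_def)

text \<open>Scaled to a common constant term, \<open>Eis4\<close> and the lattice series differ by a
  form of level 1 and weight 4 that vanishes at infinity, and 4 < 12.\<close>

theorem E4_fps_eq: "E4_fps = 1 + fps_const 240 * sigma_fps 3"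
proof -
  define c where "c = Eis4_const"
  define b :: complex where "b = of_real (16 * pi ^ 4 / 3)"
  have lat: "qexp lattice_Eis4 (fps_const c + fps_const b * sigma_fps 3)"
  proof -
    have "qexp (\<lambda>z. eval_fps (sigma_fps 3) (nome z)) (sigma_fps 3)"
      by (simp add: qexp_def conv_radius_sigma_fps)
    from qexp_add[OF qexp_const qexp_cmult[OF this]] show ?thesis
      unfolding lattice_Eis4_def [abs_def] b_def c_def .
  qed
  define h where "h = (\<lambda>z. c * Eis4 z - lattice_Eis4 z)"
  have h: "qexp h (fps_const c * E4_fps - (fps_const c + fps_const b * sigma_fps 3))"
    unfolding h_def by (intro qexp_diff qexp_cmult qexp_Eis4 lat)
  have E4_0: "fps_nth E4_fps 0 = 1" and E4_1: "fps_nth E4_fps (Suc 0) = 240"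
    by (simp_all add: E4_fps_def E2_fps_def power2_eq_square fps_mult_nth)
  obtain C where C: "C > 0" "\<And>z. Im z \<ge> 1 \<Longrightarrow> norm (h z) \<le> C * exp (- 2 * pi * of_nat 1 * Im z)"
    using qexp_bound[OF h, of 1] by (auto simp: E4_0)
  have "h z = 0" if z: "Im z > 0" for z
  proof (rule level_one_vanishing[OF qexp_holomorphic[OF h], of 4 1 C 1])
    show "norm (h (z + 1)) = norm (h z)" if "Im z > 0" for z
      using qexp_T[OF h that] by simp
    show "norm (h (-1 / z)) = norm z ^ 4 * norm (h z)" if "Im z > 0" for z
    proof -
      have "h (-1 / z) = z ^ 4 * h z"
        unfolding h_def Eis4_S[OF that] lattice_Eis4_S[OF that] by (simp add: algebra_simps)
      thus ?thesis by (simp add: norm_mult norm_power)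
    qed
  qed (use z C in auto)
  hence "fps_const c * E4_fps - (fps_const c + fps_const b * sigma_fps 3) = 0"
    by (intro qexp_unique[OF h]) (use qexp_const[of 0] in auto)
  hence eq: "fps_const c * E4_fps = fps_const c + fps_const b * sigma_fps 3" by simp
  \<comment> \<open>The coefficient of q both fixes the ratio 240 and shows that \<open>c\<close> is
    not 0.\<close>
  from arg_cong[OF this, of "\<lambda>F. fps_nth F 1"] have b: "b = c * 240"
    by (simp add: E4_1)
  have "c \<noteq> 0" using b pi_gt_zero by (auto simp: b_def)
  have "fps_const c * E4_fps = fps_const c * (1 + fps_const 240 * sigma_fps 3)"
    unfolding eq b by (simp add: algebra_simps flip: fps_const_mult)
  thus ?thesis using \<open>c \<noteq> 0\<close> by (subst (asm) mult_cancel_left) auto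
qed

section \<open>Forms of level 13\<close>

definition Gamma0_13_inv :: "nat \<Rightarrow> (complex \<Rightarrow> complex) \<Rightarrow> bool" where
  "Gamma0_13_inv k f \<longleftrightarrow> (\<forall>a b c d z. a * d - b * c = 1 \<longrightarrow> 13 dvd c \<longrightarrow> Im z > 0 \<longrightarrow>
     f ((of_int a * z + of_int b) / (of_int c * z + of_int d)) = (of_int c * z + of_int d) ^ k * f z)"

lemma Gamma0_13_invD:
  "Gamma0_13_inv k f \<Longrightarrow> a * d - b * c = 1 \<Longrightarrow> 13 dvd c \<Longrightarrow> Im z > 0 \<Longrightarrow>
     f ((of_int a * z + of_int b) / (of_int c * z + of_int d)) = (of_int c * z + of_int d) ^ k * f z"
  unfolding Gamma0_13_inv_def by blast

text \<open>Here \<open>h\<close> is half the weight and \<open>\<epsilon>\<close> the eigenvalue of the Fricke involution.\<close>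

definition mform :: "nat \<Rightarrow> complex \<Rightarrow> (complex \<Rightarrow> complex) \<Rightarrow> complex fps \<Rightarrow> bool" where
  "mform h \<epsilon> f F \<longleftrightarrow> qexp f F \<and> Gamma0_13_inv (2 * h) f \<and>
     (\<forall>z. Im z > 0 \<longrightarrow> f (-1 / (13 * z)) = \<epsilon> * (13 * z ^ 2) ^ h * f z)"

lemma mformD:
  assumes "mform h \<epsilon> f F"
  shows "qexp f F" "Gamma0_13_inv (2 * h) f" "\<And>z. Im z > 0 \<Longrightarrow> f (-1 / (13 * z)) = \<epsilon> * (13 * z ^ 2) ^ h * f z"
  using assms by (auto simp: mform_def)

lemma mform_add: "mform h \<epsilon> f F \<Longrightarrow> mform h \<epsilon> g G \<Longrightarrow> mform h \<epsilon> (\<lambda>z. f z + g z) (F + G)"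
  unfolding mform_def Gamma0_13_inv_def by (auto intro: qexp_add simp: ring_distribs)

lemma mform_cmult: "mform h \<epsilon> f F \<Longrightarrow> mform h \<epsilon> (\<lambda>z. c * f z) (fps_const c * F)"
  unfolding mform_def Gamma0_13_inv_def by (auto intro: qexp_cmult)

lemma mform_diff: "mform h \<epsilon> f F \<Longrightarrow> mform h \<epsilon> g G \<Longrightarrow> mform h \<epsilon> (\<lambda>z. f z - g z) (F - G)"
  unfolding mform_def Gamma0_13_inv_def by (auto intro: qexp_diff simp: ring_distribs)

lemma mform_mult:
  "mform h \<epsilon> f F \<Longrightarrow> mform h' \<epsilon>' g G \<Longrightarrow> mform (h + h') (\<epsilon> * \<epsilon>') (\<lambda>z. f z * g z) (F * G)"
  unfolding mform_def Gamma0_13_inv_def by (auto intro: qexp_mult simp: power_add ring_distribs)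

lemma qexp_eventually_nonzero:
  assumes f: "qexp f F" and "F \<noteq> 0"
  obtains Y where "\<And>z. Im z \<ge> Y \<Longrightarrow> Im z > 0 \<Longrightarrow> f z \<noteq> 0"
proof -
  define G where "G = fps_shift (subdegree F) F"
  have G: "fps_conv_radius G \<ge> 1" using qexpD(1)[OF f] by (simp add: G_def)
  have F: "F = fps_X ^ subdegree F * G"
    by (simp add: G_def subdegree_decompose mult.commute)
  have "isCont (eval_fps G) 0"
    using G by (intro continuous_eval_fps) (auto intro: less_le_trans[of _ 1])
  moreover have "eval_fps G 0 \<noteq> 0"
    using assms(2) by (simp add: eval_fps_at_0 G_def)
  ultimately have "eventually (\<lambda>q. eval_fps G q \<noteq> 0) (nhds 0)"
    by (intro tendsto_imp_eventually_ne) (auto simp: isCont_def tendsto_at_iff_tendsto_nhds)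
  then obtain \<delta> where \<delta>: "\<delta> > 0" "\<And>q. norm q < \<delta> \<Longrightarrow> eval_fps G q \<noteq> 0"
    by (auto simp: eventually_nhds_metric)
  have "((\<lambda>y. exp (- 2 * pi * y)) \<longlongrightarrow> 0) at_top"
    by (intro filterlim_compose[OF exp_at_bot] filterlim_tendsto_neg_mult_at_bot[OF tendsto_const] filterlim_ident) auto
  hence "eventually (\<lambda>y. exp (- 2 * pi * y) < \<delta>) at_top"
    using \<delta>(1) by (rule order_tendstoD(2))
  then obtain Y where Y: "\<And>y. y \<ge> Y \<Longrightarrow> exp (- 2 * pi * y) < \<delta>"
    by (auto simp: eventually_at_top_linorder)
  have "f z \<noteq> 0" if z: "Im z \<ge> Y" "Im z > 0" for z
  proof -
    have "f z = nome z ^ subdegree F * eval_fps G (nome z)"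
      unfolding qexpD(2)[OF f z(2)]
      by (subst F) (simp add: eval_fps_mult nome_in_conv_radius[OF G z(2)])
    thus ?thesis using \<delta>(2)[of "nome z"] Y[OF z(1)] by (simp add: norm_nome)
  qed
  thus ?thesis by (rule that)
qed

text \<open>The entry at position \<open>j\<close> is \<open>- 1 / j\<close> modulo 13; the one at \<open>0\<close> is junk.\<close>

definition neg_inverse13 :: "nat \<Rightarrow> nat" where
  "neg_inverse13 j = [0, 12, 6, 4, 3, 5, 2, 11, 8, 10, 9, 7, 1] ! j"

lemma neg_inverse13:
  assumes "j \<in> {1..<13}"
  shows "neg_inverse13 j \<in> {1..<13}" "neg_inverse13 (neg_inverse13 j) = j" "13 dvd j * neg_inverse13 j + 1"
proof -
  have "j = 1 \<or> j = 2 \<or> j = 3 \<or> j = 4 \<or> j = 5 \<or> j = 6 \<or> j = 7 \<or> j = 8 \<or> j = 9 \<or> j = 10 \<or> j = 11 \<or> j = 12"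
    using assms by (simp, presburger)
  thus "neg_inverse13 j \<in> {1..<13}" "neg_inverse13 (neg_inverse13 j) = j" "13 dvd j * neg_inverse13 j + 1"
    by (elim disjE; simp add: neg_inverse13_def)+
qed

text \<open>With j i + 1 = 13 m, the matrix with rows (j, -m) and (13, -i) lies in
  \<open>Gamma0 13\<close> and maps (z + i)/13 to (-1/z + j)/13; its automorphy factor there is
  z.\<close>

lemma coset_transform:
  assumes f: "Gamma0_13_inv k f" and j: "j \<in> {1..<13}" and z: "Im z > 0"
  shows "f ((-1 / z + of_nat j) / 13) = z ^ k * f ((z + of_nat (neg_inverse13 j)) / 13)"
proof -
  define i where "i = neg_inverse13 j"
  define w where "w = (z + of_nat i) / 13"
  have "13 dvd j * i + 1" unfolding i_def by (rule neg_inverse13[OF j])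
  then obtain m where m: "j * i + 1 = 13 * m" by (elim dvdE)
  have w: "Im w > 0" using z by (simp add: w_def)
  have nz: "z \<noteq> 0" using z by auto
  have m': "(of_nat j * of_nat i + 1 :: complex) = 13 * of_nat m"
    using arg_cong[OF m, of "of_nat :: nat \<Rightarrow> complex"] by (simp add: add.commute)
  have det: "int j * (- int i) - (- int m) * 13 = 1"
    using arg_cong[OF m, of int] by (simp add: algebra_simps)
  have zw: "of_int 13 * w + of_int (- int i) = z" by (simp add: w_def add_divide_distrib)
  have "of_int (int j) * w + of_int (- int m) = (of_nat j * z + (of_nat j * of_nat i - 13 * of_nat m)) / 13"
    by (simp add: w_def field_simps)
  also have "of_nat j * of_nat i - 13 * of_nat m = (- 1 :: complex)"
    using m' by (simp add: algebra_simps)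
  finally have num: "of_int (int j) * w + of_int (- int m) = (of_nat j * z - 1) / 13" by simp
  have arg: "(-1 / z + of_nat j) / 13 = (of_int (int j) * w + of_int (- int m)) / (of_int 13 * w + of_int (- int i))"
    unfolding zw num using nz by (simp add: field_simps)
  have "f ((-1 / z + of_nat j) / 13) = z ^ k * f w"
    using Gamma0_13_invD[OF f det dvd_refl w] unfolding arg zw .
  thus ?thesis by (simp add: w_def i_def)
qed

lemma coset_bij: "bij_betw neg_inverse13 {1..<13} {1..<13}"
  by (rule bij_betwI[where g = neg_inverse13]) (use neg_inverse13 in auto)

lemma atLeastLessThan_13: "{..<13 :: nat} = insert 0 {1..<13}"
  by auto

text \<open>
  The product of \<open>f\<close> and all \<open>f ((z + j) / 13)\<close> is, up to a constant, the norm of \<open>f\<close> to level 1. Since \<open>f\<close> is a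
  Fricke eigenform, it vanishes to order \<open>n\<close> at both cusps, so the norm vanishes to order \<open>2 n\<close>.
\<close>

theorem level_13_vanishing:
  assumes f: "mform h \<epsilon> f F" and \<epsilon>: "norm \<epsilon> = 1"
    and 0: "\<And>i. i < n \<Longrightarrow> fps_nth F i = 0" and n: "7 * h < 6 * n"
  shows "F = 0"
proof (rule ccontr)
  assume "F \<noteq> 0"
  note q = mformD(1)[OF f] and inv = mformD(2)[OF f] and fricke = mformD(3)[OF f]
  define N where "N = (\<lambda>z. f z * (\<Prod>j<13. f ((z + of_nat j) / 13)))"
  have hol: "f holomorphic_on upper_half_plane" by (rule qexp_holomorphic[OF q])
  have hol_shift: "(\<lambda>z. f ((z + of_nat j) / 13)) holomorphic_on upper_half_plane" for j
  proof -
    have "(\<lambda>z. (z + of_nat j) / 13) holomorphic_on upper_half_plane"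
      by (intro holomorphic_intros) auto
    moreover have "(\<lambda>z. (z + of_nat j) / 13) ` upper_half_plane \<subseteq> upper_half_plane" by auto
    ultimately show ?thesis
      using holomorphic_on_compose_gen[OF _ hol] by (force simp: o_def)
  qed
  have holN: "N holomorphic_on upper_half_plane"
    unfolding N_def by (intro holomorphic_intros hol hol_shift)
  have T: "N (z + 1) = N z" if z: "Im z > 0" for z
  proof -
    define g where "g = (\<lambda>j::nat. f ((z + of_nat j) / 13))"
    have "(\<Prod>j<13. f ((z + 1 + of_nat j) / 13)) = (\<Prod>j<13. g (Suc j))"
      by (simp add: g_def algebra_simps)
    also have "\<dots> = (\<Prod>j<12. g (Suc j)) * g 13"
      using prod.lessThan_Suc[of "\<lambda>j. g (Suc j)" 12] by simp
    also have "g 13 = f (z / 13 + 1)" by (simp add: g_def add_divide_distrib)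
    also have "\<dots> = g 0" using z by (subst qexp_T[OF q]) (simp_all add: g_def)
    also have "(\<Prod>j<12. g (Suc j)) * g 0 = (\<Prod>j<13. g j)"
      using prod.lessThan_Suc_shift[of g 12] by (simp add: mult.commute)
    finally show ?thesis using qexp_T[OF q z] by (simp add: N_def g_def)
  qed
  have S: "norm (N (-1 / z)) = norm z ^ (28 * h) * norm (N z)" if z: "Im z > 0" for z
  proof -
    have nz: "z \<noteq> 0" using z by auto
    \<comment> \<open>Inversion exchanges the factors at z and z / 13 through the Fricke involution;
      the other twelve are permuted by \<open>neg_inverse13\<close>.\<close>
    have "Im (z / 13) > 0" using z by simp
    from fricke[OF this] have f1: "f (-1 / z) = \<epsilon> * (13 * (z / 13) ^ 2) ^ h * f (z / 13)" by simp
    have f2: "f ((-1 / z + of_nat 0) / 13) = \<epsilon> * (13 * z ^ 2) ^ h * f z"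
      using fricke[OF z] by (simp add: mult.commute)
    have "(\<Prod>j\<in>{1..<13}. f ((-1 / z + of_nat j) / 13)) =
        (\<Prod>j\<in>{1..<13}. z ^ (2 * h) * f ((z + of_nat (neg_inverse13 j)) / 13))"
      by (intro prod.cong refl coset_transform[OF inv _ z])
    also have "\<dots> = z ^ (24 * h) * (\<Prod>j\<in>{1..<13}. f ((z + of_nat (neg_inverse13 j)) / 13))"
      by (simp add: prod.distrib flip: power_mult)
    also have "(\<Prod>j\<in>{1..<13}. f ((z + of_nat (neg_inverse13 j)) / 13)) =
        (\<Prod>j\<in>{1..<13}. f ((z + of_nat j) / 13))"
      by (rule prod.reindex_bij_betw[OF coset_bij, of "\<lambda>j. f ((z + of_nat j) / 13)"])
    finally have f3: "(\<Prod>j\<in>{1..<13}. f ((-1 / z + of_nat j) / 13)) = 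
        z ^ (24 * h) * (\<Prod>j\<in>{1..<13}. f ((z + of_nat j) / 13))" .
    have "N (-1 / z) = (\<epsilon> * (13 * (z / 13) ^ 2) ^ h * f (z / 13)) * ((\<epsilon> * (13 * z ^ 2) ^ h * f z) *
        (z ^ (24 * h) * (\<Prod>j\<in>{1..<13}. f ((z + of_nat j) / 13))))"
      unfolding N_def atLeastLessThan_13 by (subst prod.insert) (simp_all only: f1 f2 f3, auto)
    also have "\<dots> = \<epsilon> ^ 2 * ((13 * (z / 13) ^ 2) ^ h * (13 * z ^ 2) ^ h * z ^ (24 * h)) * N z"
      unfolding N_def atLeastLessThan_13 by (subst prod.insert) (auto simp: power2_eq_square)
    also have "(13 * (z / 13) ^ 2) ^ h * (13 * z ^ 2) ^ h * z ^ (24 * h) = z ^ (28 * h)"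
    proof -
      have "(13 * (z / 13) ^ 2) * (13 * z ^ 2) = z ^ 4" by (simp add: field_simps eval_nat_numeral)
      hence "(13 * (z / 13) ^ 2) ^ h * (13 * z ^ 2) ^ h = z ^ (4 * h)"
        by (metis power_mult power_mult_distrib)
      thus ?thesis by (simp flip: power_add)
    qed
    finally show ?thesis using \<epsilon> by (simp add: norm_mult norm_power)
  qed
  obtain C where C: "C > 0" "\<And>z. Im z \<ge> 1 \<Longrightarrow> norm (f z) \<le> C * exp (- 2 * pi * of_nat n * Im z)"
    using qexp_bound[OF q 0] by blast
  \<comment> \<open>Im z >= 13 keeps every (z + j)/13 at height at least 1. Thirteen factors of
    order n, at a thirteenth of the height, contribute the order n once more.\<close>
  have bd: "norm (N z) \<le> C ^ 14 * exp (- 2 * pi * of_nat (2 * n) * Im z)" if z: "Im z \<ge> 13" for z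
  proof -
    have "(\<Prod>j<13. norm (f ((z + of_nat j) / 13))) \<le> (\<Prod>j<13::nat. C * exp (- 2 * pi * of_nat n * (Im z / 13)))"
    proof (rule prod_mono, intro conjI)
      fix j :: nat
      show "norm (f ((z + of_nat j) / 13)) \<le> C * exp (- 2 * pi * of_nat n * (Im z / 13))"
        using C(2)[of "(z + of_nat j) / 13"] z by simp
    qed auto
    also have "\<dots> = C ^ 13 * exp (- 2 * pi * of_nat n * Im z)"
      by (simp add: power_mult_distrib flip: exp_of_nat_mult)
    finally have "norm (N z) \<le> (C * exp (- 2 * pi * of_nat n * Im z)) * (C ^ 13 * exp (- 2 * pi * of_nat n * Im z))"
      unfolding N_def norm_mult prod_norm [symmetric] using C z by (intro mult_mono) (auto intro!: prod_nonneg)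
    also have "\<dots> = C ^ 14 * exp (- 2 * pi * of_nat (2 * n) * Im z)"
      by (simp add: eval_nat_numeral algebra_simps flip: exp_add)
    finally show ?thesis .
  qed
  \<comment> \<open>The norm has weight 28 h and order 2 n, so the level 1 criterion 28 h < 12 * 2 n
    is the hypothesis 7 h < 6 n.\<close>
  have N0: "N z = 0" if "Im z > 0" for z
    by (rule level_one_vanishing[OF holN _ S bd _ that]) (use T n in auto)
  obtain Y where Y: "\<And>z. Im z \<ge> Y \<Longrightarrow> Im z > 0 \<Longrightarrow> f z \<noteq> 0"
    using qexp_eventually_nonzero[OF q \<open>F \<noteq> 0\<close>] by blast
  define z where "z = Complex 0 (13 * max 1 Y)"
  have z: "Im z > 0" by (simp add: z_def)
  have "Im z \<ge> Y" by (auto simp: z_def max_def)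
  moreover have "Im ((z + of_nat j) / 13) \<ge> Y" "Im ((z + of_nat j) / 13) > 0" for j
    by (auto simp: z_def)
  ultimately have "N z \<noteq> 0" unfolding N_def using Y z by (auto simp del: of_nat_eq_0_iff)
  with N0[OF z] show False by simp
qed

section \<open>Cusp forms of level 13: decay at the cusps and the Fricke involution\<close>

lemma tendsto_zero_Im_at_top_iff:
  fixes f :: "complex \<Rightarrow> complex"
  shows "(f \<longlongrightarrow> 0) (filtercomap Im at_top) \<longleftrightarrow> (\<forall>e>0. \<exists>Y. \<forall>z. Im z \<ge> Y \<longrightarrow> norm (f z) < e)"
  by (simp add: tendsto_iff eventually_filtercomap_at_top_linorder)

definition mat2 :: "int \<Rightarrow> int \<Rightarrow> int \<Rightarrow> int \<Rightarrow> int ^ 2 ^ 2" where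
  "mat2 a b c d = vector [vector [a, b], vector [c, d]]"

lemma mat2_nth [simp]: "mat2 a b c d $ 1 $ 1 = a" "mat2 a b c d $ 1 $ 2 = b"
  "mat2 a b c d $ 2 $ 1 = c" "mat2 a b c d $ 2 $ 2 = d"
  by (simp_all add: mat2_def vector_2)

lemma mat2_SL2Z: "mat2 a b c d \<in> SL2Z \<longleftrightarrow> a * d - b * c = 1"
  by (simp add: SL2Z_def det_2)

lemma cusp_form_Gamma0:
  assumes "f \<in> cusp_forms k 13"
  shows "Gamma0_13_inv k f"
  unfolding Gamma0_13_inv_def
proof (intro allI impI)
  fix a b c d :: int and z :: complex
  assume *: "a * d - b * c = 1" "13 dvd c" "Im z > 0"
  have "mat2 a b c d \<in> Gamma0 13"
    using * by (simp add: Gamma0_def mat2_SL2Z)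
  hence "slash k f (mat2 a b c d) z = f z"
    using assms * by (auto simp: cusp_forms_def)
  thus "f ((of_int a * z + of_int b) / (of_int c * z + of_int d)) = (of_int c * z + of_int d) ^ k * f z"
    using moebius_denom_nz[OF *(3,1)] by (simp add: slash_def moebius_def automorphy_def field_simps)
qed

text \<open>The identity and S stand for the two cusps of \<open>Gamma0 13\<close>, infinity and
  0.\<close>

lemma cusp_form_tendsto:
  assumes "f \<in> cusp_forms k 13"
  shows "(f \<longlongrightarrow> 0) (filtercomap Im at_top)"
    and "((\<lambda>z. f (-1 / z) / z ^ k) \<longlongrightarrow> 0) (filtercomap Im at_top)"
proof -
  have "(slash k f A \<longlongrightarrow> 0) (filtercomap Im at_top)" if "A \<in> SL2Z" for A
    using assms that by (auto simp: cusp_forms_def)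
  from this[of "mat2 1 0 0 1"] this[of "mat2 0 (-1) 1 0"]
  show "(f \<longlongrightarrow> 0) (filtercomap Im at_top)"
    and "((\<lambda>z. f (-1 / z) / z ^ k) \<longlongrightarrow> 0) (filtercomap Im at_top)"
    by (simp_all add: mat2_SL2Z slash_def [abs_def] moebius_def automorphy_def)
qed

lemma nome_divide_two_pi_i: "nome (w / (2 * of_real pi * \<i>)) = exp w"
  by (simp add: nome_def)

lemma nome_eq_imp_periodic_eq:
  assumes "\<And>z. Im z > 0 \<Longrightarrow> h (z + 1) = (h z :: complex)" "Im z > 0" "nome w = nome z"
  shows "h w = h z"
proof -
  obtain n :: int where "2 * of_real pi * \<i> * w = 2 * of_real pi * \<i> * z + of_int (2 * n) * of_real pi * \<i>"
    using assms(3) unfolding nome_def exp_eq by auto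
  hence "2 * of_real pi * \<i> * w = 2 * of_real pi * \<i> * (z + of_int n)" by (simp add: algebra_simps)
  hence "w = z + of_int n" by (subst (asm) mult_cancel_left) auto
  thus ?thesis using periodic_of_int[of h, OF assms(1,2)] by simp
qed

text \<open>
  A periodic function tending to \<open>0\<close> at \<open>\<i>\<infinity>\<close> is a function of the nome with a removable singularity
  at \<open>0\<close>, so it decays as fast as the nome itself.
\<close>

lemma periodic_decay:
  assumes hol: "h holomorphic_on upper_half_plane"
    and T: "\<And>z. Im z > 0 \<Longrightarrow> h (z + 1) = h z"
    and lim: "(h \<longlongrightarrow> 0) (filtercomap Im at_top)"
  obtains C Y where "\<And>z. Im z \<ge> Y \<Longrightarrow> norm (h z) \<le> C * exp (- 2 * pi * Im z)"
proof -
  \<comment> \<open>The principal logarithm jumps along the negative axis, but by periodicity of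
    \<open>h\<close> the composite does not depend on the branch.\<close>
  define H where "H = (\<lambda>q. h (Ln q / (2 * of_real pi * \<i>)))"
  have H: "H (nome z) = h z" if "Im z > 0" for z
  proof -
    have "nome (Ln (nome z) / (2 * of_real pi * \<i>)) = nome z"
      unfolding nome_divide_two_pi_i by simp
    from nome_eq_imp_periodic_eq[of h, OF T that this] show ?thesis by (simp add: H_def)
  qed
  let ?D = "ball 0 1 - {0 :: complex}"
  have "\<exists>D. (H has_field_derivative D) (at q0)" if q0: "q0 \<in> ?D" for q0
  proof -
    obtain z0 where z0: "Im z0 > 0" "nome z0 = q0"
      using nome_surj[of q0] q0 by auto
    \<comment> \<open>A local inverse of \<open>nome\<close>: on \<open>U\<close> the quotient q /
      q0 stays within distance 1 of 1, where Ln is holomorphic.\<close>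
    define \<zeta> where "\<zeta> = (\<lambda>q. z0 + Ln (q / q0) / (2 * of_real pi * \<i>))"
    define U where "U = ?D \<inter> ball q0 (norm q0)"
    have U: "open U" "q0 \<in> U" using q0 by (auto simp: U_def)
    have nome_\<zeta>: "nome (\<zeta> q) = q" if "q \<in> U" for q
    proof -
      have "nome (Ln (q / q0) / (2 * of_real pi * \<i>)) = q / q0"
        unfolding nome_divide_two_pi_i using that q0 by (simp add: U_def)
      thus ?thesis using q0 by (simp add: \<zeta>_def nome_add z0)
    qed
    have Im_\<zeta>: "Im (\<zeta> q) > 0" if "q \<in> U" for q
    proof -
      have "exp (- 2 * pi * Im (\<zeta> q)) < exp 0"
        using norm_nome[of "\<zeta> q"] nome_\<zeta>[OF that] that by (simp add: U_def)
      thus ?thesis by (simp add: zero_less_mult_iff)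
    qed
    have "(\<zeta> has_field_derivative (1 / q0 / (q0 / q0)) / (2 * of_real pi * \<i>)) (at q0)"
      unfolding \<zeta>_def using q0 by (auto intro!: derivative_eq_intros)
    moreover have "h field_differentiable at (\<zeta> q0)"
      using hol open_upper_half_plane Im_\<zeta>[OF U(2)] by (auto simp: holomorphic_on_open field_differentiable_def)
    then obtain h' where "(h has_field_derivative h') (at (\<zeta> q0))"
      by (auto simp: field_differentiable_def)
    ultimately have "\<exists>D. ((\<lambda>q. h (\<zeta> q)) has_field_derivative D) (at q0)"
      using DERIV_chain2[of h h' \<zeta> q0] by blast
    moreover have "eventually (\<lambda>q. H q = h (\<zeta> q)) (nhds q0)"
      using eventually_nhds_in_open[OF U] by eventually_elim (metis H Im_\<zeta> nome_\<zeta>)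
    note DERIV_cong_ev[OF refl this refl]
    ultimately show ?thesis by simp
  qed
  hence holH: "H holomorphic_on ?D"
    by (subst holomorphic_on_open) auto
  have limH: "H \<midarrow>0\<rightarrow> 0"
    unfolding tendsto_iff eventually_at
  proof (intro allI impI)
    fix e :: real assume "e > 0"
    then obtain Y where Y: "\<And>z. Im z \<ge> Y \<Longrightarrow> norm (h z) < e"
      using lim unfolding tendsto_zero_Im_at_top_iff by blast
    have "dist (H q) 0 < e" if q: "q \<noteq> 0" "norm q < min 1 (exp (- 2 * pi * Y))" for q
    proof -
      obtain z where z: "Im z > 0" "nome z = q"
        using nome_surj[of q] q by auto
      have "exp (- 2 * pi * Im z) < exp (- 2 * pi * Y)"
        using q norm_nome[of z] z by simp
      hence "Im z \<ge> Y" by simp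
      thus ?thesis using Y[of z] H[OF z(1)] z by simp
    qed
    thus "\<exists>d>0. \<forall>x\<in>UNIV. x \<noteq> 0 \<and> dist x 0 < d \<longrightarrow> dist (H x) 0 < e"
      by (intro exI[of _ "min 1 (exp (- 2 * pi * Y))"]) auto
  qed
  define g where "g = (\<lambda>q. if q = 0 then 0 else H q)"
  have "g holomorphic_on ball 0 1"
    unfolding g_def using holH limH by (intro removable_singularity) auto
  hence "\<forall>x\<in>ball 0 1. \<exists>D. (g has_field_derivative D) (at x)"
    by (simp only: holomorphic_on_open open_ball)
  from bspec[OF this, of 0] obtain D where "(g has_field_derivative D) (at 0)" by auto
  hence "((\<lambda>q. (g q - g 0) / (q - 0)) \<longlongrightarrow> D) (at 0)"
    by (simp add: has_field_derivative_iff)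
  hence "((\<lambda>q. norm (g q / q)) \<longlongrightarrow> norm D) (at 0)"
    by (intro tendsto_norm) (simp add: g_def)
  hence "eventually (\<lambda>q. norm (g q / q) < norm D + 1) (at 0)"
    by (rule order_tendstoD) simp
  then obtain d where d: "d > 0" "\<And>q. q \<noteq> 0 \<Longrightarrow> norm q < d \<Longrightarrow> norm (g q / q) < norm D + 1"
    by (auto simp: eventually_at)
  have "((\<lambda>y. exp (- 2 * pi * y)) \<longlongrightarrow> 0) at_top"
    by (intro filterlim_compose[OF exp_at_bot] filterlim_tendsto_neg_mult_at_bot[OF tendsto_const] filterlim_ident) auto
  hence "eventually (\<lambda>y. exp (- 2 * pi * y) < d) at_top"
    using d(1) by (rule order_tendstoD(2))
  then obtain Y where Y: "\<And>y. y \<ge> Y \<Longrightarrow> exp (- 2 * pi * y) < d"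
    by (auto simp: eventually_at_top_linorder)
  have "norm (h z) \<le> (norm D + 1) * exp (- 2 * pi * Im z)" if z: "Im z \<ge> max Y 1" for z
  proof -
    have "norm (g (nome z) / nome z) < norm D + 1"
      using d(2)[of "nome z"] Y[of "Im z"] z by (simp add: norm_nome)
    moreover have "g (nome z) = h z" using H[of z] z by (simp add: g_def)
    ultimately show ?thesis
      by (simp add: norm_divide norm_nome field_simps less_imp_le)
  qed
  thus ?thesis by (rule that)
qed

text \<open>
  The trace of a weight 4 cusp form to level 1 vanishes, so the Fricke involution acts on an
  eigenform of the operator \<open>U\<close> at \<open>13\<close> as a scalar.
\<close>

lemma fricke_eigenform:
  assumes f: "f \<in> cusp_forms 4 13" and F: "qexp f F" "F \<noteq> 0"
    and U: "\<And>z. Im z > 0 \<Longrightarrow> (\<Sum>j<13. f ((z + of_nat j) / 13)) = c * f z"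
  obtains \<epsilon> where "\<epsilon> ^ 2 = 1" "mform 2 \<epsilon> f F"
proof -
  note inv = cusp_form_Gamma0[OF f]
  have hol: "f holomorphic_on upper_half_plane" by (rule qexp_holomorphic[OF F(1)])
  \<comment> \<open>\<open>g\<close> is the Fricke transform in weight 4, as 169 z^4 = (13 z^2)^2.
    \<open>L\<close> is its trace to level 1: besides the identity coset there are those of S T^j,
    which turn \<open>g\<close> into f((z + j)/13) / 169.\<close>
  define g where "g = (\<lambda>z. f (-1 / (13 * z)) / (169 * z ^ 4))"
  define L where "L = (\<lambda>z. g z + 1 / 169 * (\<Sum>j<13. f ((z + of_nat j) / 13)))"
  have L_eq: "L z = g z + c / 169 * f z" if "Im z > 0" for z
    using U[OF that] by (simp add: L_def)
  have Im13: "Im (-1 / (13 * z)) > 0" if "Im z > 0" for z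
    using that by (intro Im_uminus_inverse_pos) auto
  have hol_g: "g holomorphic_on upper_half_plane"
  proof -
    have "(\<lambda>z. -1 / (13 * z)) holomorphic_on upper_half_plane"
      by (intro holomorphic_intros) auto
    moreover have "(\<lambda>z. -1 / (13 * z)) ` upper_half_plane \<subseteq> upper_half_plane"
      using Im13 by auto
    ultimately have "(\<lambda>z. f (-1 / (13 * z))) holomorphic_on upper_half_plane"
      using holomorphic_on_compose_gen[OF _ hol] by (force simp: o_def)
    thus ?thesis unfolding g_def by (intro holomorphic_intros) auto
  qed
  have "L holomorphic_on upper_half_plane \<longleftrightarrow> (\<lambda>z. g z + c / 169 * f z) holomorphic_on upper_half_plane"
    by (intro holomorphic_cong refl) (simp add: L_eq)
  hence hol_L: "L holomorphic_on upper_half_plane"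
    by (auto intro!: holomorphic_intros hol hol_g)
  have g_T: "g (z + 1) = g z" if z: "Im z > 0" for z
  proof -
    have nz: "z \<noteq> 0" "z + 1 \<noteq> 0" using z by (auto simp: complex_eq_iff)
    define w where "w = -1 / (13 * z)"
    have w: "Im w > 0" unfolding w_def by (rule Im13[OF z])
    \<comment> \<open>The Fricke involution conjugates the translation by 1 into the matrix with
      rows (1, 0) and (-13, 1).\<close>
    have den: "of_int (- 13) * w + of_int 1 = (z + 1) / z"
      using nz by (simp add: w_def field_simps)
    have arg: "-1 / (13 * (z + 1)) = (of_int 1 * w + of_int 0) / (of_int (- 13) * w + of_int 1)"
      unfolding den using nz by (simp add: w_def)
    have "f (-1 / (13 * (z + 1))) = ((z + 1) / z) ^ 4 * f w"
      using Gamma0_13_invD[OF inv _ _ w, of 1 1 0 "-13"] unfolding arg den by simp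
    thus ?thesis using nz by (simp add: g_def w_def field_simps)
  qed
  have L_T: "L (z + 1) = L z" if "Im z > 0" for z
    using that L_eq[of z] L_eq[of "z + 1"] g_T[OF that] qexp_T[OF F(1) that] by simp
  have L_S: "L (-1 / z) = z ^ 4 * L z" if z: "Im z > 0" for z
  proof -
    have nz: "z \<noteq> 0" using z by auto
    have 1: "g (-1 / z) = z ^ 4 * (1 / 169 * f ((z + of_nat 0) / 13))"
      using nz by (simp add: g_def field_simps)
    have 2: "1 / 169 * f ((-1 / z + of_nat 0) / 13) = z ^ 4 * g z"
      using nz by (simp add: g_def field_simps)
    have "(\<Sum>j\<in>{1..<13}. f ((-1 / z + of_nat j) / 13)) =
        (\<Sum>j\<in>{1..<13}. z ^ 4 * f ((z + of_nat (neg_inverse13 j)) / 13))"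
      by (intro sum.cong refl coset_transform[OF inv _ z])
    also have "\<dots> = z ^ 4 * (\<Sum>j\<in>{1..<13}. f ((z + of_nat j) / 13))"
      unfolding sum_distrib_left
      by (rule sum.reindex_bij_betw[OF coset_bij, of "\<lambda>j. z ^ 4 * f ((z + of_nat j) / 13)"])
    finally have 3: "(\<Sum>j\<in>{1..<13}. f ((-1 / z + of_nat j) / 13)) = z ^ 4 * (\<Sum>j\<in>{1..<13}. f ((z + of_nat j) / 13))" .
    have split: "(\<Sum>j<13. t j) = t 0 + (\<Sum>j\<in>{1..<13}. t j)" for t :: "nat \<Rightarrow> complex"
      unfolding atLeastLessThan_13 by (subst sum.insert) auto
    show ?thesis
      unfolding L_def split 3 1 distrib_left 2 by (simp add: algebra_simps)
  qed
  have lim_L: "(L \<longlongrightarrow> 0) (filtercomap Im at_top)"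
    unfolding tendsto_zero_Im_at_top_iff
  proof (intro allI impI)
    fix e :: real assume e: "e > 0"
    define e' where "e' = e / (170 + norm c)"
    have e': "e' > 0" using e by (simp add: e'_def add_pos_nonneg)
    obtain Y1 where Y1: "\<And>z. Im z \<ge> Y1 \<Longrightarrow> norm (f z) < e'"
      using cusp_form_tendsto(1)[OF f] e' unfolding tendsto_zero_Im_at_top_iff by blast
    obtain Y2 where Y2: "\<And>z. Im z \<ge> Y2 \<Longrightarrow> norm (f (-1 / z) / z ^ 4) < e'"
      using cusp_form_tendsto(2)[OF f] e' unfolding tendsto_zero_Im_at_top_iff by blast
    have "norm (L z) < e" if z: "Im z \<ge> max 1 (max Y1 Y2)" for z
    proof -
      \<comment> \<open>Decay at the cusp 0 is used at the point 13 z; 13^4 / 169 = 169.\<close>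
      have "g z = 169 * (f (-1 / (13 * z)) / (13 * z) ^ 4)"
        by (simp add: g_def power_mult_distrib)
      moreover have "norm (f (-1 / (13 * z)) / (13 * z) ^ 4) < e'"
        using z by (intro Y2) simp
      ultimately have "norm (g z) < 169 * e'"
        by (simp only: norm_mult norm_numeral)
      moreover have "norm (c / 169 * f z) \<le> norm c * e'"
      proof -
        have "norm (c / 169 * f z) = norm c / 169 * norm (f z)" by (simp add: norm_mult norm_divide)
        also have "\<dots> \<le> norm c * e'"
          using Y1[of z] z e' by (intro mult_mono) auto
        finally show ?thesis .
      qed
      ultimately have "norm (L z) < 169 * e' + norm c * e'"
        unfolding L_eq[of z, OF less_le_trans[OF zero_less_one order_trans[OF max.cobounded1 z]]]
        using norm_triangle_ineq[of "g z" "c / 169 * f z"] by linarith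
      also have "\<dots> \<le> (170 + norm c) * e'" using e' by (simp add: algebra_simps)
      also have "\<dots> = e" by (simp add: e'_def add_nonneg_eq_0_iff)
      finally show ?thesis .
    qed
    thus "\<exists>Y. \<forall>z. Im z \<ge> Y \<longrightarrow> norm (L z) < e" by blast
  qed
  obtain C Y where CY: "\<And>z. Im z \<ge> Y \<Longrightarrow> norm (L z) \<le> C * exp (- 2 * pi * Im z)"
    using periodic_decay[OF hol_L L_T lim_L] by blast
  have L0: "L z = 0" if "Im z > 0" for z
  proof (rule level_one_vanishing[OF hol_L, of 4 Y C 1])
    show "norm (L (z + 1)) = norm (L z)" if "Im z > 0" for z
      using L_T[OF that] by simp
    show "norm (L (-1 / z)) = norm z ^ 4 * norm (L z)" if "Im z > 0" for z
      using L_S[OF that] by (simp add: norm_mult norm_power)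
  qed (use CY that in auto)
  \<comment> \<open>\<open>L = 0\<close> says that the Fricke transform of \<open>f\<close> is -c /
    169 times \<open>f\<close>.\<close>
  define \<epsilon> where "\<epsilon> = - c / 169"
  have fr: "f (-1 / (13 * z)) = \<epsilon> * (13 * z ^ 2) ^ 2 * f z" if z: "Im z > 0" for z
  proof -
    have nz: "z \<noteq> 0" using z by auto
    have "g z = \<epsilon> * f z"
      using L0[OF z] L_eq[OF z] by (simp add: \<epsilon>_def add_eq_0_iff)
    moreover have "(13 * z ^ 2) ^ 2 = 169 * z ^ 4"
      by (simp add: power_mult_distrib flip: power_mult)
    ultimately show ?thesis using nz by (simp add: g_def field_simps)
  qed
  obtain Y where Y: "\<And>z. Im z \<ge> Y \<Longrightarrow> Im z > 0 \<Longrightarrow> f z \<noteq> 0"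
    using qexp_eventually_nonzero[OF F] by blast
  define z where "z = Complex 0 (max 1 Y)"
  have z: "Im z > 0" by (simp add: z_def)
  have fz: "f z \<noteq> 0" using Y[of z] z by (simp add: z_def)
  have nz: "z \<noteq> 0" using z by auto
  \<comment> \<open>The involution applied twice, at a point where \<open>f\<close> is not 0, yields
    \<epsilon>^2 = 1.\<close>
  have "f z = f (-1 / (13 * (-1 / (13 * z))))" using nz by simp
  also have "\<dots> = \<epsilon> * (13 * (-1 / (13 * z)) ^ 2) ^ 2 * (\<epsilon> * (13 * z ^ 2) ^ 2 * f z)"
    unfolding fr[OF Im13[OF z]] fr[OF z] ..
  also have "\<dots> = \<epsilon> ^ 2 * ((13 * (-1 / (13 * z)) ^ 2) * (13 * z ^ 2)) ^ 2 * f z"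
    by (simp add: power2_eq_square mult_ac)
  also have "(13 * (-1 / (13 * z)) ^ 2) * (13 * z ^ 2) = 1"
    using nz by (simp add: field_simps power2_eq_square)
  finally have "\<epsilon> ^ 2 = 1" using fz by simp
  moreover have "mform 2 \<epsilon> f F"
    unfolding mform_def using F(1) inv fr by auto
  ultimately show ?thesis by (rule that)
qed

section \<open>The forms attached to the convolution sum\<close>

text \<open>Dividing by 12 = 13 - 1 normalises the constant term to 1.\<close>

definition F13 :: "complex \<Rightarrow> complex" where
  "F13 z = (13 * Eis2 (13 * z) - Eis2 z) / 12"

definition F13_fps :: "complex fps" where
  "F13_fps = fps_const (1 / 12) * (fps_const 13 * dilate_fps 13 E2_fps - E2_fps)"

lemma qexp_F13: "qexp F13 F13_fps"
proof -
  have "qexp (\<lambda>z. Eis2 (13 * z)) (dilate_fps 13 E2_fps)"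
    using qexp_dilate[OF qexp_Eis2, of 13] by simp
  from qexp_cmult[OF qexp_diff[OF qexp_cmult[OF this, of 13] qexp_Eis2], of "1 / 12"]
  show ?thesis by (simp add: F13_def [abs_def] F13_fps_def)
qed

lemma Delta_SL2:
  assumes "a * d - b * c = 1" "Im z > 0"
  shows "Delta ((of_int a * z + of_int b) / (of_int c * z + of_int d)) = (of_int c * z + of_int d) ^ 12 * Delta z"
  by (rule modular_SL2[OF Delta_T Delta_S _ assms]) auto

lemma Eis4_SL2:
  assumes "a * d - b * c = 1" "Im z > 0"
  shows "Eis4 ((of_int a * z + of_int b) / (of_int c * z + of_int d)) = (of_int c * z + of_int d) ^ 4 * Eis4 z"
  by (rule modular_SL2[OF Eis4_T Eis4_S _ assms]) auto

lemma moebius_times_13: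
  fixes z :: complex and c' :: int
  shows "13 * ((of_int a * z + of_int b) / (of_int (13 * c') * z + of_int d)) =
     (of_int a * (13 * z) + of_int (13 * b)) / (of_int c' * (13 * z) + of_int d)"
  by (simp add: algebra_simps)

lemma Gamma0_13_inv_dilate:
  assumes f: "\<And>a b c d z. a * d - b * c = 1 \<Longrightarrow> Im z > 0 \<Longrightarrow>
     f ((of_int a * z + of_int b) / (of_int c * z + of_int d)) = (of_int c * z + of_int d) ^ k * f z"
  shows "Gamma0_13_inv k (\<lambda>z. f (13 * z))"
  unfolding Gamma0_13_inv_def
proof (intro allI impI)
  fix a b c d :: int and z :: complex
  assume det: "a * d - b * c = 1" and "13 dvd c" and z: "Im z > 0"
  then obtain c' where c: "c = 13 * c'" by (elim dvdE)
  have "a * d - (13 * b) * c' = 1" using det by (simp add: c)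
  from f[OF this, of "13 * z"] z
  show "f (13 * ((of_int a * z + of_int b) / (of_int c * z + of_int d))) = (of_int c * z + of_int d) ^ k * f (13 * z)"
    unfolding c moebius_times_13 by (simp add: mult_ac)
qed

text \<open>24 pi \<i> \<open>F13\<close> is the logarithmic derivative of Delta(13z) / Delta(z),
  and this quotient is invariant because numerator and denominator both have weight 12. The anomaly
  of \<open>Eis2\<close> at general matrices is thereby bypassed.\<close>

lemma Gamma0_13_inv_F13: "Gamma0_13_inv 2 F13"
  unfolding Gamma0_13_inv_def
proof (intro allI impI)
  fix a b c d :: int and z :: complex
  assume det: "a * d - b * c = 1" and c: "13 dvd c" and z: "Im z > 0"
  define \<gamma> where "\<gamma> = (\<lambda>z. (of_int a * z + of_int b) / (of_int c * z + of_int d) :: complex)"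
  define r where "r = (\<lambda>z. Delta (13 * z) / Delta z)"
  have \<gamma>: "Im (\<gamma> w) > 0" if "Im w > 0" for w
    unfolding \<gamma>_def by (rule Im_moebius[OF that det])
  have nz: "of_int c * w + of_int d \<noteq> 0" if "Im w > 0" for w
    by (rule moebius_denom_nz[OF that det])
  have r_inv: "r (\<gamma> w) = r w" if w: "Im w > 0" for w
  proof -
    have "Delta (13 * \<gamma> w) = (of_int c * w + of_int d) ^ 12 * Delta (13 * w)"
      unfolding \<gamma>_def by (rule Gamma0_13_invD[OF Gamma0_13_inv_dilate[OF Delta_SL2] det c w])
    moreover have "Delta (\<gamma> w) = (of_int c * w + of_int d) ^ 12 * Delta w"
      unfolding \<gamma>_def by (rule Delta_SL2[OF det w])
    ultimately show ?thesis using nz[OF w] by (simp add: r_def)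
  qed
  have r_deriv: "(r has_field_derivative (24 * of_real pi * \<i> * F13 w) * r w) (at w)" if w: "Im w > 0" for w
  proof -
    have "((\<lambda>w. Delta (13 * w)) has_field_derivative 2 * of_real pi * \<i> * Eis2 (13 * w) * Delta (13 * w) * 13) (at w)"
      using w by (intro DERIV_chain2[OF has_field_derivative_Delta]) (auto intro!: derivative_eq_intros)
    from DERIV_divide[OF this has_field_derivative_Delta[OF w]]
    have "(r has_field_derivative (2 * of_real pi * \<i> * Eis2 (13 * w) * Delta (13 * w) * 13 * Delta w -
        Delta (13 * w) * (2 * of_real pi * \<i> * Eis2 w * Delta w)) / (Delta w * Delta w)) (at w)"
      by (simp add: r_def [abs_def])
    moreover have "(p * X * D' * 13 * D - D' * (p * Y * D)) / (D * D) = 12 * p * ((13 * X - Y) / 12) * (D' / D)"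
      if "D \<noteq> 0" for p X Y D D' :: complex
      using that by (simp add: field_simps)
    from this[OF Delta_nz, of "2 * of_real pi * \<i>"] have
      "(2 * of_real pi * \<i> * Eis2 (13 * w) * Delta (13 * w) * 13 * Delta w -
        Delta (13 * w) * (2 * of_real pi * \<i> * Eis2 w * Delta w)) / (Delta w * Delta w) =
       (24 * of_real pi * \<i> * F13 w) * r w"
      by (simp only: r_def F13_def) (simp only: mult.assoc [symmetric], simp)
    ultimately show ?thesis by simp
  qed
  have d\<gamma>: "(\<gamma> has_field_derivative 1 / (of_int c * z + of_int d) ^ 2) (at z)"
  proof -
    have "(\<gamma> has_field_derivative ((of_int a * (of_int c * z + of_int d) - (of_int a * z + of_int b) * of_int c) /
        ((of_int c * z + of_int d) * (of_int c * z + of_int d)))) (at z)"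
      unfolding \<gamma>_def using nz[OF z] by (auto intro!: derivative_eq_intros)
    moreover have "of_int a * (of_int c * z + of_int d) - (of_int a * z + of_int b) * of_int c = of_int (a * d - b * c)"
      by (simp add: algebra_simps)
    ultimately show ?thesis by (simp add: det power2_eq_square)
  qed
  have "((\<lambda>w. r (\<gamma> w)) has_field_derivative
      (24 * of_real pi * \<i> * F13 (\<gamma> z)) * r (\<gamma> z) * (1 / (of_int c * z + of_int d) ^ 2)) (at z)"
    by (rule DERIV_chain2[OF r_deriv[OF \<gamma>[OF z]] d\<gamma>])
  moreover have "\<forall>\<^sub>F w in nhds z. r (\<gamma> w) = r w"
    using eventually_nhds_Im_pos[OF z] by eventually_elim (rule r_inv)
  note DERIV_cong_ev[OF refl this refl]
  ultimately have "(24 * of_real pi * \<i> * F13 (\<gamma> z)) * r (\<gamma> z) * (1 / (of_int c * z + of_int d) ^ 2) =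
      (24 * of_real pi * \<i> * F13 z) * r z"
    using DERIV_unique[OF _ r_deriv[OF z]] by blast
  hence "24 * of_real pi * \<i> * r z * F13 (\<gamma> z) = 24 * of_real pi * \<i> * r z * ((of_int c * z + of_int d) ^ 2 * F13 z)"
    unfolding r_inv[OF z] using nz[OF z] by (simp add: field_simps)
  moreover have "r z \<noteq> 0" by (simp add: r_def)
  ultimately show "F13 ((of_int a * z + of_int b) / (of_int c * z + of_int d)) = (of_int c * z + of_int d) ^ 2 * F13 z"
    unfolding \<gamma>_def by (subst (asm) mult_cancel_left) auto
qed

text \<open>The linear terms of \<open>Eis2_S\<close> at z and at 13 z cancel in this combination.
  In the square the eigenvalue -1 becomes 1.\<close>

lemma mform_F13: "mform 1 (-1) F13 F13_fps"
proof -
  have "F13 (-1 / (13 * z)) = -1 * (13 * z ^ 2) ^ 1 * F13 z" if z: "Im z > 0" for z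
  proof -
    have nz: "z \<noteq> 0" using z by auto
    have "Im (13 * z) > 0" using z by simp
    from Eis2_S[OF this] Eis2_S[OF z] show ?thesis
      using nz by (simp add: F13_def) (simp add: field_simps power2_eq_square)
  qed
  thus ?thesis
    unfolding mform_def using qexp_F13 Gamma0_13_inv_F13 by simp
qed

text \<open>The Fricke involution exchanges the two series up to powers of 13; the factor 13^2 gives
  the sum eigenvalue 1, matching the square of \<open>F13\<close>.\<close>

definition Eis4_plus :: "complex \<Rightarrow> complex" where
  "Eis4_plus z = Eis4 z + 169 * Eis4 (13 * z)"

definition Eis4_plus_fps :: "complex fps" where
  "Eis4_plus_fps = E4_fps + fps_const 169 * dilate_fps 13 E4_fps"

lemma mform_Eis4_plus: "mform 2 1 Eis4_plus Eis4_plus_fps"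
proof -
  have dil: "Gamma0_13_inv 4 (\<lambda>z. Eis4 (13 * z))"
    by (rule Gamma0_13_inv_dilate) (rule Eis4_SL2)
  have "Gamma0_13_inv 4 Eis4_plus"
    using dil Eis4_SL2 unfolding Gamma0_13_inv_def Eis4_plus_def by (auto simp: algebra_simps)
  moreover have "Eis4_plus (-1 / (13 * z)) = 1 * (13 * z ^ 2) ^ 2 * Eis4_plus z" if z: "Im z > 0" for z
  proof -
    have "Im (13 * z) > 0" using z by simp
    from Eis4_S[OF this] Eis4_S[OF z] show ?thesis
      by (simp add: Eis4_plus_def power_mult_distrib algebra_simps flip: power_mult)
  qed
  moreover have "qexp (\<lambda>z. Eis4 (13 * z)) (dilate_fps 13 E4_fps)"
    using qexp_dilate[OF qexp_Eis4, of 13] by simp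
  from qexp_add[OF qexp_Eis4 qexp_cmult[OF this, of 169]]
  have "qexp Eis4_plus Eis4_plus_fps"
    by (simp add: Eis4_plus_def [abs_def] Eis4_plus_fps_def)
  ultimately show ?thesis by (simp add: mform_def)
qed

section \<open>The Hecke operator at 2 in weight 4\<close>

definition T2 :: "(complex \<Rightarrow> complex) \<Rightarrow> complex \<Rightarrow> complex" where
  "T2 f z = 8 * f (2 * z) + (f (z / 2) + f ((z + 1) / 2)) / 2"

definition T2_fps :: "complex fps \<Rightarrow> complex fps" where
  "T2_fps F = Abs_fps (\<lambda>n. fps_nth F (2 * n)) + fps_const 8 * dilate_fps 2 F"

lemma qexp_T2:
  assumes f: "qexp f F"
  shows "qexp (T2 f) (T2_fps F)"
proof -
  define f' where "f' = (\<lambda>z. (f (z / 2) + f ((z + 1) / 2)) / 2)"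
  define F' where "F' = Abs_fps (\<lambda>n. fps_nth F (2 * n))"
  have s: "(\<lambda>n. fps_nth F' n * nome z ^ n) sums f' z" if z: "Im z > 0" for z
  proof -
    define x where "x = nome (z / 2)"
    have xx: "x ^ 2 = nome z"
      using nome_of_nat_mult[of 2 "z / 2"] by (simp add: x_def)
    \<comment> \<open>z / 2 and (z + 1) / 2 have opposite nomes, so odd powers cancel in the
      average.\<close>
    have "nome (1 / 2) = -1"
      by (simp add: nome_def exp_pi_i mult.commute)
    hence mx: "nome ((z + 1) / 2) = - x"
      by (simp add: x_def add_divide_distrib nome_add)
    have Im: "Im (z / 2) > 0" "Im ((z + 1) / 2) > 0" using z by auto
    have "(\<lambda>n. fps_nth F n * x ^ n) sums f (z / 2)" "(\<lambda>n. fps_nth F n * (- x) ^ n) sums f ((z + 1) / 2)"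
      using sums_eval_fps[OF nome_in_conv_radius[OF qexpD(1)[OF f] Im(1)]]
            sums_eval_fps[OF nome_in_conv_radius[OF qexpD(1)[OF f] Im(2)]]
            qexpD(2)[OF f Im(1)] qexpD(2)[OF f Im(2)] by (simp_all add: mx x_def)
    from sums_divide[OF sums_add[OF this], of 2]
    have "(\<lambda>n. (fps_nth F n * x ^ n + fps_nth F n * (- x) ^ n) / 2) sums f' z"
      by (simp add: f'_def)
    hence "(\<lambda>n. (fps_nth F (2 * n) * x ^ (2 * n) + fps_nth F (2 * n) * (- x) ^ (2 * n)) / 2) sums f' z"
    proof (subst sums_mono_reindex[of "\<lambda>n. 2 * n" "\<lambda>n. (fps_nth F n * x ^ n + fps_nth F n * (- x) ^ n) / 2"])
      fix n :: nat assume "n \<notin> range (\<lambda>n. 2 * n)"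
      hence "odd n" by (auto elim!: evenE)
      thus "(fps_nth F n * x ^ n + fps_nth F n * (- x) ^ n) / 2 = 0"
        by (simp add: power_minus_odd)
    qed (auto simp: strict_mono_def)
    moreover have "(fps_nth F (2 * n) * x ^ (2 * n) + fps_nth F (2 * n) * (- x) ^ (2 * n)) / 2 =
        fps_nth F' n * nome z ^ n" for n
      by (simp add: F'_def power_mult xx)
    ultimately show ?thesis by simp
  qed
  have "qexp f' F'"
    using s has_q_expansion_iff[of f' "fps_nth F'"] by (simp add: has_q_expansion_def nome_def fps_nth_inverse)
  moreover have "qexp (\<lambda>z. f (2 * z)) (dilate_fps 2 F)"
    using qexp_dilate[OF f, of 2] by simp
  ultimately have "qexp (\<lambda>z. f' z + 8 * f (2 * z)) (F' + fps_const 8 * dilate_fps 2 F)"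
    by (intro qexp_add qexp_cmult)
  thus ?thesis by (simp add: T2_def [abs_def] T2_fps_def F'_def f'_def add.commute)
qed

text \<open>\<open>A\<close>, \<open>B\<close> and \<open>C\<close> belong to the three sublattices
  of index 2, with 16 = 2^4 in \<open>A\<close> to balance the scales. A matrix permutes them as its
  reduction permutes the projective line over the field of two elements. The Fricke involution
  exchanges \<open>A\<close> with \<open>B\<close> and fixes \<open>C\<close>.\<close>

lemma mform_T2:
  assumes f: "mform 2 \<epsilon> f F"
  shows "mform 2 \<epsilon> (T2 f) (T2_fps F)"
proof -
  note inv = mformD(2)[OF f] and fricke = mformD(3)[OF f]
  define A B C where "A = (\<lambda>z. 16 * f (2 * z))" and "B = (\<lambda>z. f (z / 2))" and "C = (\<lambda>z. f ((z + 1) / 2))"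
  have T2_eq: "T2 f z = (A z + B z + C z) / 2" for z
    by (simp add: T2_def A_def B_def C_def)
  have base: "f (X / Y) = (of_int c * w + of_int d) ^ 4 * f w"
    if "a * d - b * c = 1" "13 dvd c" "Im w > 0" "X = m * (of_int a * w + of_int b)"
       "Y = m * (of_int c * w + of_int d)" "m \<noteq> 0" for a b c d :: int and w m X Y
    using Gamma0_13_invD[OF inv that(1-3)] that(4-6) by simp
  have "Gamma0_13_inv 4 (T2 f)"
    unfolding Gamma0_13_inv_def
  proof (intro allI impI)
    fix a b c d :: int and z :: complex
    assume det: "a * d - b * c = 1" and c13: "13 dvd c" and z: "Im z > 0"
    define J where "J = of_int c * z + of_int d"
    define \<gamma> where "\<gamma> = (of_int a * z + of_int b) / J"
    have nz: "J \<noteq> 0" unfolding J_def by (rule moebius_denom_nz[OF z det])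
    have Im: "Im (2 * z) > 0" "Im (z / 2) > 0" "Im ((z + 1) / 2) > 0" using z by auto
    have A1: "A \<gamma> = J ^ 4 * A z" if "even c"
    proof -
      from that obtain c' where c: "c = 2 * c'" by (elim evenE)
      obtain m where "2 * c' = 13 * m" using c13 unfolding c by (elim dvdE)
      \<comment> \<open>13 * 7 m - 13 c' = 7 * 2 c' - 13 c' = c'.\<close>
      hence "c' = 13 * (7 * m - c')" by simp
      hence "13 dvd c'" by (rule dvdI)
      moreover have "a * d - (2 * b) * c' = 1" using det by (simp add: c)
      ultimately have "f ((of_int a * (2 * z) + of_int (2 * b)) / J) = J ^ 4 * f (2 * z)"
        using base[of a d "2 * b" c' "2 * z" "of_int a * (2 * z) + of_int (2 * b)" 1 J] Im
        by (simp add: J_def c mult_ac)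
      thus ?thesis by (simp add: A_def \<gamma>_def algebra_simps)
    qed
    have A2: "A \<gamma> = J ^ 4 * B z" if "odd c" "even d"
    proof -
      from that obtain d' where d: "d = 2 * d'" by (elim evenE)
      have "(2 * a) * d' - b * c = 1" using det by (simp add: d)
      from base[OF this c13 Im(2), of "2 * (of_int a * z + of_int b)" 2 J]
      have "f (2 * (of_int a * z + of_int b) / J) = (J / 2) ^ 4 * f (z / 2)"
        by (simp add: J_def d field_simps)
      thus ?thesis by (simp add: A_def B_def \<gamma>_def power_divide mult.commute)
    qed
    have A3: "A \<gamma> = J ^ 4 * C z" if "odd c" "odd d"
    proof -
      from that have "even (d - c)" by simp
      then obtain e where e: "d - c = 2 * e" by (elim evenE)
      hence d: "d = c + 2 * e" by simp
      have "(2 * a) * e - (b - a) * c = 1" using det by (simp add: d algebra_simps)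
      from base[OF this c13 Im(3), of "2 * (of_int a * z + of_int b)" 2 J]
      have "f (2 * (of_int a * z + of_int b) / J) = (J / 2) ^ 4 * f ((z + 1) / 2)"
        by (simp add: J_def d field_simps)
      thus ?thesis by (simp add: A_def C_def \<gamma>_def power_divide mult.commute)
    qed
    \<comment> \<open>Treats \<open>B\<close> and \<open>C\<close> together: the upper row is (a, b)
      for \<open>B\<close> and (a + c, b + d) for \<open>C\<close>.\<close>
    have half: "f ((of_int a' * z + of_int b') / (2 * J)) = J ^ 4 * (if even b' then B z else if even a' then A z else C z)"
      if det': "a' * d - b' * c = 1" for a' b' :: int
    proof (cases "even b'")
      case True
      then obtain e where e: "b' = 2 * e" by (elim evenE)
      have "a' * d - e * (2 * c) = 1" using det' by (simp add: e)
      from base[OF this _ Im(2), of "of_int a' * z + of_int b'" 2 "2 * J"] c13 True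
      show ?thesis by (simp add: J_def e B_def field_simps)
    next
      case b: False
      show ?thesis
      proof (cases "even a'")
        case True
        then obtain e where e: "a' = 2 * e" by (elim evenE)
        have "e * (2 * d) - b' * c = 1" using det' by (simp add: e)
        from base[OF this c13 Im(1), of "of_int a' * z + of_int b'" 1 "2 * J"]
        have "f ((of_int a' * z + of_int b') / (2 * J)) = (of_int c * (2 * z) + of_int (2 * d)) ^ 4 * f (2 * z)"
          by (simp add: J_def e algebra_simps)
        also have "of_int c * (2 * z) + of_int (2 * d) = 2 * J" by (simp add: J_def)
        finally show ?thesis using b True by (simp add: A_def power_mult_distrib)
      next
        case False
        with b have "even (b' - a')" by simp
        then obtain e where e: "b' - a' = 2 * e" by (elim evenE)
        hence b': "b' = a' + 2 * e" by simp
        have "a' * (d - c) - e * (2 * c) = 1" using det' by (simp add: b' algebra_simps)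
        moreover have num: "of_int a' * z + of_int b' = 2 * (of_int a' * ((z + 1) / 2) + of_int e)"
          by (simp add: b' field_simps)
        moreover have den: "of_int (2 * c) * ((z + 1) / 2) + of_int (d - c) = J"
          by (simp add: J_def field_simps)
        ultimately have "f ((of_int a' * z + of_int b') / (2 * J)) = J ^ 4 * f ((z + 1) / 2)"
          using base[of a' "d - c" e "2 * c" "(z + 1) / 2" "of_int a' * z + of_int b'" 2 "2 * J"] c13 Im(3)
          unfolding den by simp
        thus ?thesis using b False by (simp add: C_def)
      qed
    qed
    have Beq: "B \<gamma> = J ^ 4 * (if even b then B z else if even a then A z else C z)"
      using half[OF det] by (simp add: B_def \<gamma>_def mult.commute)
    have "(a + c) * d - (b + d) * c = 1" using det by (simp add: algebra_simps)
    from half[OF this] have Ceq: "C \<gamma> = J ^ 4 * (if even (b + d) then B z else if even (a + c) then A z else C z)"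
      using nz by (simp add: C_def \<gamma>_def J_def field_simps)
    \<comment> \<open>Odd determinant leaves the six invertible parity patterns, and each permutes
      \<open>A\<close>, \<open>B\<close>, \<open>C\<close>.\<close>
    have "odd (a * d - b * c)" using det by simp
    hence par: "odd (a * d) \<noteq> odd (b * c)" by simp
    have "A \<gamma> + B \<gamma> + C \<gamma> = J ^ 4 * (A z + B z + C z)"
      unfolding Beq Ceq using par A1 A2 A3
      by (cases "even a"; cases "even b"; cases "even c"; cases "even d") (simp_all add: algebra_simps)
    thus "T2 f ((of_int a * z + of_int b) / (of_int c * z + of_int d)) = (of_int c * z + of_int d) ^ 4 * T2 f z"
      unfolding J_def [symmetric] \<gamma>_def [symmetric] T2_eq by simp
  qed
  moreover have "T2 f (-1 / (13 * z)) = \<epsilon> * (13 * z ^ 2) ^ 2 * T2 f z" if z: "Im z > 0" for z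
  proof -
    have nz: "z \<noteq> 0" using z by auto
    have Im: "Im (2 * z) > 0" "Im (z / 2) > 0" "Im ((z + 1) / 2) > 0" using z by auto
    have A: "A (-1 / (13 * z)) = \<epsilon> * (13 * z ^ 2) ^ 2 * B z"
      using fricke[OF Im(2)] by (simp add: A_def B_def field_simps)
    have B: "B (-1 / (13 * z)) = \<epsilon> * (13 * z ^ 2) ^ 2 * A z"
      using fricke[OF Im(1)] by (simp add: A_def B_def field_simps)
    have C: "C (-1 / (13 * z)) = \<epsilon> * (13 * z ^ 2) ^ 2 * C z"
    proof -
      define w where "w = (z + 1) / 2"
      have w: "Im w > 0" using Im by (simp add: w_def)
      define v where "v = -1 / (13 * w)"
      have v: "Im v > 0" unfolding v_def using w by (intro Im_uminus_inverse_pos) auto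
      have wnz: "w \<noteq> 0" using w by auto
      have zw: "z = 2 * w - 1" by (simp add: w_def field_simps)
      \<comment> \<open>The shift by 1/2 is absorbed by the matrix with rows (7, 1) and (13, 2),
        applied to the Fricke image \<open>v\<close> of (z + 1) / 2.\<close>
      have Jv: "of_int 13 * v + of_int 2 = z / w" using wnz by (simp add: v_def zw field_simps)
      have num: "of_int 7 * v + of_int 1 = (13 * z - 1) / (26 * w)"
        using wnz by (simp add: v_def zw field_simps)
      have "(-1 / (13 * z) + 1) / 2 = (of_int 7 * v + of_int 1) / (of_int 13 * v + of_int 2)"
        unfolding Jv num using nz wnz by (simp add: field_simps)
      moreover have "f ((of_int 7 * v + of_int 1) / (of_int 13 * v + of_int 2)) = (of_int 13 * v + of_int 2) ^ 4 * f v"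
        using Gamma0_13_invD[OF inv _ _ v, of 7 2 1 13] by simp
      ultimately have "C (-1 / (13 * z)) = (z / w) ^ 4 * f v" unfolding Jv C_def by simp
      also have "f v = \<epsilon> * (13 * w ^ 2) ^ 2 * f w" unfolding v_def using fricke[OF w] by simp
      also have "(z / w) ^ 4 * (\<epsilon> * (13 * w ^ 2) ^ 2 * f w) = \<epsilon> * (13 * z ^ 2) ^ 2 * f w"
        using wnz by (simp add: field_simps eval_nat_numeral)
      finally show ?thesis by (simp add: C_def w_def)
    qed
    show ?thesis unfolding T2_eq A B C by (simp add: algebra_simps)
  qed
  ultimately show ?thesis
    unfolding mform_def using qexp_T2[OF mformD(1)[OF f]] by simp
qed

section \<open>Explicit coefficients and a basis from \<open>G13\<close> and
  \<open>T2 G13\<close>\<close>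

lemma divisor_power_sum_eval:
  assumes "n > 0"
  shows "(\<Sum>d | d dvd n. d ^ j) = (\<Sum>d\<leftarrow>filter (\<lambda>d. d dvd n) [1..<Suc n]. d ^ j :: nat)"
proof -
  have "{d. d dvd n} = set (filter (\<lambda>d. d dvd n) [1..<Suc n])"
    using assms dvd_imp_le[of _ n] dvd_pos_nat[of n] by (fastforce simp: Suc_le_eq less_Suc_eq_le)
  thus ?thesis by (simp add: sum_list_distinct_conv_sum_set del: upt_Suc)
qed

lemma sigma_fps_eval:
  "n > 0 \<Longrightarrow> fps_nth (sigma_fps j) n = of_nat (\<Sum>d\<leftarrow>filter (\<lambda>d. d dvd n) [1..<Suc n]. d ^ j)"
  unfolding sigma_fps_def fps_nth_Abs_fps by (subst divisor_power_sum_eval) auto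

lemma sigma_fps_numerals:
  "fps_nth (sigma_fps j) 2 = 1 + 2 ^ j" "fps_nth (sigma_fps j) 3 = 1 + 3 ^ j"
  "fps_nth (sigma_fps j) 4 = 1 + 2 ^ j + 4 ^ j" "fps_nth (sigma_fps j) 5 = 1 + 5 ^ j"
  "fps_nth (sigma_fps j) 6 = 1 + 2 ^ j + 3 ^ j + 6 ^ j" "fps_nth (sigma_fps j) 7 = 1 + 7 ^ j"
  "fps_nth (sigma_fps j) 8 = 1 + 2 ^ j + 4 ^ j + 8 ^ j"
proof -
  have "[Suc 0..<n] = 1 # [2..<n]" if "1 < n" for n :: nat
    using that by (simp add: upt_conv_Cons numeral_2_eq_2)
  note this [simp]
  show "fps_nth (sigma_fps j) 2 = 1 + 2 ^ j" "fps_nth (sigma_fps j) 3 = 1 + 3 ^ j"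
    "fps_nth (sigma_fps j) 4 = 1 + 2 ^ j + 4 ^ j" "fps_nth (sigma_fps j) 5 = 1 + 5 ^ j"
    "fps_nth (sigma_fps j) 6 = 1 + 2 ^ j + 3 ^ j + 6 ^ j" "fps_nth (sigma_fps j) 7 = 1 + 7 ^ j"
    "fps_nth (sigma_fps j) 8 = 1 + 2 ^ j + 4 ^ j + 8 ^ j"
    by (simp_all add: sigma_fps_eval upt_rec_numeral)
qed

lemma E2_fps_nth: "n > 0 \<Longrightarrow> fps_nth E2_fps n = - 24 * fps_nth (sigma_fps 1) n"
  by (simp add: E2_fps_def)

lemma E2_fps_nth_0 [simp]: "fps_nth E2_fps 0 = 1"
  by (simp add: E2_fps_def)

lemma F13_fps_nth:
  "fps_nth F13_fps 0 = 1"
  "\<not> 13 dvd n \<Longrightarrow> fps_nth F13_fps n = 2 * fps_nth (sigma_fps 1) n"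
  by (simp add: F13_fps_def dilate_fps_def) (cases "n = 0"; simp add: F13_fps_def dilate_fps_def E2_fps_nth)

lemma Eis4_plus_fps_nth:
  "fps_nth Eis4_plus_fps 0 = 170"
  "\<not> 13 dvd n \<Longrightarrow> fps_nth Eis4_plus_fps n = 240 * fps_nth (sigma_fps 3) n"
  by (simp add: Eis4_plus_fps_def dilate_fps_def E4_fps_eq) (cases "n = 0"; simp add: Eis4_plus_fps_def dilate_fps_def E4_fps_eq)

text \<open>The factor \<open>17 / 4\<close> makes the coefficients integral; the constant terms cancel.\<close>

definition G13 :: "complex \<Rightarrow> complex" where
  "G13 z = 17 / 4 * (F13 z * F13 z) - 1 / 40 * Eis4_plus z"

definition G13_fps :: "complex fps" where
  "G13_fps = fps_const (17 / 4) * (F13_fps * F13_fps) - fps_const (1 / 40) * Eis4_plus_fps"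

lemma mform_G13: "mform 2 1 G13 G13_fps"
proof -
  have "mform 2 1 (\<lambda>z. F13 z * F13 z) (F13_fps * F13_fps)"
    using mform_mult[OF mform_F13 mform_F13] by (simp add: numeral_2_eq_2)
  thus ?thesis
    unfolding G13_def [abs_def] G13_fps_def by (intro mform_diff mform_cmult mform_Eis4_plus)
qed

lemma F13_numerals:
  "fps_nth F13_fps (Suc 0) = 2" "fps_nth F13_fps 2 = 6" "fps_nth F13_fps 3 = 8" "fps_nth F13_fps 4 = 14"
  "fps_nth F13_fps 5 = 12" "fps_nth F13_fps 6 = 24" "fps_nth F13_fps 7 = 16" "fps_nth F13_fps 8 = 30"
  by (simp_all add: F13_fps_nth sigma_fps_numerals)

lemma sum_0_upto_numerals:
  fixes t :: "nat \<Rightarrow> complex"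
  shows "sum t {0..Suc 0} = t 0 + t 1" "sum t {0..2} = t 0 + t 1 + t 2" "sum t {0..3} = t 0 + t 1 + t 2 + t 3"
    "sum t {0..4} = t 0 + t 1 + t 2 + t 3 + t 4" "sum t {0..5} = t 0 + t 1 + t 2 + t 3 + t 4 + t 5"
    "sum t {0..6} = t 0 + t 1 + t 2 + t 3 + t 4 + t 5 + t 6"
    "sum t {0..8} = t 0 + t 1 + t 2 + t 3 + t 4 + t 5 + t 6 + t 7 + t 8"
  by (simp_all add: eval_nat_numeral atLeast0_atMost_Suc)

text \<open>The indices 6 and 8 feed the coefficients of q^3 and q^4 in
  \<open>T2_fps G13_fps\<close>.\<close>

lemma G13_fps_numerals:
  "fps_nth G13_fps 0 = 0" "fps_nth G13_fps (Suc 0) = 11" "fps_nth G13_fps 2 = 14" "fps_nth G13_fps 3 = 2"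
  "fps_nth G13_fps 4 = -30" "fps_nth G13_fps 6 = -118" "fps_nth G13_fps 8 = -110"
  by (simp_all add: G13_fps_def fps_mult_nth sum_0_upto_numerals F13_fps_nth(1) F13_numerals
        Eis4_plus_fps_nth sigma_fps_numerals)

lemma T2_G13_numerals:
  "fps_nth (T2_fps G13_fps) 0 = 0" "fps_nth (T2_fps G13_fps) (Suc 0) = 14" "fps_nth (T2_fps G13_fps) 2 = 58"
  "fps_nth (T2_fps G13_fps) 3 = -118" "fps_nth (T2_fps G13_fps) 4 = 2"
  by (simp_all add: T2_fps_def dilate_fps_def G13_fps_numerals G13_fps_numerals(3)[unfolded numeral_2_eq_2])

text \<open>The constants are chosen so that \<open>B1 = q + O(q\<^sup>3)\<close> and \<open>B2 = q\<^sup>2 + O(q\<^sup>3)\<close>.\<close>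

definition B1 :: "complex \<Rightarrow> complex" where
  "B1 z = 58 / 442 * G13 z - 14 / 442 * T2 G13 z"

definition B2 :: "complex \<Rightarrow> complex" where
  "B2 z = 11 / 442 * T2 G13 z - 14 / 442 * G13 z"

definition B1_fps :: "complex fps" where
  "B1_fps = fps_const (58 / 442) * G13_fps - fps_const (14 / 442) * T2_fps G13_fps"

definition B2_fps :: "complex fps" where
  "B2_fps = fps_const (11 / 442) * T2_fps G13_fps - fps_const (14 / 442) * G13_fps"

lemma mform_B: "mform 2 1 B1 B1_fps" "mform 2 1 B2 B2_fps"
  unfolding B1_def [abs_def] B1_fps_def B2_def [abs_def] B2_fps_def
  by (intro mform_diff mform_cmult mform_T2 mform_G13)+

lemma B_fps_numerals:
  "fps_nth B1_fps 0 = 0" "fps_nth B1_fps (Suc 0) = 1" "fps_nth B1_fps 2 = 0" "fps_nth B1_fps 3 = 4" "fps_nth B1_fps 4 = -4"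
  "fps_nth B2_fps 0 = 0" "fps_nth B2_fps (Suc 0) = 0" "fps_nth B2_fps 2 = 1" "fps_nth B2_fps 3 = -3" "fps_nth B2_fps 4 = 1"
  by (simp_all add: B1_fps_def B2_fps_def G13_fps_numerals T2_G13_numerals)

text \<open>Inverts the linear system behind \<open>B1\<close> and \<open>B2\<close>. Its
  determinant is 442 = 11 * 58 - 14 * 14, from the coefficients of q and q^2 in \<open>G13\<close>
  (11, 14) and in \<open>T2 G13\<close> (14, 58).\<close>

lemma G13_fps_eq: "G13_fps = fps_const 11 * B1_fps + fps_const 14 * B2_fps"
  by (rule fps_ext) (simp add: B1_fps_def B2_fps_def field_simps)

text \<open>
  If \<open>V\<close> is the combination of the basis with the same first two coefficients as \<open>F\<close> and \<open>d\<close> is the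
  difference of the third coefficients, then \<open>F\<^sup>2 - V\<^sup>2 - 2 d B2\<^sup>2\<close> has Fricke eigenvalue \<open>1\<close> and
  vanishes to order 5, hence is \<open>0\<close>. Its coefficient at \<open>5\<close> is \<open>2 d (\<mu> + 6)\<close>.
\<close>

lemma eigenform_fps_unique:
  assumes f: "mform 2 \<epsilon> f F" "\<epsilon> ^ 2 = 1"
    and F: "fps_nth F 0 = 0" "fps_nth F (Suc 0) = 1" "fps_nth F 2 = \<mu>" "fps_nth F 4 = \<mu> ^ 2 - 8"
    and \<mu>: "\<mu> ^ 2 - \<mu> - 4 = 0"
  shows "F = B1_fps + fps_const \<mu> * B2_fps"
proof -
  define V where "V = B1_fps + fps_const \<mu> * B2_fps"
  define v where "v = (\<lambda>z. B1 z + \<mu> * B2 z)"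
  have v: "mform 2 1 v V"
    unfolding v_def V_def by (intro mform_add mform_cmult mform_B)
  have \<mu>2: "\<mu> ^ 2 = \<mu> + 4" using \<mu> by (simp add: algebra_simps)
  hence \<mu>\<mu>: "\<mu> * \<mu> = \<mu> + 4" by (simp add: power2_eq_square)
  have V: "fps_nth V 0 = 0" "fps_nth V (Suc 0) = 1" "fps_nth V 2 = \<mu>" "fps_nth V 4 = fps_nth F 4"
    by (simp_all add: V_def B_fps_numerals F \<mu>2)
  define d where "d = fps_nth F 3 - fps_nth V 3"
  have F3: "fps_nth F 3 = fps_nth V 3 + d" by (simp add: d_def)
  define H where "H = F * F - V * V - fps_const (2 * d) * (B2_fps * B2_fps)"
  \<comment> \<open>Forms can be subtracted only at equal Fricke eigenvalue, and that of
    \<open>f\<close> may be -1; squares all have eigenvalue 1.\<close>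
  have "\<epsilon> * \<epsilon> = 1" using f(2) by (simp add: power2_eq_square)
  hence "mform 4 1 (\<lambda>z. f z * f z) (F * F)"
    using mform_mult[OF f(1) f(1)] by simp
  moreover have "mform 4 1 (\<lambda>z. v z * v z) (V * V)" "mform 4 1 (\<lambda>z. B2 z * B2 z) (B2_fps * B2_fps)"
    using mform_mult[OF v v] mform_mult[OF mform_B(2) mform_B(2)] by simp_all
  ultimately have H: "mform 4 1 (\<lambda>z. f z * f z - v z * v z - 2 * d * (B2 z * B2 z)) H"
    unfolding H_def by (intro mform_diff mform_cmult)
  have H_low: "fps_nth H i = 0" if "i < 5" for i
  proof -
    from that have "i = 0 \<or> i = Suc 0 \<or> i = 2 \<or> i = 3 \<or> i = 4" by auto
    thus ?thesis
      by (elim disjE) (simp_all add: H_def fps_mult_nth sum_0_upto_numerals F V F3 B_fps_numerals algebra_simps)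
  qed
  \<comment> \<open>Weight 8 means h = 4, and 7 * 4 < 6 * 5.\<close>
  have H0: "H = 0"
    by (rule level_13_vanishing[OF H _ H_low]) auto
  \<comment> \<open>Without constant terms, the coefficient of q^5 in a square involves indices 1 to
    4 only, where \<open>d\<close> is the sole unknown.\<close>
  have "fps_nth H 5 = 2 * d * (\<mu> + 6)"
    by (simp add: H_def fps_mult_nth sum_0_upto_numerals F V(1-3) V(4)[unfolded F] F3 B_fps_numerals algebra_simps)
  hence "d = 0 \<or> \<mu> + 6 = 0" by (simp add: H0)
  moreover have "\<mu> + 6 \<noteq> 0"
  proof
    assume "\<mu> + 6 = 0"
    hence "\<mu> = -6" by (simp add: eq_neg_iff_add_eq_0)
    with \<mu> show False by simp
  qed
  ultimately have "d = 0" by blast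
  with H0 have "(F - V) * (F + V) = 0" by (simp add: H_def algebra_simps)
  moreover have "F + V \<noteq> 0"
  proof
    assume "F + V = 0"
    hence "fps_nth (F + V) (Suc 0) = 0" by simp
    thus False by (simp add: F V)
  qed
  ultimately show ?thesis by (simp add: V_def)
qed

section \<open>Newforms of level 13 in terms of \<open>B1\<close> and \<open>B2\<close>\<close>

lemma hecke_2_13: "hecke_op 4 13 2 f z = T2 f z"
proof -
  have "{a. a dvd 2 \<and> coprime a 13} = {1, 2 :: nat}"
  proof -
    have "coprime 2 (13 :: nat)" by (simp add: coprime_iff_gcd_eq_1 gcd_non_0_nat)
    moreover have "a = 1 \<or> a = 2" if "a dvd 2" for a :: nat
      using that dvd_imp_le[of a 2] by (cases a rule: nat.exhaust) (auto simp: le_Suc_eq numeral_2_eq_2)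
    ultimately show ?thesis by auto
  qed
  thus ?thesis
    by (simp add: hecke_op_def T2_def lessThan_Suc numeral_2_eq_2 field_simps)
qed

lemma hecke_13_13: "hecke_op 4 13 13 f z = (\<Sum>j<13. f ((z + of_nat j) / 13)) / 13"
proof -
  have "{a. a dvd 13 \<and> coprime a 13} = {1 :: nat}"
    by (auto simp: coprime_absorb_left)
  thus ?thesis by (simp add: hecke_op_def)
qed

lemma cusp_form_fps_0:
  assumes "f \<in> cusp_forms 4 13" "qexp f F"
  shows "fps_nth F 0 = 0"
proof -
  have "((\<lambda>y. f (Complex 0 y)) \<longlongrightarrow> 0) at_top"
    unfolding tendsto_iff
  proof (intro allI impI)
    fix e :: real assume "e > 0"
    then obtain Y where "\<And>z. Im z \<ge> Y \<Longrightarrow> norm (f z) < e"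
      using cusp_form_tendsto(1)[OF assms(1)] unfolding tendsto_zero_Im_at_top_iff by blast
    thus "eventually (\<lambda>y. dist (f (Complex 0 y)) 0 < e) at_top"
      by (intro eventually_mono[OF eventually_ge_at_top[of Y]]) auto
  qed
  moreover have "eventually (\<lambda>y. f (Complex 0 y) = eval_fps F (nome (Complex 0 y))) at_top"
    by (intro eventually_mono[OF eventually_gt_at_top[of 0]]) (auto intro: qexpD(2)[OF assms(2)])
  ultimately have "((\<lambda>y. eval_fps F (nome (Complex 0 y))) \<longlongrightarrow> 0) at_top"
    by (rule Lim_transform_eventually)
  moreover have "isCont (eval_fps F) 0"
    using qexpD(1)[OF assms(2)] by (intro continuous_eval_fps) (auto intro: less_le_trans[of _ 1])
  from isCont_tendsto_compose[OF this nome_tendsto_0]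
  have "((\<lambda>y. eval_fps F (nome (Complex 0 y))) \<longlongrightarrow> fps_nth F 0) at_top"
    by (simp add: eval_fps_at_0)
  ultimately show ?thesis
    by (rule tendsto_unique [OF trivial_limit_at_top_linorder, THEN sym])
qed

text \<open>The eigenvalue equation at 2 supplies the coefficient of q^4, the one at 13 the Fricke
  symmetry.\<close>

lemma primitive_form_fps:
  assumes prim: "primitive_form 4 13 f" and \<tau>: "has_q_expansion f \<tau>"
    and \<mu>: "\<tau> 2 = \<mu>" "\<mu> ^ 2 - \<mu> - 4 = 0"
  shows "Abs_fps \<tau> = B1_fps + fps_const \<mu> * B2_fps"
proof -
  define F where "F = Abs_fps \<tau>"
  have F: "qexp f F" using \<tau> by (simp add: F_def has_q_expansion_iff)
  have cusp: "f \<in> cusp_forms 4 13"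
    using prim by (simp add: primitive_form_def new_subspace_def)
  obtain a where a: "has_q_expansion f a" "a 1 = 1"
    using prim by (auto simp: primitive_form_def)
  have "F = Abs_fps a"
    using a(1) by (intro qexp_unique[OF F]) (auto simp: has_q_expansion_iff)
  hence F1: "fps_nth F (Suc 0) = 1" using a(2) by simp
  hence Fnz: "F \<noteq> 0" by auto
  have F2: "fps_nth F 2 = \<mu>" using \<mu> by (simp add: F_def)
  have hecke: "\<exists>c. \<forall>z\<in>upper_half_plane. hecke_op 4 13 n f z = c * f z" if "n > 0" for n
    using prim that by (auto simp: primitive_form_def hecke_eigenform_def)
  obtain c where "\<forall>z\<in>upper_half_plane. hecke_op 4 13 2 f z = c * f z"
    using hecke[of 2] by auto
  hence c: "\<And>z. Im z > 0 \<Longrightarrow> T2 f z = c * f z"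
    by (simp add: hecke_2_13)
  have T2F: "T2_fps F = fps_const c * F"
    by (rule qexp_unique[OF qexp_T2[OF F] qexp_cmult[OF F] c])
  \<comment> \<open>At q the relation identifies the eigenvalue as \<mu>; at q^2 it makes the
    coefficient of q^4 equal to \<mu>^2 - 2^3.\<close>
  have "fps_nth (T2_fps F) (Suc 0) = c" "fps_nth (T2_fps F) 2 = c * \<mu>"
    unfolding T2F by (simp_all add: F1 F2)
  hence "fps_nth F 2 = c" "fps_nth F 4 + 8 * fps_nth F (Suc 0) = c * \<mu>"
    by (simp_all add: T2_fps_def dilate_fps_def)
  hence F4: "fps_nth F 4 = \<mu> ^ 2 - 8"
    by (simp add: F1 F2 power2_eq_square algebra_simps)
  obtain c' where "\<forall>z\<in>upper_half_plane. hecke_op 4 13 13 f z = c' * f z"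
    using hecke[of 13] by auto
  hence c': "\<And>z. Im z > 0 \<Longrightarrow> (\<Sum>j<13. f ((z + of_nat j) / 13)) / 13 = c' * f z"
    by (simp add: hecke_13_13)
  have "(\<Sum>j<13. f ((z + of_nat j) / 13)) = (13 * c') * f z" if "Im z > 0" for z
    using c'[OF that] by simp
  then obtain \<epsilon> where "\<epsilon> ^ 2 = 1" "mform 2 \<epsilon> f F"
    using fricke_eigenform[OF cusp F Fnz] by blast
  thus ?thesis
    using eigenform_fps_unique[OF _ _ cusp_form_fps_0[OF cusp F] F1 F2 F4 \<mu>(2)] by (simp add: F_def)
qed

section \<open>The convolution sum as a coefficient of a product\<close>

lemma divisor_sigma_nat: "of_nat (divisor_sigma j (real n)) = fps_nth (sigma_fps j) n"
  by (cases "n = 0") (simp_all add: divisor_sigma_def sigma_fps_def)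

lemma divisor_sigma_div: "of_nat (divisor_sigma j (real n / 13)) = fps_nth (dilate_fps 13 (sigma_fps j)) n"
proof (cases "13 dvd n")
  case True
  then obtain m where m: "n = 13 * m" by (elim dvdE)
  hence "real n / 13 = real m" by simp
  thus ?thesis using divisor_sigma_nat[of j m] by (simp add: dilate_fps_def m)
next
  case False
  have "real n / 13 \<notin> \<nat>"
  proof
    assume "real n / 13 \<in> \<nat>"
    then obtain m where "real n / 13 = real m" by (auto elim!: Nats_cases)
    hence "real n = real (13 * m)" by simp
    hence "n = 13 * m" by (simp only: of_nat_eq_iff)
    with False show False by simp
  qed
  thus ?thesis using False by (simp add: divisor_sigma_def dilate_fps_def)
qed

text \<open>The additional terms of the Cauchy product vanish: both series have constant term 0, and
  the dilated one lives on multiples of 13.\<close>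

lemma conv_sum_13_fps:
  "of_nat (conv_sum 13 n) = fps_nth (dilate_fps 13 (sigma_fps 1) * sigma_fps 1) n"
proof -
  define s where "s = fps_nth (sigma_fps 1)"
  have set_eq: "{m. 0 < m \<and> real m < real n / real 13} = {m. 0 < m \<and> 13 * m < n}"
  proof -
    have "real m < real n / real 13 \<longleftrightarrow> real (13 * m) < real n" for m
      by (simp add: field_simps)
    thus ?thesis by (simp only: of_nat_less_iff)
  qed
  have inj: "inj_on ((*) 13) {m :: nat. 0 < m \<and> 13 * m < n}" by (auto intro: inj_onI)
  have "of_nat (conv_sum 13 n) = (\<Sum>m | 0 < m \<and> 13 * m < n. s m * s (n - 13 * m))"
    unfolding conv_sum_def set_eq of_nat_sum
  proof (rule sum.cong[OF refl])
    fix m assume "m \<in> {m. 0 < m \<and> 13 * m < n}"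
    hence "real n - real 13 * real m = real (n - 13 * m)" by (simp add: of_nat_diff)
    thus "of_nat (divisor_sigma 1 (real m) * divisor_sigma 1 (real n - real 13 * real m)) = s m * s (n - 13 * m)"
      by (simp only: of_nat_mult divisor_sigma_nat s_def)
  qed
  also have "\<dots> = (\<Sum>i\<in>(*) 13 ` {m. 0 < m \<and> 13 * m < n}. fps_nth (dilate_fps 13 (sigma_fps 1)) i * s (n - i))"
    by (subst sum.reindex[OF inj]) (simp add: dilate_fps_def s_def)
  also have "\<dots> = (\<Sum>i=0..n. fps_nth (dilate_fps 13 (sigma_fps 1)) i * s (n - i))"
  proof (rule sum.mono_neutral_left)
    show "\<forall>i\<in>{0..n} - (*) 13 ` {m. 0 < m \<and> 13 * m < n}. fps_nth (dilate_fps 13 (sigma_fps 1)) i * s (n - i) = 0"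
    proof
      fix i assume i: "i \<in> {0..n} - (*) 13 ` {m. 0 < m \<and> 13 * m < n}"
      show "fps_nth (dilate_fps 13 (sigma_fps 1)) i * s (n - i) = 0"
      proof (cases "13 dvd i \<and> i \<noteq> 0")
        case True
        then obtain m where "i = 13 * m" "m > 0" by auto
        with i have "n - i = 0" by (auto simp: image_iff)
        thus ?thesis by (simp add: s_def)
      qed (auto simp: dilate_fps_def)
    qed
  qed auto
  finally show ?thesis by (simp add: fps_mult_nth s_def)
qed

text \<open>Ramanujan's identity at 13 z. Arguing with functions spares a proof that
  \<open>dilate_fps\<close> is multiplicative.\<close>

lemma dilate_E2_fps_square:
  "dilate_fps 13 E2_fps ^ 2 = dilate_fps 13 E4_fps + fps_const 12 * dilate_fps 13 (fps_X * fps_deriv E2_fps)"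
proof (rule qexp_unique)
  show "qexp (\<lambda>z. Eis2 (of_nat 13 * z) ^ 2) (dilate_fps 13 E2_fps ^ 2)"
    by (intro qexp_power qexp_dilate qexp_Eis2) simp
  show "qexp (\<lambda>z. Eis4 (of_nat 13 * z) + 12 * theta_Eis2 (of_nat 13 * z))
      (dilate_fps 13 E4_fps + fps_const 12 * dilate_fps 13 (fps_X * fps_deriv E2_fps))"
    by (intro qexp_add qexp_cmult qexp_dilate qexp_Eis4 qexp_theta_Eis2) simp_all
  show "Eis2 (of_nat 13 * z) ^ 2 = Eis4 (of_nat 13 * z) + 12 * theta_Eis2 (of_nat 13 * z)" if "Im z > 0" for z
    using that by (simp add: Eis4_eq)
qed

text \<open>Each divisor series is 1 - P or 1 - P' over 24, so 14976 = 26 * 24^2. After polarisation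
  the three squares are expressed by \<open>E4_fps\<close>, the derivatives and
  \<open>G13_fps\<close>.\<close>

lemma sigma_product_fps:
  defines "P \<equiv> E2_fps" and "P' \<equiv> dilate_fps 13 E2_fps"
    and "Q \<equiv> E4_fps" and "Q' \<equiv> dilate_fps 13 E4_fps"
    and "D \<equiv> fps_X * fps_deriv E2_fps" and "D' \<equiv> dilate_fps 13 (fps_X * fps_deriv E2_fps)"
  shows "fps_const 14976 * (dilate_fps 13 (sigma_fps 1) * sigma_fps 1) =
     fps_const 26 * (1 - P - P') + (Q + fps_const 12 * D) + fps_const 169 * (Q' + fps_const 12 * D')
     - fps_const (576 / 17) * G13_fps - fps_const (144 / 170) * (Q + fps_const 169 * Q')"
proof -
  define S S' where "S = sigma_fps 1" and "S' = dilate_fps 13 (sigma_fps 1)"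
  have P: "P = 1 - 24 * S"
    by (simp add: P_def E2_fps_def S_def numeral_fps_const)
  have P': "P' = 1 - 24 * S'"
    by (rule fps_ext) (auto simp: P'_def S'_def dilate_fps_def E2_fps_def numeral_fps_const)
  have Q: "P ^ 2 = Q + 12 * D"
    by (simp add: P_def Q_def D_def E4_fps_def numeral_fps_const)
  have Q': "P' ^ 2 = Q' + 12 * D'"
    unfolding P'_def Q'_def D'_def dilate_E2_fps_square by (simp add: numeral_fps_const)
  have F: "12 * F13_fps = 13 * P' - P"
    by (rule fps_ext) (simp add: F13_fps_def P_def P'_def numeral_fps_const)
  \<comment> \<open>Clears the denominators of \<open>G13\<close>: 680 * 17 / 4 = 2890 and 680 / 40
    = 17.\<close>
  have G: "680 * G13_fps = 2890 * (F13_fps * F13_fps) - 17 * (Q + 169 * Q')"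
    by (rule fps_ext) (simp add: G13_fps_def Eis4_plus_fps_def Q_def Q'_def numeral_fps_const algebra_simps)
  have "2890 * ((12 * F13_fps) * (12 * F13_fps)) = 144 * (680 * G13_fps + 17 * (Q + 169 * Q'))"
    unfolding G by (simp add: algebra_simps)
  hence FG: "2890 * (13 * P' - P) ^ 2 = 144 * (680 * G13_fps + 17 * (Q + 169 * Q'))"
    unfolding F power2_eq_square .
  have "2890 * (14976 * (S' * S)) = 2890 * (26 * ((1 - P) * (1 - P')))"
    unfolding P P' by (simp add: algebra_simps)
  also have "\<dots> = 2890 * (26 * (1 - P - P') + P ^ 2 + 169 * P' ^ 2) - 2890 * (13 * P' - P) ^ 2"
    by (simp add: algebra_simps power2_eq_square)
  also have "\<dots> = 2890 * (26 * (1 - P - P') + (Q + 12 * D) + 169 * (Q' + 12 * D'))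
      - 144 * (680 * G13_fps + 17 * (Q + 169 * Q'))"
    unfolding FG Q Q' ..
  finally have "fps_const 2890 * (fps_const 14976 * (S' * S)) = fps_const 2890 * (fps_const 26 * (1 - P - P') + (Q + fps_const 12 * D)
      + fps_const 169 * (Q' + fps_const 12 * D')
     - fps_const (576 / 17) * G13_fps - fps_const (144 / 170) * (Q + fps_const 169 * Q'))"
    by (simp add: fps_eq_iff numeral_fps_const field_simps)
  thus ?thesis unfolding S_def S'_def by simp
qed

theorem theorem3:
  fixes u :: complex and \<Delta>\<^sub>2 \<Delta>\<^sub>3 :: "complex \<Rightarrow> complex" and \<tau>\<^sub>2 \<tau>\<^sub>3 :: "nat \<Rightarrow> complex"
    and n :: nat
  assumes "u ^ 2 - u - 4 = 0"
    and "primitive_form 4 13 \<Delta>\<^sub>2" and "has_q_expansion \<Delta>\<^sub>2 \<tau>\<^sub>2" and "\<tau>\<^sub>2 2 = 1 - u"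
    and "primitive_form 4 13 \<Delta>\<^sub>3" and "has_q_expansion \<Delta>\<^sub>3 \<tau>\<^sub>3" and "\<tau>\<^sub>3 2 = u"
    and "n > 0"
  shows "of_nat (conv_sum 13 n) =
      1 / 408 * of_nat (divisor_sigma 3 (real n)) + 169 / 408 * of_nat (divisor_sigma 3 (real n / 13))
    - 1 / 52 * of_nat n * of_nat (divisor_sigma 1 (real n))
    - 1 / 4 * of_nat n * of_nat (divisor_sigma 1 (real n / 13))
    + 1 / 24 * of_nat (divisor_sigma 1 (real n)) + 1 / 24 * of_nat (divisor_sigma 1 (real n / 13))
    + (u - 6) / 442 * \<tau>\<^sub>2 n - (u + 5) / 442 * \<tau>\<^sub>3 n"
proof -
  have u: "u ^ 2 = u + 4" using assms(1) by (simp add: algebra_simps)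
  have "(1 - u) ^ 2 - (1 - u) - 4 = 0" using u by (simp add: power2_eq_square algebra_simps)
  note T2 = primitive_form_fps[OF assms(2,3,4) this] and T3 = primitive_form_fps[OF assms(5,6,7) assms(1)]
  have \<tau>2: "\<tau>\<^sub>2 n = fps_nth B1_fps n + (1 - u) * fps_nth B2_fps n"
    using arg_cong[OF T2, of "\<lambda>F. fps_nth F n"] by simp
  have \<tau>3: "\<tau>\<^sub>3 n = fps_nth B1_fps n + u * fps_nth B2_fps n"
    using arg_cong[OF T3, of "\<lambda>F. fps_nth F n"] by simp
  \<comment> \<open>x = 6 - u and y = u + 5 solve x + y = 11 and (1 - u) x + u y = 14, the
    coordinates of \<open>G13\<close> with respect to \<open>B1\<close> and
    \<open>B2\<close>.\<close>
  have "(6 - u) * \<tau>\<^sub>2 n + (u + 5) * \<tau>\<^sub>3 n =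
      11 * fps_nth B1_fps n + (6 - 2 * u + 2 * u ^ 2) * fps_nth B2_fps n"
    unfolding \<tau>2 \<tau>3 by (simp add: power2_eq_square algebra_simps)
  also have "6 - 2 * u + 2 * u ^ 2 = 14" using u by simp
  finally have "(6 - u) * \<tau>\<^sub>2 n + (u + 5) * \<tau>\<^sub>3 n = 11 * fps_nth B1_fps n + 14 * fps_nth B2_fps n" .
  hence G: "fps_nth G13_fps n = (6 - u) * \<tau>\<^sub>2 n + (u + 5) * \<tau>\<^sub>3 n"
    by (simp add: G13_fps_eq)
  define s s' t t' where "s = fps_nth (sigma_fps 1) n" and "s' = fps_nth (dilate_fps 13 (sigma_fps 1)) n"
    and "t = fps_nth (sigma_fps 3) n" and "t' = fps_nth (dilate_fps 13 (sigma_fps 3)) n"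
  have P: "fps_nth E2_fps n = - 24 * s" using assms(8) by (simp add: E2_fps_nth s_def)
  have P': "fps_nth (dilate_fps 13 E2_fps) n = - 24 * s'"
    using assms(8) by (auto simp: dilate_fps_def E2_fps_nth s'_def elim!: dvdE)
  have Q: "fps_nth E4_fps n = 240 * t" using assms(8) by (simp add: E4_fps_eq t_def)
  have Q': "fps_nth (dilate_fps 13 E4_fps) n = 240 * t'"
    using assms(8) by (auto simp: dilate_fps_def E4_fps_eq t'_def elim!: dvdE)
  have theta: "fps_nth (fps_X * fps_deriv E2_fps) m = of_nat m * fps_nth E2_fps m" for m
    by (cases m) auto
  have D: "fps_nth (fps_X * fps_deriv E2_fps) n = - 24 * of_nat n * s"
    unfolding theta P by simp
  \<comment> \<open>The derivative is taken before dilation, so it multiplies by n / 13 instead of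
    n.\<close>
  have D': "fps_nth (dilate_fps 13 (fps_X * fps_deriv E2_fps)) n = - 24 / 13 * of_nat n * s'"
  proof (cases "13 dvd n")
    case True
    then obtain m where m: "n = 13 * m" by (elim dvdE)
    hence "m > 0" using assms(8) by simp
    have dil: "fps_nth (dilate_fps 13 K) n = fps_nth K m" for K
      by (simp add: dilate_fps_def m)
    show ?thesis
      unfolding dil theta s'_def E2_fps_nth[OF \<open>m > 0\<close>] by (simp add: m)
  qed (simp add: dilate_fps_def s'_def)
  have "14976 * of_nat (conv_sum 13 n) = 26 * (24 * s + 24 * s') + (240 * t + 12 * (- 24 * of_nat n * s)) +
      169 * (240 * t' + 12 * (- 24 / 13 * of_nat n * s')) - 576 / 17 * fps_nth G13_fps n
      - 144 / 170 * (240 * t + 169 * (240 * t'))"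
    using arg_cong[OF sigma_product_fps, of "\<lambda>F. fps_nth F n"] assms(8)
    unfolding conv_sum_13_fps
    by (simp only: fps_mult_left_const_nth fps_add_nth fps_sub_nth P P' Q Q' D D' fps_one_nth) simp
  \<comment> \<open>Since 14976 = 26 * 576, the factor 576 / 17 becomes 1 / 442, and 240 (1 - 144 /
    170) becomes 1 / 408.\<close>
  also have "\<dots> = 14976 * (1 / 408 * t + 169 / 408 * t' - 1 / 52 * of_nat n * s - 1 / 4 * of_nat n * s'
      + 1 / 24 * s + 1 / 24 * s' + (u - 6) / 442 * \<tau>\<^sub>2 n - (u + 5) / 442 * \<tau>\<^sub>3 n)"
    unfolding G by (simp add: field_simps)
  finally show ?thesis
    unfolding divisor_sigma_nat divisor_sigma_div s_def [symmetric] s'_def [symmetric] t_def [symmetric] t'_def [symmetric]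
    by (subst (asm) mult_cancel_left) simp
qed

end
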